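(* Let $\mathscr{B}\subset\mathbb{N}$ be infinite and primitive, and let $Y:=\{x\in\{0,1\}^{\mathbb{Z}} : |\operatorname{supp}x \bmod b|=b-1\text{ for each }b\in\mathscr{B}\}$. The following conditions are equivalent: (a) $\mathscr{B}$ is taut; (b) $\mathcal{P}(S,Y\cap\widetilde{X}_\eta)\neq\emptyset$; (c) $\nu_\eta(Y\cap X_\eta)=1$.
   Context: $\mathbb{N}=\{1,2,\dots\}$. For $\mathscr{B}\subset\mathbb{N}$ let $\mathcal{M}_{\mathscr{B}}:=\bigcup_{b\in\mathscr{B}}b\mathbb{Z}$, $\mathcal{F}_{\mathscr{B}}:=\mathbb{Z}\setminus\mathcal{M}_{\mathscr{B}}$; $\eta\in\{0,1\}^{\mathbb{Z}}$ is the characteristic function of $\mathcal{F}_{\mathscr{B}}$. $\mathscr{B}$ is primitive if no element of $\mathscr{B}$ divides another element of $\mathscr{B}$. $\operatorname{supp}x:=\{n\in\mathbb{Z}: x(n)=1\}$ and $\operatorname{supp}x\bmod b$ is its image in $\mathbb{Z}/b\mathbb{Z}$. $S$ is the left shift on $\{0,1\}^{\mathbb{Z}}$ (product topology), and $X_\eta$ is the closure of $\{S^m\eta : m\in\mathbb{Z}\}$. A subshift $X\subset\{0,1\}^{\mathbb{Z}}$ (closed, $S$-invariant set) is hereditary if $x\in X$ and $y\le x$ coordinatewise imply $y\in X$; $\widetilde{X}_\eta$ is the smallest hereditary subshift containing $X_\eta$. For a Borel $S$-invariant set $Z$, $\mathcal{P}(S,Z)$ is the set of $S$-invariant Borel probability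 measures on $Z$ ($Y$ is Borel and $S$-invariant). Mirsky measure: let $G$ be the closure of $\{(n \bmod b)_{b\in\mathscr{B}} : n\in\mathbb{Z}\}$ in the compact group $\prod_{b\in\mathscr{B}}\mathbb{Z}/b\mathbb{Z}$, let $\mathbb{P}$ be the normalized Haar measure of $G$, and define $\varphi\colon G\to\{0,1\}^{\mathbb{Z}}$ by $\varphi(g)(n)=1$ iff $n\not\equiv -g_b \bmod b$ for all $b\in\mathscr{B}$ (and $0$ otherwise); then $\nu_\eta:=\varphi_*(\mathbb{P})$. The logarithmic density of $A\subset\mathbb{Z}$ is $\boldsymbol{\delta}(A)=\lim_{N\to\infty}\frac{1}{\log N}\sum_{a\in A,1\le a\le N}\frac1a$ when the limit exists; it always exists for $A=\mathcal{M}_{\mathscr{B}}$ (Davenport–Erdős). $\mathscr{B}$ is taut if $\boldsymbol{\delta}(\mathcal{M}_{\mathscr{B}\setminus\{b\}})<\boldsymbol{\delta}(\mathcal{M}_{\mathscr{B}})$ for each $b\in\mathscr{B}$. *)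

theory Defs
  imports "HOL-Probability.Probability" "HOL-Algebra.Product_Groups"
    "HOL-Algebra.Elementary_Groups" "HOL-Number_Theory.Cong"
begin

section \<open>Sets of multiples and logarithmic density\<close>

definition multiples :: "nat set \<Rightarrow> int set" where
  "multiples B = (\<Union>b\<in>B. {n. int b dvd n})"

definition free_set :: "nat set \<Rightarrow> int set" where
  "free_set B = UNIV - multiples B"

definition primitive_set :: "nat set \<Rightarrow> bool" where
  "primitive_set B \<longleftrightarrow> (\<forall>a\<in>B. \<forall>b\<in>B. a \<noteq> b \<longrightarrow> \<not> a dvd b)"

text \<open>The value is unspecified if the limit does not exist; for \<open>A = multiples B\<close> it always
  exists, by the theorem of Davenport and Erdos.\<close>

definition log_density :: "int set \<Rightarrow> real" where
  "log_density A = lim (\<lambda>N::nat. (\<Sum>a\<in>A \<inter> {1..int N}. 1 / real_of_int a) / ln (real N))"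

definition taut :: "nat set \<Rightarrow> bool" where
  "taut B \<longleftrightarrow> (\<forall>b\<in>B. log_density (multiples (B - {b})) < log_density (multiples B))"


section \<open>Subshifts\<close>

text \<open>A point of \<open>{0,1}\<^sup>\<int>\<close> is a function \<open>int \<Rightarrow> bool\<close>, with \<open>True\<close> for 1 and \<open>False\<close> for 0. The
  library instances supply the product of discrete topologies on this type and the coordinatewise
  order induced by \<open>False < True\<close>.\<close>

type_synonym bi_seq = "int \<Rightarrow> bool"

definition shift_pow :: "int \<Rightarrow> bi_seq \<Rightarrow> bi_seq" where
  "shift_pow m x = (\<lambda>n. x (n + m))"

definition lshift :: "bi_seq \<Rightarrow> bi_seq" where
  "lshift x = (\<lambda>n. x (n + 1))"

lemma shift_pow_eq_funpow:
  "shift_pow (int k) = lshift ^^ k" "shift_pow (- int k) = inv_into UNIV lshift ^^ k"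
proof -
  have "inv_into UNIV lshift = shift_pow (- 1)"
    by (rule inv_equality) (auto simp: lshift_def shift_pow_def)
  moreover have "shift_pow (int k) = lshift ^^ k" "shift_pow (- int k) = shift_pow (- 1) ^^ k" for k
    by (induction k) (auto simp: fun_eq_iff lshift_def shift_pow_def algebra_simps)
  ultimately show "shift_pow (int k) = lshift ^^ k" "shift_pow (- int k) = inv_into UNIV lshift ^^ k"
    by auto
qed

definition supp :: "bi_seq \<Rightarrow> int set" where
  "supp x = {n. x n}"

definition subshift :: "bi_seq set \<Rightarrow> bool" where
  "subshift X \<longleftrightarrow> closed X \<and> lshift ` X = X"

definition hereditary :: "bi_seq set \<Rightarrow> bool" where
  "hereditary X \<longleftrightarrow> (\<forall>x\<in>X. \<forall>y. y \<le> x \<longrightarrow> y \<in> X)"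

definition eta :: "nat set \<Rightarrow> bi_seq" where
  "eta B = (\<lambda>n. n \<in> free_set B)"

definition X_eta :: "nat set \<Rightarrow> bi_seq set" where
  "X_eta B = closure (range (\<lambda>m. shift_pow m (eta B)))"

definition X_eta_her :: "nat set \<Rightarrow> bi_seq set" where
  "X_eta_her B = \<Inter>{X. subshift X \<and> hereditary X \<and> X_eta B \<subseteq> X}"

lemma bij_lshift: "bij lshift"
  by (rule o_bij[of "shift_pow (- 1)"]) (auto simp: fun_eq_iff lshift_def shift_pow_def)

lemma X_eta_her_smallest:
  "subshift (X_eta_her B)" "hereditary (X_eta_her B)" "X_eta B \<subseteq> X_eta_her B"
  "subshift X \<Longrightarrow> hereditary X \<Longrightarrow> X_eta B \<subseteq> X \<Longrightarrow> X_eta_her B \<subseteq> X"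
proof -
  let ?C = "{X. subshift X \<and> hereditary X \<and> X_eta B \<subseteq> X}"
  have "?C \<noteq> {}"
    using bij_lshift by (auto simp: subshift_def hereditary_def bij_def intro!: exI[of _ UNIV])
  then have "lshift ` \<Inter>?C = \<Inter>((`) lshift ` ?C)"
    using bij_image_INT[OF bij_lshift, of "\<lambda>X. X" ?C] by simp
  also have "(`) lshift ` ?C = ?C"
    by (auto simp: subshift_def image_iff intro!: exI)
  finally show "subshift (X_eta_her B)"
    unfolding X_eta_her_def subshift_def by (auto intro!: closed_Inter)
qed (auto simp: X_eta_her_def hereditary_def)

text \<open>For positive \<open>b\<close>, \<open>n mod int b\<close> is the representative of the class of \<open>n\<close> in
  \<open>{0..<int b}\<close>, so the image below is in bijection with the image of the support in \<open>\<int>/b\<int>\<close>.\<close>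

definition Y_set :: "nat set \<Rightarrow> bi_seq set" where
  "Y_set B = {x. \<forall>b\<in>B. card ((\<lambda>n. n mod int b) ` supp x) = b - 1}"

text \<open>The measures have the set \<open>Z\<close> itself as underlying space, with the trace of the Borel
  sigma-algebra.\<close>

definition invariant_probs :: "bi_seq set \<Rightarrow> bi_seq measure set" where
  "invariant_probs Z = {\<mu>. prob_space \<mu> \<and> sets \<mu> = sets (restrict_space borel Z) \<and>
     lshift \<in> measurable \<mu> \<mu> \<and> distr \<mu> \<mu> lshift = \<mu>}"


section \<open>The Mirsky measure\<close>

text \<open>Normalized Haar measure of a compact metrizable group \<open>H\<close> with topology \<open>T\<close> on its carrier.
  Regularity is automatic for finite Borel measures on compact metrizable spaces.\<close>

definition normalized_haar :: "('a, 'm) monoid_scheme \<Rightarrow> 'a topology \<Rightarrow> 'a measure" where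
  "normalized_haar H T = (THE P. prob_space P \<and>
     space P = topspace T \<and> sets P = sigma_sets (topspace T) {U. openin T U} \<and>
     (\<forall>g\<in>carrier H. \<forall>A\<in>sets P. emeasure P ((\<lambda>x. g \<otimes>\<^bsub>H\<^esub> x) ` A) = emeasure P A))"

definition residue_topology :: "nat set \<Rightarrow> (nat \<Rightarrow> int) topology" where
  "residue_topology B = product_topology (\<lambda>b. discrete_topology (carrier (integer_mod_group b))) B"

definition odometer_set :: "nat set \<Rightarrow> (nat \<Rightarrow> int) set" where
  "odometer_set B = residue_topology B closure_of range (\<lambda>n. \<lambda>b\<in>B. n mod int b)"

definition odometer_group :: "nat set \<Rightarrow> (nat \<Rightarrow> int) monoid" where
  "odometer_group B = (product_group B integer_mod_group)\<lparr>carrier := odometer_set B\<rparr>"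

definition odometer_haar :: "nat set \<Rightarrow> (nat \<Rightarrow> int) measure" where
  "odometer_haar B =
     normalized_haar (odometer_group B) (subtopology (residue_topology B) (odometer_set B))"

definition phi :: "nat set \<Rightarrow> (nat \<Rightarrow> int) \<Rightarrow> bi_seq" where
  "phi B g = (\<lambda>n. \<forall>b\<in>B. [n \<noteq> - g b] (mod int b))"

definition mirsky :: "nat set \<Rightarrow> bi_seq measure" where
  "mirsky B = distr (odometer_haar B) borel (phi B)"

end

theory Submission
  imports Defs "HOL-Real_Asymp.Real_Asymp"
begin

text \<open>
  All densities are read off from the probability measures \<open>P\<^sub>s\<close> on the positive integers
  proportional to \<open>n\<close> to the power \<open>- s\<close>, for \<open>s > 1\<close>. Let \<open>free_density C\<close> be the infimum over
  \<open>s > 1\<close> of the \<open>P\<^sub>s\<close>-probability that no element of \<open>C\<close> divides \<open>n\<close>. Under \<open>P\<^sub>s\<close> any two functions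
  that decrease along divisibility are positively correlated (\<open>zeta_correlation\<close>). This one
  inequality shows that the probability increases with \<open>s\<close>, so that the infimum is the limit at \<open>1\<close>
  and is continuous under truncation of \<open>C\<close> (two infima commute), and it gives Behrend's inequality
  \<open>free_density_Un\<close>. As \<open>1 / n\<close> is at most \<open>exp 1\<close> times the \<open>s\<close>-weight for \<open>n \<le> N\<close> and
  \<open>s = 1 + 1 / ln N\<close>, the set of multiples of \<open>C\<close> has logarithmic density \<open>1 - free_density C\<close>
  (\<open>log_density_multiples\<close>, the theorem of Davenport and Erdos). Removing \<open>b\<close> from \<open>B\<close> loses no
  density iff \<open>free_density\<close> vanishes at the numbers \<open>c div gcd c b\<close>, where \<open>c\<close> runs through the rest
  of \<open>B\<close> (\<open>taut_iff\<close>).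

  Suppose that \<open>B\<close> is primitive and not taut. Splitting these quotients according to \<open>gcd c b\<close>,
  Behrend's inequality produces a proper divisor \<open>d\<close> of some \<open>b \<in> B\<close> such that almost every multiple
  of \<open>d\<close> is divisible by an element of \<open>B\<close> other than \<open>b\<close> (\<open>not_taut_imp_free_density_eq_0\<close>). A point \<open>x\<close> of \<open>Y\<close>
  misses exactly one class modulo each \<open>b\<close>, and on the hereditary closure these classes are
  consistent, so they define an equivariant map to the odometer; its image measure is uniform by
  invariance. Hence almost every \<open>x\<close> misses a whole class modulo \<open>d\<close>, thus at least two classes
  modulo \<open>b\<close>, contradicting \<open>x \<in> Y\<close>. So an invariant measure forces \<open>B\<close> to be taut
  (\<open>invariant_prob_imp_taut\<close>).

  Conversely let \<open>B\<close> be taut. Behrend's inequality bounds below the density of the free integers in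
  each nonzero class modulo \<open>b \<in> B\<close>, and ergodicity of the odometer lets the orbit of almost every
  point hit each such class at a free position; this puts the Mirsky measure on \<open>Y\<close>
  (\<open>AE_phi_in_Y_set\<close>). It lives on \<open>X_eta\<close> whether or not \<open>B\<close> is taut: up to a set of small \<open>P\<^sub>s\<close>-probability
  \<open>eta\<close> coincides with its periodic truncations, so a pattern that never occurs in \<open>eta\<close> has
  density zero (\<open>AE_phi_in_X_eta\<close>). Restricting the Mirsky measure then gives an invariant measure
  on \<open>Y \<inter> X_eta_her\<close>, which closes the circle of implications.
\<close>

section \<open>Correlation of divisibility-decreasing functions\<close>

text \<open>
  Zero is excluded as a multiple because every number divides it.
\<close>

definition dvd_antimono :: "(nat \<Rightarrow> real) \<Rightarrow> bool" where
  "dvd_antimono f \<longleftrightarrow> (\<forall>d n. d dvd n \<longrightarrow> 0 < n \<longrightarrow> f n \<le> f d)"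

lemma dvd_antimonoD: "dvd_antimono f \<Longrightarrow> d dvd n \<Longrightarrow> 0 < n \<Longrightarrow> f n \<le> f d"
  by (auto simp: dvd_antimono_def)

lemma dvd_antimono_mult_left:
  assumes "dvd_antimono f" "0 < c"
  shows "dvd_antimono (\<lambda>n. f (c * n))"
  using assms by (auto simp: dvd_antimono_def)

text \<open>
  Indices \<open>i\<close> and \<open>k - i\<close> together contribute \<open>(a i - a (k - i)) * (b i - b (k - i))\<close>, a product of
  two factors of the same sign.
\<close>

lemma sum_reversed_pairing_le:
  fixes a b :: "nat \<Rightarrow> real"
  assumes a: "\<And>i j. i \<le> j \<Longrightarrow> a j \<le> a i" and b: "\<And>i j. i \<le> j \<Longrightarrow> b j \<le> b i"
  shows "(\<Sum>i\<le>k. a i * b (k - i)) \<le> (\<Sum>i\<le>k. a i * b i)"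
proof -
  have rev: "(\<Sum>i\<le>k. h (k - i)) = (\<Sum>i\<le>k. h i)" for h :: "nat \<Rightarrow> real"
    by (rule sum.reindex_bij_witness[of _ "\<lambda>i. k - i" "\<lambda>i. k - i"]) auto
  have "0 \<le> (\<Sum>i\<le>k. (a i - a (k - i)) * (b i - b (k - i)))"
  proof (rule sum_nonneg)
    fix i
    show "0 \<le> (a i - a (k - i)) * (b i - b (k - i))"
      using a[of i "k - i"] a[of "k - i" i] b[of i "k - i"] b[of "k - i" i]
      by (cases "i \<le> k - i") (auto intro: mult_nonneg_nonneg mult_nonpos_nonpos)
  qed
  also have "\<dots> = (\<Sum>i\<le>k. a i * b i) + (\<Sum>i\<le>k. a (k - i) * b (k - i))
      - (\<Sum>i\<le>k. a i * b (k - i)) - (\<Sum>i\<le>k. a (k - i) * b i)"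
    by (simp add: algebra_simps sum.distrib sum_subtractf)
  also have "(\<Sum>i\<le>k. a (k - i) * b (k - i)) = (\<Sum>i\<le>k. a i * b i)"
    by (rule rev)
  also have "(\<Sum>i\<le>k. a (k - i) * b i) = (\<Sum>i\<le>k. a i * b (k - i))"
    using rev[of "\<lambda>i. a i * b (k - i)"] by (simp cong: sum.cong_simp)
  finally show ?thesis by simp
qed

lemma bij_betw_divisors_prime_power_mult:
  fixes p M :: nat
  assumes p: "prime p" "\<not> p dvd M" and M: "0 < M"
  shows "bij_betw (\<lambda>(i, e). p ^ i * e) ({..k} \<times> {e. e dvd M}) {d. d dvd p ^ k * M}"
proof (rule bij_betw_imageI)
  have nd: "\<not> p dvd e" if "e dvd M" for e
    using p that dvd_trans by blast
  show "inj_on (\<lambda>(i, e). p ^ i * e) ({..k} \<times> {e. e dvd M})"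
  proof (rule inj_onI, clarsimp)
    fix i e i' e' assume *: "e dvd M" "e' dvd M" "p ^ i * e = p ^ i' * e'"
    have mult: "multiplicity p (p ^ j * x) = j" if "x dvd M" for j x
      using p nd[OF that] by (auto intro!: multiplicity_eqI simp: prime_gt_0_nat)
    have "i = i'" using mult[of e i] mult[of e' i'] * by simp
    then show "i = i' \<and> e = e'" using * p by (auto simp: prime_gt_0_nat)
  qed
  show "(\<lambda>(i, e). p ^ i * e) ` ({..k} \<times> {e. e dvd M}) = {d. d dvd p ^ k * M}"
  proof (intro equalityI subsetI)
    fix d assume "d \<in> {d. d dvd p ^ k * M}"
    then have d: "d dvd p ^ k * M" by simp
    then obtain a e where ae: "d = a * e" "a dvd p ^ k" "e dvd M"
      using division_decomp by blast
    then obtain i where "i \<le> k" "a = p ^ i"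
      using p divides_primepow_nat by blast
    then show "d \<in> (\<lambda>(i, e). p ^ i * e) ` ({..k} \<times> {e. e dvd M})"
      using ae by (auto intro!: image_eqI[of _ _ "(i, e)"])
  qed (auto intro!: mult_dvd_mono le_imp_power_dvd)
qed

text \<open>
  Pairing each divisor with its complement reverses the order on every prime exponent, so one prime
  power can be treated at a time: the coprime part is handled by induction, the exponents of the
  remaining prime by the rearrangement inequality above.
\<close>

lemma sum_complementary_divisors_le:
  assumes "0 < N" "dvd_antimono f" "dvd_antimono g"
  shows "(\<Sum>d | d dvd N. f d * g (N div d)) \<le> (\<Sum>d | d dvd N. f d * g d)"
  using assms
proof (induction N arbitrary: f g rule: less_induct)
  case (less N)
  show ?case
  proof (cases "N = 1")
    case False
    then obtain p where p: "prime p" "p dvd N"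
      using prime_factor_nat by blast
    obtain M where M: "N = p ^ multiplicity p N * M" "\<not> p dvd M"
      using multiplicity_decompose'[of N p] less.prems p by (metis not_prime_unit not_gr_zero)
    define k where "k = multiplicity p N"
    have k: "k > 0" using p less.prems by (simp add: k_def prime_multiplicity_gt_zero_iff)
    have N: "N = p ^ k * M" using M by (simp add: k_def)
    have M0: "0 < M" using less.prems N by auto
    have "p ^ k > 1" using k p prime_gt_1_nat by (metis one_less_power)
    then have MN: "M < N" using N M0 by simp
    have p0: "p > 0" using p prime_gt_0_nat by simp
    have fin: "finite {e. e dvd M}" using M0 by simp
    note bij = bij_betw_divisors_prime_power_mult[OF p(1) M(2) M0, of k]
    have reindex: "(\<Sum>d | d dvd N. h d) = (\<Sum>i\<le>k. \<Sum>e | e dvd M. h (p ^ i * e))" for h :: "nat \<Rightarrow> real"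
      unfolding N sum.reindex_bij_betw[OF bij, symmetric]
      by (simp add: case_prod_unfold sum.cartesian_product)
    have "(\<Sum>d | d dvd N. f d * g (N div d))
        = (\<Sum>i\<le>k. \<Sum>e | e dvd M. f (p ^ i * e) * g (p ^ (k - i) * (M div e)))"
      unfolding reindex
    proof (intro sum.cong refl)
      fix i e assume "i \<in> {..k}" "e \<in> {e. e dvd M}"
      then have i: "i \<le> k" and e: "e dvd M" by auto
      have "p ^ k = p ^ i * p ^ (k - i)" using i by (simp flip: power_add)
      then have "N div (p ^ i * e) = p ^ (k - i) * (M div e)"
        using p0 e by (auto simp: N elim!: dvdE)
      then show "f (p ^ i * e) * g (N div (p ^ i * e)) = f (p ^ i * e) * g (p ^ (k - i) * (M div e))"
        by simp
    qed
    also have "\<dots> \<le> (\<Sum>i\<le>k. \<Sum>e | e dvd M. f (p ^ i * e) * g (p ^ (k - i) * e))"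
      using p0 less.prems by (intro sum_mono less.IH[OF MN M0] dvd_antimono_mult_left) auto
    also have "\<dots> = (\<Sum>e | e dvd M. \<Sum>i\<le>k. f (p ^ i * e) * g (p ^ (k - i) * e))"
      by (rule sum.swap)
    also have "\<dots> \<le> (\<Sum>e | e dvd M. \<Sum>i\<le>k. f (p ^ i * e) * g (p ^ i * e))"
    proof (rule sum_mono)
      fix e assume e: "e \<in> {e. e dvd M}"
      have mono: "h (p ^ j * e) \<le> h (p ^ i * e)" if "dvd_antimono h" "i \<le> j" for h i j
        using that e M0 p0 by (intro dvd_antimonoD) (auto intro: mult_dvd_mono le_imp_power_dvd dvd_pos_nat)
      show "(\<Sum>i\<le>k. f (p ^ i * e) * g (p ^ (k - i) * e)) \<le> (\<Sum>i\<le>k. f (p ^ i * e) * g (p ^ i * e))"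
        using sum_reversed_pairing_le[of "\<lambda>i. f (p ^ i * e)" "\<lambda>i. g (p ^ i * e)" k] mono less.prems
        by auto
    qed
    also have "\<dots> = (\<Sum>d | d dvd N. f d * g d)"
      unfolding reindex by (rule sum.swap)
    finally show ?thesis .
  qed auto
qed

text \<open>
  The library value \<open>0 powr a = 0\<close> makes the weight of the integer \<open>0\<close> vanish, so sums over all
  natural numbers are sums over the positive ones.
\<close>

definition zeta_weight :: "real \<Rightarrow> nat \<Rightarrow> real" where
  "zeta_weight s n = real n powr (- s)"

definition zeta_sum :: "real \<Rightarrow> real" where
  "zeta_sum s = (\<Sum>\<^sub>\<infinity>n. zeta_weight s n)"

definition zeta_pmf :: "real \<Rightarrow> nat pmf" where
  "zeta_pmf s = embed_pmf (\<lambda>n. zeta_weight s n / zeta_sum s)"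

abbreviation zeta_prob :: "real \<Rightarrow> nat set \<Rightarrow> real" where
  "zeta_prob s A \<equiv> measure_pmf.prob (zeta_pmf s) A"

abbreviation zeta_expectation :: "real \<Rightarrow> (nat \<Rightarrow> real) \<Rightarrow> real" where
  "zeta_expectation s f \<equiv> measure_pmf.expectation (zeta_pmf s) f"

lemma zeta_weight_nonneg [simp]: "0 \<le> zeta_weight s n"
  by (simp add: zeta_weight_def)

lemma zeta_weight_0 [simp]: "zeta_weight s 0 = 0"
  by (simp add: zeta_weight_def)

lemma zeta_weight_1 [simp]: "zeta_weight s 1 = 1" "zeta_weight s (Suc 0) = 1"
  by (simp_all add: zeta_weight_def)

lemma zeta_weight_mult: "zeta_weight s (a * b) = zeta_weight s a * zeta_weight s b"
  by (simp add: zeta_weight_def powr_mult)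

context
  fixes s :: real assumes s: "1 < s"
begin

lemma summable_zeta_weight: "zeta_weight s summable_on A"
proof -
  have "summable (zeta_weight s)"
    using s summable_real_powr_iff[of "- s"] by (simp add: zeta_weight_def[abs_def])
  then have "zeta_weight s summable_on UNIV"
    by (simp add: summable_on_UNIV_nonneg_real_iff)
  then show ?thesis by (rule summable_on_subset_banach) simp
qed

lemma zeta_sum_ge_1: "1 \<le> zeta_sum s"
  using finite_sum_le_infsum[OF summable_zeta_weight, of "{1}" UNIV]
  by (simp add: zeta_sum_def)

lemma zeta_sum_pos: "0 < zeta_sum s" "zeta_sum s \<noteq> 0"
  using zeta_sum_ge_1 by linarith+

lemma pmf_zeta: "pmf (zeta_pmf s) n = zeta_weight s n / zeta_sum s"
  unfolding zeta_pmf_def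
proof (rule pmf_embed_pmf)
  have "((\<lambda>n. zeta_weight s n / zeta_sum s) has_sum 1) UNIV"
    using has_sum_cmult_left[OF has_sum_infsum[OF summable_zeta_weight[of UNIV]], of "1 / zeta_sum s"] zeta_sum_pos
    by (simp add: zeta_sum_def)
  then have "(\<lambda>n. zeta_weight s n / zeta_sum s) sums 1"
    by (rule has_sum_imp_sums)
  then have "(\<Sum>n. ennreal (zeta_weight s n / zeta_sum s)) = ennreal 1"
    using zeta_sum_pos by (intro suminf_ennreal_eq) (auto intro!: divide_nonneg_nonneg simp: less_imp_le)
  then show "(\<integral>\<^sup>+n. ennreal (zeta_weight s n / zeta_sum s) \<partial>count_space UNIV) = 1"
    by (simp add: nn_integral_count_space_nat)
qed (use zeta_sum_pos in \<open>auto intro!: divide_nonneg_nonneg simp: less_imp_le\<close>)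

lemma expectation_zeta:
  assumes "\<And>n. \<bar>f n\<bar> \<le> 1"
  shows "zeta_expectation s f = (\<Sum>\<^sub>\<infinity>n\<in>{0<..}. zeta_weight s n * f n) / zeta_sum s"
proof -
  have *: "(\<lambda>n. norm (zeta_weight s n / zeta_sum s)) summable_on UNIV"
    using zeta_sum_pos summable_on_cmult_left[OF summable_zeta_weight[of UNIV], of "1 / zeta_sum s"]
    by simp
  have "(\<lambda>n. norm (pmf (zeta_pmf s) n * f n)) summable_on UNIV"
    by (rule Infinite_Sum.abs_summable_on_comparison_test[OF *])
       (use zeta_sum_pos assms in \<open>auto simp: pmf_zeta abs_mult intro!: mult_left_le divide_right_mono\<close>)
  then have "zeta_expectation s f = (\<Sum>\<^sub>\<infinity>n. pmf (zeta_pmf s) n * f n)"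
    unfolding pmf_expectation_eq_infsetsum
    by (rule infsetsum_infsum[OF abs_summable_equivalent[THEN iffD1]])
  also have "\<dots> = (\<Sum>\<^sub>\<infinity>n. zeta_weight s n * f n / zeta_sum s)"
    by (simp add: pmf_zeta)
  also have "\<dots> = (\<Sum>\<^sub>\<infinity>n. zeta_weight s n * f n) / zeta_sum s"
    using infsum_cmult_left'[of "\<lambda>n. zeta_weight s n * f n" "1 / zeta_sum s" UNIV] by simp
  also have "(\<Sum>\<^sub>\<infinity>n. zeta_weight s n * f n) = (\<Sum>\<^sub>\<infinity>n\<in>{0<..}. zeta_weight s n * f n)"
    by (rule infsum_cong_neutral) auto
  finally show ?thesis .
qed

text \<open>
  The weight of a pair depends only on its product \<open>n\<close>, so independent pairs can be grouped by \<open>n\<close>: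
  given the product, the first entry is a uniformly distributed divisor of \<open>n\<close>.
\<close>

lemma infsum_zeta_weight_pairs:
  fixes h :: "nat \<Rightarrow> nat \<Rightarrow> real"
  assumes h: "\<And>a b. \<bar>h a b\<bar> \<le> 1"
  shows "(\<lambda>(a, b). zeta_weight s a * zeta_weight s b * h a b) summable_on {0<..} \<times> {0<..}"
    and "(\<Sum>\<^sub>\<infinity>(a, b)\<in>{0<..} \<times> {0<..}. zeta_weight s a * zeta_weight s b * h a b)
       = (\<Sum>\<^sub>\<infinity>n\<in>{0<..}. zeta_weight s n * (\<Sum>d | d dvd n. h d (n div d)))"
    and "(\<lambda>n. zeta_weight s n * (\<Sum>d | d dvd n. h d (n div d))) summable_on {0<..}"
proof -
  let ?P = "{0<..} :: nat set"
  have sum1: "(\<lambda>x. norm (case x of (a, b) \<Rightarrow> zeta_weight s a * zeta_weight s b)) summable_on ?P \<times> ?P"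
    using Infinite_Sum.abs_summable_on_Sigma_iff[of "\<lambda>(a, b). zeta_weight s a * zeta_weight s b" ?P "\<lambda>_. ?P"]
      summable_zeta_weight[of ?P]
    by (simp add: abs_mult infsum_cmult_right' summable_on_cmult_right summable_on_cmult_left)
  have sum2: "(\<lambda>x. norm (case x of (a, b) \<Rightarrow> zeta_weight s a * zeta_weight s b * h a b)) summable_on ?P \<times> ?P"
    by (rule Infinite_Sum.abs_summable_on_comparison_test[OF sum1]) (auto simp: abs_mult h intro!: mult_left_le)
  then show sum3: "(\<lambda>(a, b). zeta_weight s a * zeta_weight s b * h a b) summable_on ?P \<times> ?P"
    using summable_on_iff_abs_summable_on_real by blast
  have bij: "bij_betw (\<lambda>(n, d). (d, n div d)) (SIGMA n:?P. {d. d dvd n}) (?P \<times> ?P)"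
    by (rule bij_betw_byWitness[of _ "\<lambda>(a, b). (a * b, a)"])
       (auto intro: dvd_pos_nat simp: div_greater_zero_iff dvd_imp_le)
  have eq: "(case (case x of (n, d) \<Rightarrow> (d, n div d)) of (a, b) \<Rightarrow> zeta_weight s a * zeta_weight s b * h a b)
      = (case x of (n, d) \<Rightarrow> zeta_weight s n * h d (n div d))" if "x \<in> (SIGMA n:?P. {d. d dvd n})" for x
    using that by (auto simp flip: zeta_weight_mult)
  have sum4: "(\<lambda>(n, d). zeta_weight s n * h d (n div d)) summable_on (SIGMA n:?P. {d. d dvd n})"
    using sum3 unfolding summable_on_reindex_bij_betw[OF bij, symmetric]
    by (subst summable_on_cong[OF eq[symmetric]]) auto
  have "(\<Sum>\<^sub>\<infinity>(a, b)\<in>?P \<times> ?P. zeta_weight s a * zeta_weight s b * h a b)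
      = (\<Sum>\<^sub>\<infinity>(n, d)\<in>(SIGMA n:?P. {d. d dvd n}). zeta_weight s n * h d (n div d))"
    unfolding infsum_reindex_bij_betw[OF bij, symmetric] by (rule infsum_cong[OF eq])
  also have "\<dots> = (\<Sum>\<^sub>\<infinity>n\<in>?P. \<Sum>\<^sub>\<infinity>d\<in>{d. d dvd n}. zeta_weight s n * h d (n div d))"
    using infsum_Sigma'_banach[OF sum4] by simp
  also have "\<dots> = (\<Sum>\<^sub>\<infinity>n\<in>?P. zeta_weight s n * (\<Sum>d | d dvd n. h d (n div d)))"
    by (rule infsum_cong) (simp add: sum_distrib_left)
  finally show "(\<Sum>\<^sub>\<infinity>(a, b)\<in>?P \<times> ?P. zeta_weight s a * zeta_weight s b * h a b)
       = (\<Sum>\<^sub>\<infinity>n\<in>?P. zeta_weight s n * (\<Sum>d | d dvd n. h d (n div d)))" .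
  have "(\<lambda>n. \<Sum>\<^sub>\<infinity>d\<in>{d. d dvd n}. zeta_weight s n * h d (n div d)) summable_on ?P"
    using summable_on_Sigma_banach[OF sum4] by simp
  then show "(\<lambda>n. zeta_weight s n * (\<Sum>d | d dvd n. h d (n div d))) summable_on ?P"
    by (rule summable_on_cong[THEN iffD1, rotated]) (simp add: sum_distrib_left)
qed

text \<open>
  Both sides are expectations over independent pairs \<open>(a, b)\<close>, of \<open>f a * g b\<close> and of \<open>f a * g a\<close>.
  After grouping by the product \<open>n = a * b\<close> they compare \<open>f d * g (n div d)\<close> with \<open>f d * g d\<close>, summed
  over the divisors \<open>d\<close> of \<open>n\<close>.
\<close>

lemma zeta_correlation:
  assumes f: "dvd_antimono f" "\<And>n. \<bar>f n\<bar> \<le> 1" and g: "dvd_antimono g" "\<And>n. \<bar>g n\<bar> \<le> 1"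
  shows "zeta_expectation s f * zeta_expectation s g
       \<le> zeta_expectation s (\<lambda>n. f n * g n)"
proof -
  let ?P = "{0<..} :: nat set" and ?w = "zeta_weight s"
  have fg: "\<bar>f a * g b\<bar> \<le> 1" for a b
    using f(2)[of a] g(2)[of b] by (simp add: abs_mult mult_le_one)
  have prod: "(\<Sum>\<^sub>\<infinity>(a, b)\<in>?P \<times> ?P. ?w a * ?w b * (u a * v b)) = (\<Sum>\<^sub>\<infinity>a\<in>?P. ?w a * u a) * (\<Sum>\<^sub>\<infinity>b\<in>?P. ?w b * v b)"
    if "\<And>a b. \<bar>u a * v b\<bar> \<le> 1" for u v :: "nat \<Rightarrow> real"
  proof -
    have "(\<Sum>\<^sub>\<infinity>(a, b)\<in>?P \<times> ?P. ?w a * ?w b * (u a * v b)) = (\<Sum>\<^sub>\<infinity>a\<in>?P. \<Sum>\<^sub>\<infinity>b\<in>?P. (?w a * u a) * (?w b * v b))"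
      using infsum_Sigma'_banach[OF infsum_zeta_weight_pairs(1)[of "\<lambda>a b. u a * v b", OF that]]
      by (simp add: mult_ac)
    then show ?thesis
      by (simp add: infsum_cmult_right' infsum_cmult_left')
  qed
  have one: "(\<Sum>\<^sub>\<infinity>b\<in>?P. ?w b) = zeta_sum s"
    unfolding zeta_sum_def by (rule infsum_cong_neutral) auto
  have "(\<Sum>\<^sub>\<infinity>a\<in>?P. ?w a * f a) * (\<Sum>\<^sub>\<infinity>b\<in>?P. ?w b * g b) = (\<Sum>\<^sub>\<infinity>(a, b)\<in>?P \<times> ?P. ?w a * ?w b * (f a * g b))"
    by (rule prod[symmetric]) (rule fg)
  also have "\<dots> = (\<Sum>\<^sub>\<infinity>n\<in>?P. ?w n * (\<Sum>d | d dvd n. f d * g (n div d)))"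
    by (rule infsum_zeta_weight_pairs) (rule fg)
  also have "\<dots> \<le> (\<Sum>\<^sub>\<infinity>n\<in>?P. ?w n * (\<Sum>d | d dvd n. f d * g d))"
    using f g fg by (intro infsum_mono infsum_zeta_weight_pairs(3) mult_left_mono sum_complementary_divisors_le) auto
  also have "\<dots> = (\<Sum>\<^sub>\<infinity>(a, b)\<in>?P \<times> ?P. ?w a * ?w b * (f a * g a))"
    by (rule infsum_zeta_weight_pairs(2)[symmetric]) (rule fg)
  also have "\<dots> = (\<Sum>\<^sub>\<infinity>a\<in>?P. ?w a * (f a * g a)) * zeta_sum s"
    using prod[of "\<lambda>a. f a * g a" "\<lambda>_. 1"] fg one by simp
  finally show ?thesis
    using zeta_sum_pos f g fg by (simp add: expectation_zeta field_simps)
qed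

end

definition nfree :: "nat set \<Rightarrow> nat set" where
  "nfree C = {n. \<forall>c\<in>C. \<not> c dvd n}"

lemma dvd_antimono_indicator_nfree: "dvd_antimono (indicator (nfree C))"
  by (auto simp: dvd_antimono_def nfree_def indicator_def dest: dvd_trans)

text \<open>
  Passing from \<open>s\<close> to \<open>t\<close> multiplies the weight by a function that decreases along divisibility; being
  free of divisors in \<open>C\<close> also decreases, so the correlation inequality applies to the two.
\<close>

lemma zeta_prob_nfree_mono:
  assumes "1 < s" "s \<le> t"
  shows "zeta_prob s (nfree C) \<le> zeta_prob t (nfree C)"
proof -
  have t: "1 < t" using assms by simp
  let ?f = "indicator (nfree C) :: nat \<Rightarrow> real" and ?g = "\<lambda>n. zeta_weight (t - s) n"
  have g: "dvd_antimono ?g"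
    unfolding dvd_antimono_def zeta_weight_def
  proof (intro allI impI)
    fix d n :: nat assume "d dvd n" "0 < n"
    then have "0 < d" "d \<le> n" by (auto intro: dvd_imp_le dvd_pos_nat)
    then show "real n powr - (t - s) \<le> real d powr - (t - s)"
      using assms by (intro powr_mono2') auto
  qed
  have g1: "\<bar>?g n\<bar> \<le> 1" for n
    using dvd_antimonoD[OF g, of 1 n] by (cases "n = 0") auto
  have w: "zeta_weight s n * zeta_weight (t - s) n = zeta_weight t n" for n
    by (simp add: zeta_weight_def flip: powr_add)
  have E_f: "zeta_expectation r ?f = zeta_prob r (nfree C)" for r
    by simp
  have z: "(\<Sum>\<^sub>\<infinity>n\<in>{0<..}. zeta_weight t n) = zeta_sum t"
    unfolding zeta_sum_def by (rule infsum_cong_neutral) auto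
  have "zeta_prob s (nfree C) * (zeta_sum t / zeta_sum s)
      = zeta_expectation s ?f * zeta_expectation s ?g"
    using expectation_zeta[OF assms(1) g1] by (simp only: E_f w z)
  also have "\<dots> \<le> zeta_expectation s (\<lambda>n. ?f n * ?g n)"
    by (rule zeta_correlation[OF assms(1) dvd_antimono_indicator_nfree _ g g1]) (auto split: split_indicator)
  also have "\<dots> = (\<Sum>\<^sub>\<infinity>n\<in>{0<..}. zeta_weight s n * (?f n * ?g n)) / zeta_sum s"
    using g1 by (intro expectation_zeta[OF assms(1)]) (auto split: split_indicator)
  also have "(\<Sum>\<^sub>\<infinity>n\<in>{0<..}. zeta_weight s n * (?f n * ?g n)) = (\<Sum>\<^sub>\<infinity>n\<in>{0<..}. zeta_weight t n * ?f n)"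
    by (rule infsum_cong) (simp add: w[symmetric] mult_ac)
  also have "(\<Sum>\<^sub>\<infinity>n\<in>{0<..}. zeta_weight t n * ?f n) = zeta_prob t (nfree C) * zeta_sum t"
    using expectation_zeta[OF t, of ?f] zeta_sum_pos[OF t] unfolding E_f by (auto split: split_indicator)
  finally show ?thesis
    using zeta_sum_pos[OF t] zeta_sum_pos[OF assms(1)] by (simp add: field_simps)
qed

lemma zeta_prob_nfree_Un:
  assumes "1 < s"
  shows "zeta_prob s (nfree A) * zeta_prob s (nfree C) \<le> zeta_prob s (nfree (A \<union> C))"
proof -
  have "indicator (nfree A) n * indicator (nfree C) n = (indicator (nfree (A \<union> C)) n :: real)" for n
    by (auto simp: nfree_def split: split_indicator)
  moreover have "zeta_expectation s (indicator (nfree A)) * zeta_expectation s (indicator (nfree C))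
     \<le> zeta_expectation s (\<lambda>n. indicator (nfree A) n * indicator (nfree C) n :: real)"
    by (rule zeta_correlation[OF assms]) (auto intro: dvd_antimono_indicator_nfree split: split_indicator)
  ultimately show ?thesis by simp
qed

section \<open>Equidistribution in residue classes\<close>

definition periodic_set :: "nat \<Rightarrow> int set \<Rightarrow> bool" where
  "periodic_set L A \<longleftrightarrow> (\<forall>m n. [m = n] (mod int L) \<longrightarrow> m \<in> A \<longrightarrow> n \<in> A)"

definition mean_density :: "nat \<Rightarrow> int set \<Rightarrow> real" where
  "mean_density L A = card (A \<inter> {0..<int L}) / L"

lemma Lcm_nat_pos: "finite C \<Longrightarrow> 0 \<notin> C \<Longrightarrow> 0 < Lcm (C :: nat set)"
  by (metis Lcm_0_iff_nat gr0I)

lemma cong_Lcm_iff: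
  assumes "finite C"
  shows "[m = n] (mod int (Lcm C)) \<longleftrightarrow> (\<forall>b\<in>C. [m = n] (mod int b))"
proof -
  have "int (Lcm C) dvd k \<longleftrightarrow> (\<forall>b\<in>C. int b dvd k)" for k
    by (simp add: Lcm_dvd_iff flip: dvd_nat_abs_iff)
  then show ?thesis by (simp add: cong_iff_dvd_diff)
qed

lemma residues_below_Lcm_unique:
  assumes "finite C" "r \<in> {0..<int (Lcm C)}" "r' \<in> {0..<int (Lcm C)}"
    and "\<And>b. b \<in> C \<Longrightarrow> [k b = r] (mod int b)" "\<And>b. b \<in> C \<Longrightarrow> [k b = r'] (mod int b)"
  shows "r = r'"
proof -
  have "\<forall>b\<in>C. [r = r'] (mod int b)" using assms(4,5) by (simp add: cong_def)
  then have "[r = r'] (mod int (Lcm C))" unfolding cong_Lcm_iff[OF assms(1)] .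
  then show ?thesis using assms(2,3) by (simp add: cong_def)
qed

lemma measure_pmf_range_inj:
  fixes p :: "nat pmf"
  assumes "inj f"
  shows "measure_pmf.prob p (range f) = infsetsum (\<lambda>k. pmf p (f k)) UNIV"
  using infsetsum_reindex[OF assms, of "pmf p"] by (simp add: measure_pmf_conv_infsetsum)

text \<open>
  Weights that decrease with \<open>n\<close> cannot distinguish residue classes by more than the largest weight.
  This covers both the weights of the zeta distribution and the weights \<open>1 / n\<close> for \<open>n \<le> N\<close> that define
  logarithmic density.
\<close>

locale antimono_pmf =
  fixes p :: "nat pmf"
  assumes pmf_0: "pmf p 0 = 0"
    and antimono: "1 \<le> m \<Longrightarrow> m \<le> n \<Longrightarrow> pmf p n \<le> pmf p m"
begin

abbreviation "prob \<equiv> measure_pmf.prob p"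

lemma prob_minus_0: "prob (A - {0}) = prob A"
  by (rule measure_pmf.finite_measure_eq_AE) (use pmf_0 in \<open>auto simp: AE_measure_pmf_iff set_pmf_iff intro!: Nat.gr0I\<close>)

lemma prob_progression_antimono:
  assumes "0 < L" "1 \<le> r" "r \<le> r'"
  shows "prob (range (\<lambda>k. r' + k * L)) \<le> prob (range (\<lambda>k. r + k * L))"
proof -
  have inj: "inj (\<lambda>k. r + k * L)" for r using assms(1) by (auto simp: inj_def)
  have "Infinite_Set_Sum.abs_summable_on (\<lambda>k. pmf p (r + k * L)) UNIV" for r
    using abs_summable_on_reindex_iff[OF inj, of "pmf p" r] pmf_abs_summable[of p] by simp
  then show ?thesis
    using assms unfolding measure_pmf_range_inj[OF inj]
    by (intro infsetsum_mono antimono) auto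
qed

text \<open>
  Sliding a progression to the right decreases its probability, and sliding it by the full period
  \<open>L\<close> only removes its first term. So the \<open>L\<close> classes have probabilities that differ by at most that
  of the integer \<open>1\<close>, and they add up to one.
\<close>

lemma prob_residue_class:
  assumes L: "0 < L" and r: "r < L"
  shows "\<bar>prob {n. n mod L = r} - 1 / L\<bar> \<le> pmf p 1"
proof -
  define C where "C r = prob (range (\<lambda>k. r + k * L))" for r
  have anti: "C r' \<le> C r" if "1 \<le> r" "r \<le> r'" for r r'
    unfolding C_def using prob_progression_antimono[OF L that] .
  have "range (\<lambda>k. 1 + k * L) = {1} \<union> range (\<lambda>k. (1 + L) + k * L)"
  proof -
    have "range (\<lambda>k. 1 + k * L) = (\<lambda>k. 1 + k * L) ` insert 0 (range Suc)"
      by (simp only: UNIV_nat_eq[symmetric])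
    also have "\<dots> = {1} \<union> range (\<lambda>k. (1 + L) + k * L)"
      by (simp add: image_image add_ac)
    finally show ?thesis .
  qed
  then have C1: "C 1 = pmf p 1 + C (1 + L)"
    unfolding C_def using L
    by (subst measure_pmf.finite_measure_Union[symmetric, of "{1}", simplified measure_pmf_single]) auto
  have residue: "prob {n. n mod L = r mod L} = C r" if "1 \<le> r" "r \<le> L" for r
  proof -
    have "{n. n mod L = r mod L} - {0} = range (\<lambda>k. r + k * L)"
    proof (intro equalityI subsetI)
      fix n assume n: "n \<in> {n. n mod L = r mod L} - {0}"
      have "r \<le> n"
      proof (rule ccontr)
        assume "\<not> r \<le> n"
        then have "n < L" using that by simp
        then have "n = r mod L" using n by simp
        then show False using n that \<open>\<not> r \<le> n\<close> by (cases "r = L") auto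
      qed
      then have "n = r + (n - r) div L * L"
        using n by (simp add: mod_eq_dvd_iff_nat)
      then show "n \<in> range (\<lambda>k. r + k * L)" by blast
    qed (use that in auto)
    then show ?thesis using prob_minus_0[of "{n. n mod L = r mod L}"] by (simp add: C_def)
  qed
  have inv: "\<exists>r'. 1 \<le> r' \<and> r' \<le> L \<and> r' mod L = r" if "r < L" for r
    using that L by (intro exI[of _ "if r = 0 then L else r"]) auto
  have "1 = prob (\<Union>r\<in>{..<L}. {n. n mod L = r})"
    using L by (subst measure_pmf.prob_space[of p, symmetric], intro arg_cong[where f = prob]) auto
  also have "\<dots> = (\<Sum>r<L. prob {n. n mod L = r})"
    by (rule measure_pmf.finite_measure_finite_Union) (auto simp: disjoint_family_on_def)
  finally have tot: "1 = (\<Sum>r<L. prob {n. n mod L = r})" .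
  have up: "prob {n. n mod L = r} \<le> C 1"
    and low: "C 1 - pmf p 1 \<le> prob {n. n mod L = r}" if "r < L" for r
  proof -
    obtain r' where r': "1 \<le> r'" "r' \<le> L" "r' mod L = r" using inv[OF \<open>r < L\<close>] by auto
    have eq: "prob {n. n mod L = r} = C r'" using residue[OF r'(1,2)] unfolding r'(3) .
    have "C r' \<le> C 1" "C (1 + L) \<le> C r'"
      using r' by (intro anti; simp)+
    then show "prob {n. n mod L = r} \<le> C 1"
      "C 1 - pmf p 1 \<le> prob {n. n mod L = r}"
      unfolding eq using C1 by linarith+
  qed
  have "(\<Sum>r<L. prob {n. n mod L = r}) \<le> (\<Sum>r<L. C 1)"
    by (intro sum_mono up) simp
  then have "1 \<le> L * C 1" by (simp flip: tot)
  moreover have "(\<Sum>r<L. C 1 - pmf p 1) \<le> (\<Sum>r<L. prob {n. n mod L = r})"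
    by (intro sum_mono low) simp
  then have "L * (C 1 - pmf p 1) \<le> 1" by (simp flip: tot)
  ultimately have "1 / L \<le> C 1" "C 1 - pmf p 1 \<le> 1 / L"
    using L by (simp_all add: field_simps)
  then show ?thesis using up[OF r] low[OF r] by linarith
qed

lemma prob_periodic:
  assumes L: "0 < L" and A: "periodic_set L A"
  shows "\<bar>prob (int -` A) - mean_density L A\<bar> \<le> L * pmf p 1"
proof -
  let ?R = "{r. r < L \<and> int r \<in> A}"
  have "int ` ?R = A \<inter> {0..<int L}"
    by (auto intro!: image_eqI[of _ _ "nat _"])
  then have card: "card (A \<inter> {0..<int L}) = card ?R"
    using card_image[of int ?R] by simp
  have memA: "int n \<in> A \<longleftrightarrow> int (n mod L) \<in> A" for n
  proof -
    have "[int n = int (n mod L)] (mod int L)" by (simp add: cong_def zmod_int)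
    then show ?thesis using A unfolding periodic_set_def by (blast intro: cong_sym)
  qed
  have "int -` A = (\<Union>r\<in>?R. {n. n mod L = r})"
    using L memA by auto
  then have "prob (int -` A) = (\<Sum>r\<in>?R. prob {n. n mod L = r})"
    by (simp only:, intro measure_pmf.finite_measure_finite_Union) (auto simp: disjoint_family_on_def)
  then have "\<bar>prob (int -` A) - mean_density L A\<bar>
      = \<bar>\<Sum>r\<in>?R. prob {n. n mod L = r} - 1 / L\<bar>"
    by (simp add: mean_density_def card sum_subtractf)
  also have "\<dots> \<le> (\<Sum>r\<in>?R. pmf p 1)"
    by (rule order_trans[OF sum_abs sum_mono]) (use prob_residue_class[OF L] in auto)
  also have "\<dots> = card ?R * pmf p 1" by simp
  also have "\<dots> \<le> L * pmf p 1"
    using card_mono[of "{..<L}" ?R] by (intro mult_right_mono) (auto simp: subset_iff)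
  finally show ?thesis .
qed

end

lemma antimono_pmf_zeta: "1 < s \<Longrightarrow> antimono_pmf (zeta_pmf s)"
  by unfold_locales
     (auto simp: pmf_zeta zeta_weight_def intro!: divide_right_mono powr_mono2' less_imp_le[OF zeta_sum_pos(1)])

text \<open>
  Every finite part of the sum is continuous at \<open>1\<close>, where it is a harmonic number.
\<close>

lemma filterlim_zeta_sum_at_right_1: "filterlim zeta_sum at_top (at_right 1)"
  unfolding filterlim_at_top_gt[of _ _ 0]
proof (intro allI impI)
  fix Z :: real
  have "eventually (\<lambda>N. Z < harm N) sequentially"
    using harm_at_top unfolding filterlim_at_top_dense by blast
  then obtain N where N: "Z < harm N"
    by (auto simp: eventually_sequentially)
  have "((\<lambda>s. \<Sum>n\<in>{1..N}. zeta_weight s n) \<longlongrightarrow> (\<Sum>n\<in>{1..N}. zeta_weight 1 n)) (at_right 1)"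
    unfolding zeta_weight_def by (intro tendsto_intros) auto
  also have "(\<Sum>n\<in>{1..N}. zeta_weight 1 n) = harm N"
    by (simp add: harm_def zeta_weight_def powr_minus)
  finally have "eventually (\<lambda>s. Z < (\<Sum>n\<in>{1..N}. zeta_weight s n)) (at_right 1)"
    using N by (rule order_tendstoD)
  moreover have "eventually (\<lambda>s. 1 < s) (at_right (1::real))"
    by (rule eventually_at_right_less)
  ultimately show "eventually (\<lambda>s. Z \<le> zeta_sum s) (at_right 1)"
  proof eventually_elim
    case (elim s)
    have "(\<Sum>n\<in>{1..N}. zeta_weight s n) \<le> zeta_sum s"
      unfolding zeta_sum_def by (rule finite_sum_le_infsum) (auto intro: summable_zeta_weight elim)
    then show ?case using elim by simp
  qed
qed

lemma zeta_prob_periodic_tendsto: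
  assumes "0 < L" "periodic_set L A"
  shows "((\<lambda>s. zeta_prob s (int -` A)) \<longlongrightarrow> mean_density L A) (at_right 1)"
proof (rule LIM_zero_cancel, rule Lim_null_comparison)
  show "eventually (\<lambda>s. norm (zeta_prob s (int -` A) - mean_density L A) \<le> L * (1 / zeta_sum s)) (at_right 1)"
    using eventually_at_right_less[of 1]
  proof eventually_elim
    case (elim s)
    then show ?case
      using antimono_pmf.prob_periodic[OF antimono_pmf_zeta assms, of s] by (simp add: pmf_zeta)
  qed
  have "((\<lambda>s. 1 / zeta_sum s) \<longlongrightarrow> 0) (at_right 1)"
    by (rule real_tendsto_divide_at_top[OF tendsto_const filterlim_zeta_sum_at_right_1])
  then show "((\<lambda>s. L * (1 / zeta_sum s)) \<longlongrightarrow> 0) (at_right 1)"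
    by (rule tendsto_mult_right_zero)
qed

section \<open>The density of the integers free of given divisors\<close>

text \<open>
  By monotonicity in \<open>s\<close> the infimum is the limit for \<open>s\<close> tending to \<open>1\<close>
  (\<open>zeta_prob_nfree_tendsto\<close>). As an infimum it commutes with the infimum over the truncations of
  \<open>C\<close>.
\<close>

definition free_density :: "nat set \<Rightarrow> real" where
  "free_density C = (INF s\<in>{1<..}. zeta_prob s (nfree C))"

text \<open>
  A multiple \<open>d * m\<close> of \<open>d\<close> is divisible by \<open>c\<close> iff \<open>m\<close> is divisible by \<open>c div gcd c d\<close>.
\<close>

definition gcd_quotients :: "nat \<Rightarrow> nat set \<Rightarrow> nat set" where
  "gcd_quotients d C = (\<lambda>c. c div gcd c d) ` C"

lemma gcd_quotients_Un: "gcd_quotients d (A \<union> C) = gcd_quotients d A \<union> gcd_quotients d C"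
  by (auto simp: gcd_quotients_def)

lemma nfree_eq: "nfree C = int -` free_set C"
  by (auto simp: nfree_def free_set_def multiples_def)

lemma free_set_iff: "n \<in> free_set C \<longleftrightarrow> (\<forall>c\<in>C. \<not> int c dvd n)"
  by (auto simp: free_set_def multiples_def)

lemma nfree_antimono: "(\<And>c. c \<in> C \<Longrightarrow> \<exists>a\<in>A. a dvd c) \<Longrightarrow> nfree A \<subseteq> nfree C"
  by (auto simp: nfree_def) (meson dvd_trans)

lemma periodic_free_set:
  assumes "\<And>c. c \<in> C \<Longrightarrow> c dvd L"
  shows "periodic_set L (free_set C)"
  unfolding periodic_set_def free_set_iff
  using assms by (meson cong_dvd_iff cong_dvd_modulus of_nat_dvd_iff)

lemma periodic_set_Int: "periodic_set L A \<Longrightarrow> periodic_set L C \<Longrightarrow> periodic_set L (A \<inter> C)"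
  by (auto simp: periodic_set_def)

lemma periodic_dvd_add:
  assumes "d dvd L"
  shows "periodic_set L {n. int d dvd i + n}"
  unfolding periodic_set_def
proof (intro allI impI)
  fix m n assume "[m = n] (mod int L)" "m \<in> {n. int d dvd i + n}"
  moreover from this have "[m = n] (mod int d)" using assms by (metis cong_dvd_modulus of_nat_dvd_iff)
  then have "[i + m = i + n] (mod int d)" by (rule cong_add[OF cong_refl])
  ultimately show "n \<in> {n. int d dvd i + n}" using cong_dvd_iff by blast
qed

lemma free_density_le: "1 < s \<Longrightarrow> free_density C \<le> zeta_prob s (nfree C)"
  unfolding free_density_def by (rule cINF_lower) (auto intro!: bdd_belowI[of _ 0])

lemma free_density_nonneg: "0 \<le> free_density C"
  unfolding free_density_def by (rule cINF_greatest) (auto intro: exI[of _ 2])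

lemma zeta_prob_nfree_tendsto: "((\<lambda>s. zeta_prob s (nfree C)) \<longlongrightarrow> free_density C) (at_right 1)"
proof (rule order_tendstoI)
  fix a assume "a < free_density C"
  then show "eventually (\<lambda>s. a < zeta_prob s (nfree C)) (at_right 1)"
    by (intro eventually_mono[OF eventually_at_right_less[of 1]]) (rule less_le_trans[OF _ free_density_le])
next
  fix a assume "free_density C < a"
  then obtain t where t: "1 < t" "zeta_prob t (nfree C) < a"
    unfolding free_density_def by (subst (asm) cINF_less_iff) (auto intro!: bdd_belowI[of _ 0] exI[of _ 2])
  then show "eventually (\<lambda>s. zeta_prob s (nfree C) < a) (at_right 1)"
    unfolding eventually_at_right_field
    by (intro exI[of _ t] conjI allI impI t(1) le_less_trans[OF zeta_prob_nfree_mono t(2)]) auto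
qed

lemma at_right_1_nontrivial: "at_right (1::real) \<noteq> bot"
  by simp

lemma free_density_antimono:
  assumes "\<And>c. c \<in> C \<Longrightarrow> \<exists>a\<in>A. a dvd c"
  shows "free_density A \<le> free_density C"
  by (rule tendsto_le[OF _ zeta_prob_nfree_tendsto zeta_prob_nfree_tendsto])
     (use nfree_antimono[OF assms] in \<open>auto intro!: always_eventually measure_pmf.finite_measure_mono\<close>)

lemma free_density_anti_subset: "C \<subseteq> A \<Longrightarrow> free_density A \<le> free_density C"
  by (rule free_density_antimono) (meson dvd_refl subsetD)

lemma free_density_empty: "free_density {} = 1"
  using zeta_prob_nfree_tendsto[of "{}"] by (simp add: nfree_def tendsto_const_iff)

text \<open>
  Behrend's inequality, inherited from the correlation inequality at each \<open>s > 1\<close>.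
\<close>

lemma free_density_Un: "free_density A * free_density C \<le> free_density (A \<union> C)"
  by (rule tendsto_le[OF _ zeta_prob_nfree_tendsto tendsto_mult[OF zeta_prob_nfree_tendsto zeta_prob_nfree_tendsto]])
     (auto intro!: eventually_mono[OF eventually_at_right_less[of 1]] zeta_prob_nfree_Un)

lemma free_density_UN_pos:
  assumes "finite I" "\<And>i. i \<in> I \<Longrightarrow> 0 < free_density (A i)"
  shows "0 < free_density (\<Union>i\<in>I. A i)"
  using assms
proof (induction I)
  case (insert i I)
  then have "0 < free_density (A i) * free_density (\<Union>i\<in>I. A i)" by simp
  also have "\<dots> \<le> free_density (\<Union>i\<in>insert i I. A i)"
    using free_density_Un by simp
  finally show ?case .
qed (simp add: free_density_empty)

lemma free_density_eq_mean_density: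
  assumes "0 < L" "\<And>c. c \<in> C \<Longrightarrow> c dvd L"
  shows "free_density C = mean_density L (free_set C)"
  using tendsto_unique[OF at_right_1_nontrivial zeta_prob_nfree_tendsto[of C]]
    zeta_prob_periodic_tendsto[OF assms(1) periodic_free_set[OF assms(2)]] nfree_eq by auto

lemma free_density_finite_pos:
  assumes "finite C" "0 \<notin> C" "1 \<notin> C"
  shows "0 < free_density C"
proof -
  have L: "0 < Lcm C" using assms(1,2) by (rule Lcm_nat_pos)
  have "0 < mean_density (Lcm C) (free_set C)"
  proof (cases "Lcm C = 1")
    case True
    then have "C \<subseteq> {1}" using dvd_Lcm[of _ C] by auto
    then have "C = {}" using assms by auto
    then show ?thesis by (simp add: mean_density_def free_set_def multiples_def)
  next
    case False
    then have "1 \<in> free_set C \<inter> {0..<int (Lcm C)}"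
      using L assms by (auto simp: free_set_iff)
    then have "0 < card (free_set C \<inter> {0..<int (Lcm C)})"
      by (subst card_gt_0_iff) auto
    then show ?thesis using L by (simp add: mean_density_def)
  qed
  then show ?thesis by (subst free_density_eq_mean_density[OF L]) (auto intro: dvd_Lcm)
qed

lemma zeta_prob_nfree_truncate:
  "(\<lambda>K. zeta_prob s (nfree (C \<inter> {..K}))) \<longlonglongrightarrow> zeta_prob s (nfree C)"
proof -
  have "(\<Inter>K. nfree (C \<inter> {..K})) = nfree C" by (auto simp: nfree_def)
  moreover have "decseq (\<lambda>K. nfree (C \<inter> {..K}))" by (auto simp: decseq_def nfree_def)
  ultimately show ?thesis using measure_pmf.finite_Lim_measure_decseq[of "\<lambda>K. nfree (C \<inter> {..K})"] by simp
qed

text \<open>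
  Two infima commute: first choose \<open>s\<close> with a probability close to \<open>free_density C\<close>, then a truncation
  that is good for this \<open>s\<close>. The latter's probability at \<open>s\<close> dominates its own density.
\<close>

lemma free_density_truncate: "(\<lambda>K. free_density (C \<inter> {..K})) \<longlonglongrightarrow> free_density C"
proof (rule order_tendstoI)
  fix a assume "a < free_density C"
  moreover have "free_density C \<le> free_density (C \<inter> {..K})" for K by (rule free_density_antimono) (use dvd_refl in blast)
  ultimately show "eventually (\<lambda>K. a < free_density (C \<inter> {..K})) sequentially"
    by (auto intro!: always_eventually intro: less_le_trans)
next
  fix a assume a: "free_density C < a"
  have "eventually (\<lambda>s. zeta_prob s (nfree C) < a \<and> 1 < s) (at_right 1)"
    using order_tendstoD(2)[OF zeta_prob_nfree_tendsto a] eventually_at_right_less[of 1] by eventually_elim auto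
  then obtain s where s: "1 < s" "zeta_prob s (nfree C) < a"
    using eventually_happens'[OF at_right_1_nontrivial] by blast
  have "eventually (\<lambda>K. zeta_prob s (nfree (C \<inter> {..K})) < a) sequentially"
    by (rule order_tendstoD(2)[OF zeta_prob_nfree_truncate s(2)])
  then show "eventually (\<lambda>K. free_density (C \<inter> {..K}) < a) sequentially"
    by (rule eventually_mono) (rule le_less_trans[OF free_density_le[OF s(1)]])
qed

text \<open>
  The bound has the limit \<open>free_density (C \<inter> {..K}) - free_density C\<close> for \<open>s\<close> tending to \<open>1\<close>, which is
  small for large \<open>K\<close>: the elements of \<open>C\<close> beyond \<open>K\<close> matter little uniformly in \<open>s\<close>.
\<close>

lemma zeta_prob_tail_le:
  assumes "1 < s"
  shows "zeta_prob s (nfree (C \<inter> {..K}) - nfree C) \<le> zeta_prob s (nfree (C \<inter> {..K})) - free_density C"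
proof -
  have "nfree C \<subseteq> nfree (C \<inter> {..K})" by (auto simp: nfree_def)
  then show ?thesis
    using free_density_le[OF assms, of C] by (simp add: measure_pmf.finite_measure_Diff)
qed

lemma dvd_mult_iff_gcd_quotient:
  fixes c d m :: nat
  assumes "0 < d"
  shows "c dvd d * m \<longleftrightarrow> c div gcd c d dvd m"
proof -
  have g: "gcd c d \<noteq> 0" using assms by simp
  have "c dvd d * m \<longleftrightarrow> gcd c d * (c div gcd c d) dvd gcd c d * (d div gcd c d * m)"
    by (simp flip: mult.assoc)
  also have "\<dots> \<longleftrightarrow> c div gcd c d dvd d div gcd c d * m"
    by (rule dvd_times_left_cancel_iff[OF g])
  also have "\<dots> \<longleftrightarrow> c div gcd c d dvd m"
    using assms by (intro coprime_dvd_mult_right_iff div_gcd_coprime) simp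
  finally show ?thesis .
qed

lemma multiples_Int_nfree:
  assumes "0 < d"
  shows "{n. d dvd n} \<inter> nfree C = (*) d ` nfree (gcd_quotients d C)"
proof -
  have "d * m \<in> nfree C \<longleftrightarrow> m \<in> nfree (gcd_quotients d C)" for m
    by (simp add: nfree_def gcd_quotients_def dvd_mult_iff_gcd_quotient[OF assms])
  then show ?thesis by (auto simp: dvd_def)
qed

lemma zeta_prob_dilate:
  assumes "1 < s" "0 < d"
  shows "zeta_prob s ((*) d ` A) = zeta_weight s d * zeta_prob s A"
proof -
  have "zeta_prob s ((*) d ` A) = infsetsum (\<lambda>n. pmf (zeta_pmf s) (d * n)) A"
    using assms unfolding measure_pmf_conv_infsetsum by (subst infsetsum_reindex) (auto simp: inj_on_def)
  also have "\<dots> = infsetsum (\<lambda>n. zeta_weight s d * pmf (zeta_pmf s) n) A"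
    using assms by (simp add: pmf_zeta zeta_weight_mult)
  also have "\<dots> = zeta_weight s d * zeta_prob s A"
    unfolding measure_pmf_conv_infsetsum by (rule infsetsum_cmult_right) (auto intro: pmf_abs_summable)
  finally show ?thesis .
qed

lemma zeta_prob_multiples_Int_nfree_tendsto:
  assumes "0 < d"
  shows "((\<lambda>s. zeta_prob s ({n. d dvd n} \<inter> nfree C)) \<longlongrightarrow> free_density (gcd_quotients d C) / d) (at_right 1)"
proof -
  have "((\<lambda>s. zeta_weight s d * zeta_prob s (nfree (gcd_quotients d C)))
      \<longlongrightarrow> zeta_weight 1 d * free_density (gcd_quotients d C)) (at_right 1)"
    unfolding zeta_weight_def by (intro tendsto_intros zeta_prob_nfree_tendsto) (use assms in auto)
  moreover have "zeta_weight 1 d * free_density (gcd_quotients d C) = free_density (gcd_quotients d C) / d"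
    using assms by (simp add: zeta_weight_def powr_minus field_simps)
  moreover have "eventually (\<lambda>s. zeta_weight s d * zeta_prob s (nfree (gcd_quotients d C))
      = zeta_prob s ({n. d dvd n} \<inter> nfree C)) (at_right 1)"
    using eventually_at_right_less[of 1]
    by eventually_elim (simp add: assms multiples_Int_nfree zeta_prob_dilate)
  ultimately show ?thesis
    using Lim_transform_eventually by fastforce
qed

text \<open>
  The density lost by adding \<open>b\<close> is carried by the multiples of \<open>b\<close>, a copy of the integers scaled
  by \<open>b\<close>.
\<close>

lemma free_density_insert_eq:
  assumes "0 < b"
  shows "free_density (insert b C) = free_density C - free_density (gcd_quotients b C) / b"
proof (rule tendsto_unique[OF at_right_1_nontrivial zeta_prob_nfree_tendsto])
  have "nfree (insert b C) = nfree C - ({n. b dvd n} \<inter> nfree C)" by (auto simp: nfree_def)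
  then have "zeta_prob s (nfree (insert b C)) = zeta_prob s (nfree C) - zeta_prob s ({n. b dvd n} \<inter> nfree C)" for s
    by (simp add: measure_pmf.finite_measure_Diff)
  then show "((\<lambda>s. zeta_prob s (nfree (insert b C))) \<longlongrightarrow> free_density C - free_density (gcd_quotients b C) / b) (at_right 1)"
    by (simp only:) (intro tendsto_intros zeta_prob_nfree_tendsto zeta_prob_multiples_Int_nfree_tendsto assms)
qed

section \<open>Logarithmic density of sets of multiples\<close>

definition log_pmf :: "nat \<Rightarrow> nat pmf" where
  "log_pmf N = embed_pmf (\<lambda>n. if n \<in> {1..N} then 1 / (n * harm N) else 0)"

definition log_average :: "nat set \<Rightarrow> nat \<Rightarrow> real" where
  "log_average A N = (\<Sum>n\<in>A \<inter> {1..N}. 1 / n) / ln N"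

lemma pmf_log:
  assumes N: "1 \<le> N"
  shows "pmf (log_pmf N) n = (if n \<in> {1..N} then 1 / (n * harm N) else 0)"
  unfolding log_pmf_def
proof (rule pmf_embed_pmf)
  have h: "harm N > (0 :: real)" using N by simp
  have "(\<integral>\<^sup>+n. ennreal (if n \<in> {1..N} then 1 / (n * harm N) else 0) \<partial>count_space UNIV)
      = (\<integral>\<^sup>+n. ennreal (1 / (n * harm N)) \<partial>count_space {1..N})"
    by (subst (2) nn_integral_count_space_indicator)
       (auto intro!: nn_integral_cong split: split_indicator)
  also have "\<dots> = (\<Sum>n\<in>{1..N}. ennreal (1 / (n * harm N)))"
    by (simp add: nn_integral_count_space_finite)
  also have "\<dots> = ennreal (\<Sum>n\<in>{1..N}. 1 / (n * harm N))"
    using h by (intro sum_ennreal) (auto intro!: divide_nonneg_nonneg mult_nonneg_nonneg harm_nonneg)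
  also have "(\<Sum>n\<in>{1..N}. 1 / (n * harm N)) = (\<Sum>n\<in>{1..N}. inverse (real n)) / harm N"
    by (simp add: sum_divide_distrib field_simps)
  also have "\<dots> = 1" using h by (simp add: harm_def)
  finally show "(\<integral>\<^sup>+n. ennreal (if n \<in> {1..N} then 1 / (n * harm N) else 0) \<partial>count_space UNIV) = 1"
    by simp
qed (use harm_nonneg[of N, where ?'a = real] in auto)

lemma antimono_pmf_log:
  assumes "1 \<le> N"
  shows "antimono_pmf (log_pmf N)"
  using assms
  by unfold_locales
    (auto simp: pmf_log intro!: divide_left_mono mult_right_mono mult_pos_pos mult_nonneg_nonneg harm_nonneg)

lemma prob_log_pmf:
  assumes "1 \<le> N"
  shows "measure_pmf.prob (log_pmf N) A = (\<Sum>n\<in>A \<inter> {1..N}. 1 / n) / harm N"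
proof -
  have "measure_pmf.prob (log_pmf N) A = measure_pmf.prob (log_pmf N) (A \<inter> {1..N})"
    by (rule measure_pmf.finite_measure_eq_AE)
       (use assms in \<open>auto simp: AE_measure_pmf_iff set_pmf_iff pmf_log split: if_splits\<close>)
  also have "\<dots> = (\<Sum>n\<in>A \<inter> {1..N}. 1 / (n * harm N))"
    using assms by (subst measure_measure_pmf_finite) (auto simp: pmf_log)
  finally show ?thesis by (simp add: sum_divide_distrib)
qed

lemma harm_le_ln_plus_1:
  assumes "1 \<le> N"
  shows "harm N \<le> ln (real N) + 1"
  using decseqD[OF decseq_harm_diff_ln, of 0 "N - 1"] assms by (simp add: harm_expand)

lemma harm_div_ln_tendsto: "(\<lambda>N. harm N / ln (real N)) \<longlonglongrightarrow> 1"
proof (rule tendsto_sandwich[of "\<lambda>_. 1" _ _ "\<lambda>N. (ln (real N) + 1) / ln (real N)"])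
  show "eventually (\<lambda>N. 1 \<le> harm N / ln (real N)) sequentially"
    using eventually_gt_at_top[of 1]
  proof eventually_elim
    case (elim N)
    have "ln (real N) \<le> ln (real N + 1)" using elim by simp
    then have "ln (real N) \<le> harm N" using ln_le_harm[of N] by linarith
    then show ?case using elim by simp
  qed
  show "eventually (\<lambda>N. harm N / ln (real N) \<le> (ln (real N) + 1) / ln (real N)) sequentially"
    using eventually_gt_at_top[of 1]
    by eventually_elim (use harm_le_ln_plus_1 in \<open>auto intro!: divide_right_mono\<close>)
  show "(\<lambda>N. (ln (real N) + 1) / ln (real N)) \<longlonglongrightarrow> 1" by real_asymp
qed simp

lemma log_average_periodic:
  assumes "0 < L" "periodic_set L A"
  shows "log_average (int -` A) \<longlonglongrightarrow> mean_density L A"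
proof -
  have "(\<lambda>N. measure_pmf.prob (log_pmf N) (int -` A)) \<longlonglongrightarrow> mean_density L A"
  proof (rule LIM_zero_cancel, rule Lim_null_comparison)
    show "eventually (\<lambda>N. norm (measure_pmf.prob (log_pmf N) (int -` A) - mean_density L A) \<le> L * (1 / harm N)) sequentially"
      using eventually_ge_at_top[of 1]
    proof eventually_elim
      case (elim N)
      then show ?case
        using antimono_pmf.prob_periodic[OF antimono_pmf_log assms, of N] by (simp add: pmf_log)
    qed
    have "(\<lambda>N. 1 / harm N) \<longlonglongrightarrow> (0 :: real)"
      by (rule real_tendsto_divide_at_top[OF tendsto_const harm_at_top])
    then show "(\<lambda>N. L * (1 / harm N)) \<longlonglongrightarrow> (0 :: real)"
      by (rule tendsto_mult_right_zero)
  qed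
  from tendsto_mult[OF this harm_div_ln_tendsto]
  have "(\<lambda>N. measure_pmf.prob (log_pmf N) (int -` A) * (harm N / ln N)) \<longlonglongrightarrow> mean_density L A"
    by simp
  moreover have "eventually (\<lambda>N. measure_pmf.prob (log_pmf N) (int -` A) * (harm N / ln N) = log_average (int -` A) N) sequentially"
    using eventually_gt_at_top[of 1]
  proof eventually_elim
    case (elim N)
    then have "harm N \<noteq> (0 :: real)" using harm_pos[of N, where ?'a = real] by linarith
    then show ?case using elim by (simp add: prob_log_pmf log_average_def)
  qed
  ultimately show ?thesis by (rule Lim_transform_eventually)
qed

text \<open>
  Comparison with the integral: the mean value theorem bounds the terms from the second on by a
  telescoping sum.
\<close>

lemma zeta_sum_le:
  assumes s: "1 < s"
  shows "zeta_sum s \<le> 1 + 1 / (s - 1)"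
proof -
  have step: "real (Suc n) powr (- s) \<le> (real n powr (1 - s) - real (Suc n) powr (1 - s)) / (s - 1)"
    if n: "1 \<le> n" for n
  proof -
    have deriv: "((\<lambda>x. x powr (1 - s)) has_real_derivative (1 - s) * x powr (1 - s - 1)) (at x)"
      if "real n \<le> x" for x
      using that n by (intro has_real_derivative_powr) simp
    obtain z where z: "real n < z" "z < real (Suc n)"
      "real (Suc n) powr (1 - s) - real n powr (1 - s) = (real (Suc n) - real n) * ((1 - s) * z powr (1 - s - 1))"
      using MVT2[of "real n" "real (Suc n)" "\<lambda>x. x powr (1 - s)" "\<lambda>x. (1 - s) * x powr (1 - s - 1)"] deriv
      by auto
    have "real (Suc n) powr (- s) \<le> z powr (- s)"
      using z n s by (intro powr_mono2') auto
    moreover have "real n powr (1 - s) - real (Suc n) powr (1 - s) = (s - 1) * z powr (- s)"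
      using z(3) by (simp add: algebra_simps)
    ultimately have "real (Suc n) powr (- s) \<le> z powr (- s)"
      "(real n powr (1 - s) - real (Suc n) powr (1 - s)) / (s - 1) = z powr (- s)"
      using s by simp_all
    then show ?thesis by simp
  qed
  have partial: "(\<Sum>n<N. zeta_weight s n) \<le> 1 + 1 / (s - 1)" for N
  proof -
    have bound: "(\<Sum>n<Suc (Suc M). zeta_weight s n) \<le> 1 + (1 - real (Suc M) powr (1 - s)) / (s - 1)" for M
    proof (induction M)
      case (Suc M)
      have "(\<Sum>n<Suc (Suc (Suc M)). zeta_weight s n) = (\<Sum>n<Suc (Suc M). zeta_weight s n) + real (Suc (Suc M)) powr (- s)"
        by (simp add: zeta_weight_def)
      also have "\<dots> \<le> 1 + (1 - real (Suc M) powr (1 - s)) / (s - 1) + (real (Suc M) powr (1 - s) - real (Suc (Suc M)) powr (1 - s)) / (s - 1)"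
        using Suc step[of "Suc M"] by linarith
      also have "\<dots> = 1 + (1 - real (Suc (Suc M)) powr (1 - s)) / (s - 1)"
        by (simp add: diff_divide_distrib)
      finally show ?case .
    qed simp
    have "(\<Sum>n<N. zeta_weight s n) \<le> (\<Sum>n<Suc (Suc N). zeta_weight s n)"
      by (rule sum_mono2) auto
    also note bound[of N]
    also have "1 + (1 - real (Suc N) powr (1 - s)) / (s - 1) \<le> 1 + 1 / (s - 1)"
      using s by (simp add: divide_right_mono)
    finally show ?thesis .
  qed
  have "zeta_weight s sums zeta_sum s"
    unfolding zeta_sum_def by (rule has_sum_imp_sums[OF has_sum_infsum[OF summable_zeta_weight[OF s]]])
  then show ?thesis
    unfolding sums_def by (rule LIMSEQ_le_const2) (use partial in blast)
qed

text \<open>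
  For \<open>n \<le> N\<close> the factor \<open>n powr (s - 1)\<close> is at most \<open>N powr (1 / ln N) = exp 1\<close>, and the normalizing
  constant at this \<open>s\<close> is at most \<open>1 + ln N\<close>.
\<close>

lemma log_average_le_zeta_prob:
  fixes N :: nat
  assumes N: "1 < N" and s: "s = 1 + 1 / ln (real N)"
  shows "log_average A N \<le> exp 1 * ((1 + ln (real N)) / ln (real N)) * zeta_prob s A"
proof -
  have ln: "0 < ln (real N)" using N by simp
  then have s1: "1 < s" by (simp add: s)
  have "(\<Sum>n\<in>A \<inter> {1..N}. 1 / n) \<le> (\<Sum>n\<in>A \<inter> {1..N}. exp 1 * zeta_weight s n)"
  proof (rule sum_mono)
    fix n assume "n \<in> A \<inter> {1..N}"
    then have n: "1 \<le> n" "n \<le> N" by auto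
    have "real n powr (1 / ln N) \<le> real N powr (1 / ln N)"
      using n ln by (intro powr_mono2) auto
    also have "\<dots> = exp 1" using N ln by (simp add: powr_def)
    finally have "real n powr (1 / ln N) * real n powr (- s) \<le> exp 1 * zeta_weight s n"
      unfolding zeta_weight_def by (rule mult_right_mono) simp
    moreover have "real n powr (1 / ln N) * real n powr (- s) = 1 / n"
      using n by (simp add: s powr_minus field_simps flip: powr_add)
    ultimately show "1 / real n \<le> exp 1 * zeta_weight s n" by simp
  qed
  also have "\<dots> = exp 1 * zeta_sum s * zeta_prob s (A \<inter> {1..N})"
    using zeta_sum_pos[OF s1]
    by (subst measure_measure_pmf_finite) (auto simp: pmf_zeta[OF s1] sum_distrib_left)
  also have "\<dots> \<le> exp 1 * (1 + ln (real N)) * zeta_prob s A"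
    using zeta_sum_le[OF s1] zeta_sum_pos[OF s1] ln
    by (intro mult_mono measure_pmf.finite_measure_mono) (auto simp: s)
  finally show ?thesis
    unfolding log_average_def using ln by (simp add: divide_right_mono)
qed

text \<open>
  The truncations of \<open>C\<close> are periodic and bound the averages from above. From below the error is the
  average of the numbers divisible only by elements of \<open>C\<close> beyond the truncation, which is controlled
  by their zeta probability at \<open>s = 1 + 1 / ln N\<close>.
\<close>

theorem log_average_nfree_tendsto:
  assumes "0 \<notin> C"
  shows "log_average (nfree C) \<longlonglongrightarrow> free_density C"
proof (rule order_tendstoI)
  let ?T = "\<lambda>K. C \<inter> {..K}"
  have lim: "log_average (nfree (?T K)) \<longlonglongrightarrow> free_density (?T K)" for K
  proof -
    have L: "0 < Lcm (?T K)" using assms by (intro Lcm_nat_pos) auto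
    show ?thesis
      using log_average_periodic[OF L periodic_free_set[of "?T K"]] free_density_eq_mean_density[OF L, of "?T K"]
      by (simp add: nfree_eq dvd_Lcm)
  qed
  have sub: "nfree C \<subseteq> nfree (?T K)" for K by (auto simp: nfree_def)
  {
    fix a assume "free_density C < a"
    from eventually_happens'[OF sequentially_bot order_tendstoD(2)[OF free_density_truncate this]]
    obtain K where K: "free_density (?T K) < a" by blast
    show "eventually (\<lambda>N. log_average (nfree C) N < a) sequentially"
      using order_tendstoD(2)[OF lim K] eventually_gt_at_top[of 1]
    proof eventually_elim
      case (elim N)
      have "log_average (nfree C) N \<le> log_average (nfree (?T K)) N"
        unfolding log_average_def using elim sub[of K] by (intro divide_right_mono sum_mono2) auto
      then show ?case using elim by linarith
    qed
  }
  {
    fix a assume a: "a < free_density C"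
    have "(\<lambda>K. free_density (?T K) - exp 1 * (free_density (?T K) - free_density C))
        \<longlonglongrightarrow> free_density C - exp 1 * (free_density C - free_density C)"
      by (intro tendsto_intros free_density_truncate)
    then have "(\<lambda>K. free_density (?T K) - exp 1 * (free_density (?T K) - free_density C)) \<longlonglongrightarrow> free_density C"
      by simp
    from eventually_happens'[OF sequentially_bot order_tendstoD(1)[OF this a]]
    obtain K where K: "a < free_density (?T K) - exp 1 * (free_density (?T K) - free_density C)" by blast
    \<comment> \<open>The multiples only of elements beyond \<open>K\<close> have upper density at most
      \<open>exp 1 * (free_density (C \<inter> {..K}) - free_density C)\<close>, whence the choice of \<open>K\<close>.\<close>
    let ?s = "\<lambda>N::nat. 1 + 1 / ln (real N)"
    let ?q = "\<lambda>N::nat. (1 + ln (real N)) / ln (real N)"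
    have s: "filterlim ?s (at_right 1) sequentially" by real_asymp
    have "(\<lambda>N. log_average (nfree (?T K)) N - exp 1 * ?q N * (zeta_prob (?s N) (nfree (?T K)) - free_density C))
       \<longlonglongrightarrow> free_density (?T K) - exp 1 * 1 * (free_density (?T K) - free_density C)"
    proof (intro tendsto_intros lim filterlim_compose[OF zeta_prob_nfree_tendsto s])
      show "?q \<longlonglongrightarrow> 1" by real_asymp
    qed
    then have "eventually (\<lambda>N. a < log_average (nfree (?T K)) N - exp 1 * ?q N * (zeta_prob (?s N) (nfree (?T K)) - free_density C)) sequentially"
      by (rule order_tendstoD(1)) (use K in simp)
    then show "eventually (\<lambda>N. a < log_average (nfree C) N) sequentially"
      using eventually_gt_at_top[of 1]
    proof eventually_elim
      case (elim N)
      have "log_average (nfree C) N = log_average (nfree (?T K)) N - log_average (nfree (?T K) - nfree C) N"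
      proof -
        have "nfree C \<inter> {1..N} = (nfree (?T K) \<inter> {1..N}) - (nfree (?T K) - nfree C) \<inter> {1..N}"
          using sub[of K] by auto
        then show ?thesis
          unfolding log_average_def by (subst sum_diff[symmetric, THEN arg_cong[where f = "\<lambda>x. x / ln N"], unfolded diff_divide_distrib]) auto
      qed
      moreover have "log_average (nfree (?T K) - nfree C) N
          \<le> exp 1 * ?q N * zeta_prob (?s N) (nfree (?T K) - nfree C)"
        by (rule log_average_le_zeta_prob) (use elim in auto)
      moreover have "exp 1 * ?q N * zeta_prob (?s N) (nfree (?T K) - nfree C)
          \<le> exp 1 * ?q N * (zeta_prob (?s N) (nfree (?T K)) - free_density C)"
        using elim by (intro mult_left_mono zeta_prob_tail_le) auto
      ultimately show ?case using elim by linarith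
    qed
  }
qed

theorem log_density_multiples:
  assumes "0 \<notin> C"
  shows "log_density (multiples C) = 1 - free_density C"
proof -
  have "(\<lambda>N. log_average (nfree {}) N - log_average (nfree C) N) \<longlonglongrightarrow> 1 - free_density C"
    using tendsto_diff[OF log_average_nfree_tendsto[of "{}"] log_average_nfree_tendsto[OF assms]]
    by (simp add: free_density_empty)
  moreover have "log_average (nfree {}) N - log_average (nfree C) N
      = (\<Sum>a\<in>multiples C \<inter> {1..int N}. 1 / real_of_int a) / ln (real N)" for N
  proof -
    have "(\<Sum>a\<in>multiples C \<inter> {1..int N}. 1 / real_of_int a) = (\<Sum>n\<in>{1..N} - nfree C \<inter> {1..N}. 1 / real n)"
    proof -
      have mem: "int n \<in> multiples C \<longleftrightarrow> n \<notin> nfree C" for n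
        by (auto simp: nfree_def multiples_def)
      have "x \<in> int ` ({1..N} - nfree C \<inter> {1..N})" if "x \<in> multiples C \<inter> {1..int N}" for x
        using that mem[of "nat x"] by (intro image_eqI[of _ _ "nat x"]) auto
      then have "multiples C \<inter> {1..int N} = int ` ({1..N} - nfree C \<inter> {1..N})"
        using mem by auto
      then show ?thesis by (simp add: sum.reindex)
    qed
    also have "\<dots> = (\<Sum>n\<in>{1..N}. 1 / real n) - (\<Sum>n\<in>nfree C \<inter> {1..N}. 1 / real n)"
      by (rule sum_diff) auto
    finally show ?thesis by (simp add: log_average_def diff_divide_distrib nfree_def)
  qed
  ultimately show ?thesis unfolding log_density_def by (simp add: limI)
qed

lemma taut_iff:
  assumes "0 \<notin> B"
  shows "taut B \<longleftrightarrow> (\<forall>b\<in>B. 0 < free_density (gcd_quotients b (B - {b})))"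
  unfolding taut_def
proof (rule ball_cong[OF refl])
  fix b assume b: "b \<in> B"
  then have "0 < b" using assms by (metis gr0I)
  then show "log_density (multiples (B - {b})) < log_density (multiples B) \<longleftrightarrow> 0 < free_density (gcd_quotients b (B - {b}))"
    using free_density_insert_eq[of b "B - {b}"] assms b
    by (simp add: log_density_multiples insert_absorb zero_less_divide_iff)
qed

section \<open>Tautness and residue classes\<close>

text \<open>
  Add to \<open>v\<close> the multiple \<open>t * m\<close> where \<open>t\<close> is the product of the primes dividing \<open>L\<close> but not \<open>v\<close>:
  each prime divisor of \<open>L\<close> then divides exactly one of the two summands.
\<close>

lemma coprime_lift:
  fixes v m :: int
  assumes "coprime v m" "0 < L"
  obtains u where "[u = v] (mod m)" "coprime u (int L)"
proof -
  define t where "t = (\<Prod>p | p \<in> prime_factors L \<and> \<not> int p dvd v. int p)"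
  have fin: "finite {p. p \<in> prime_factors L \<and> \<not> int p dvd v}" by simp
  have dvd_t: "int p dvd t \<longleftrightarrow> \<not> int p dvd v" if "p \<in> prime_factors L" for p
  proof
    assume "int p dvd t"
    moreover have "prime (int p)" using that by auto
    ultimately obtain q where q: "q \<in> prime_factors L" "\<not> int q dvd v" "int p dvd int q"
      unfolding t_def by (auto simp: prime_dvd_prod_iff[OF fin])
    then have "p = q" using that by (auto simp: primes_dvd_imp_eq in_prime_factors_iff)
    then show "\<not> int p dvd v" using q by simp
  next
    assume "\<not> int p dvd v"
    then show "int p dvd t" unfolding t_def using that by (intro dvd_prodI[OF fin]) auto
  qed
  show ?thesis
  proof
    show "[v + t * m = v] (mod m)" by (simp add: cong_def)
    show "coprime (v + t * m) (int L)"
    proof (rule ccontr)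
      assume "\<not> coprime (v + t * m) (int L)"
      then have "gcd (v + t * m) (int L) \<noteq> 1" by (simp add: coprime_iff_gcd_eq_1)
      then have "nat (gcd (v + t * m) (int L)) \<noteq> 1" by auto
      then obtain p where p: "prime p" "p dvd nat (gcd (v + t * m) (int L))"
        using prime_factor_nat by blast
      then have "int p dvd gcd (v + t * m) (int L)" by (metis gcd_ge_0_int int_dvd_int_iff nat_0_le)
      then have *: "int p dvd v + t * m" "p dvd L" by auto
      then have pf: "p \<in> prime_factors L" using p assms by (auto simp: in_prime_factors_iff)
      show False
      proof (cases "int p dvd v")
        case True
        then have "int p dvd t * m" using * by (simp add: dvd_add_right_iff)
        moreover have "prime (int p)" using p by simp
        ultimately have "int p dvd m" using dvd_t[OF pf] True by (simp add: prime_dvd_mult_iff)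
        then have "is_unit (int p)" using assms(1) True by (auto dest: coprime_common_divisor)
        then show False using p by simp
      next
        case False
        then have "int p dvd t * m" using dvd_t[OF pf] by simp
        then show False using * False by (simp add: dvd_add_left_iff)
      qed
    qed
  qed
qed

lemma unit_multiplier_between_residues:
  fixes r r' :: int
  assumes "0 < b" "0 < L" and g: "gcd r (int b) = gcd r' (int b)"
  obtains u where "[u * r = r'] (mod int b)" "coprime u (int L)"
proof -
  let ?g = "gcd r (int b)" and ?m = "int b div gcd r (int b)"
  have g0: "?g \<noteq> 0" using assms(1) by simp
  have cop: "coprime (r div ?g) ?m" "coprime (r' div ?g) ?m"
    using assms(1) div_gcd_coprime[of r "int b"] div_gcd_coprime[of r' "int b"] g by auto
  obtain w where w: "[r div ?g * w = 1] (mod ?m)"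
    using cop(1) cong_solve_coprime_int by blast
  have "coprime w ?m"
    using cong_imp_coprime[OF cong_sym[OF w]] by simp
  then have "coprime (w * (r' div ?g)) ?m" using cop by simp
  then obtain u where u: "[u = w * (r' div ?g)] (mod ?m)" "coprime u (int L)"
    using coprime_lift assms(2) by blast
  have "[u * (r div ?g) = w * (r' div ?g) * (r div ?g)] (mod ?m)"
    by (rule cong_mult[OF u(1) cong_refl])
  also have "w * (r' div ?g) * (r div ?g) = (r div ?g * w) * (r' div ?g)" by simp
  also have "[\<dots> = 1 * (r' div ?g)] (mod ?m)" by (rule cong_mult[OF w cong_refl])
  finally have "[?g * (u * (r div ?g)) = ?g * (r' div ?g)] (mod ?g * ?m)"
    using cong_cmult_leftI[of "u * (r div ?g)" "1 * (r' div ?g)" ?m ?g] by simp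
  moreover have "?g * (u * (r div ?g)) = u * r" by (simp add: algebra_simps)
  moreover have "?g * (r' div ?g) = r'" unfolding g by simp
  ultimately have "[u * r = r'] (mod int b)" by simp
  then show ?thesis using that u by blast
qed

text \<open>
  Multiplication by a unit modulo \<open>L\<close> moves one class to the other and preserves divisibility by the
  divisors of \<open>L\<close>. So the number of free integers in a class depends only on its greatest common
  divisor with \<open>b\<close>.
\<close>

lemma card_free_residue_class_le:
  fixes r r' :: int
  assumes "0 < L" "0 < b" "b dvd L" "\<And>c. c \<in> C \<Longrightarrow> c dvd L" and g: "gcd r (int b) = gcd r' (int b)"
  shows "card ({n. [n = r] (mod int b)} \<inter> free_set C \<inter> {0..<int L})
       \<le> card ({n. [n = r'] (mod int b)} \<inter> free_set C \<inter> {0..<int L})"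
proof -
  obtain u where u: "[u * r = r'] (mod int b)" "coprime u (int L)"
    using unit_multiplier_between_residues[OF assms(2,1) g] by blast
  let ?f = "\<lambda>n. (u * n) mod int L"
  let ?K = "\<lambda>r. {n. [n = r] (mod int b)} \<inter> free_set C \<inter> {0..<int L}"
  show ?thesis
  proof (rule card_inj_on_le[of ?f])
    show "inj_on ?f (?K r)"
    proof (rule inj_onI)
      fix x y assume xy: "x \<in> ?K r" "y \<in> ?K r" "?f x = ?f y"
      then have "[u * x = u * y] (mod int L)" by (simp add: cong_def)
      then have "[x = y] (mod int L)" using u(2) by (simp add: cong_mult_lcancel)
      then show "x = y" using xy by (simp add: cong_def)
    qed
    show "?f ` ?K r \<subseteq> ?K r'"
    proof clarify
      fix n assume n: "[n = r] (mod int b)" "n \<in> free_set C"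
      have "[?f n = u * n] (mod int L)" by (simp add: cong_def)
      then have "[?f n = u * n] (mod int b)" by (rule cong_dvd_modulus) (use assms(3) in simp)
      also have "[u * n = u * r] (mod int b)" by (rule cong_mult[OF cong_refl n(1)])
      also note u(1)
      finally have "[?f n = r'] (mod int b)" .
      moreover have "\<not> int c dvd ?f n" if c: "c \<in> C" for c
      proof -
        have cL: "int c dvd int L" using assms(4)[OF c] by simp
        then have "coprime (int c) u" using u(2) by (metis coprime_commute coprime_divisors dvd_refl)
        moreover have "\<not> int c dvd n" using n(2) c by (simp add: free_set_iff)
        ultimately have "\<not> int c dvd u * n" by (simp add: coprime_dvd_mult_right_iff)
        then show ?thesis using cL by (simp add: dvd_mod_iff)
      qed
      ultimately show "?f n \<in> ?K r'"
        using assms(1) by (simp add: free_set_iff)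
    qed
  qed simp
qed

text \<open>
  This turns a prescribed greatest common divisor into divisibility by \<open>d\<close> together with a freeness
  condition, the form that Behrend's inequality can handle.
\<close>

lemma gcd_eq_iff_proper_multiples:
  fixes n b d :: nat
  assumes "d dvd b" "0 < b"
  shows "gcd n b = d \<longleftrightarrow> d dvd n \<and> (\<forall>q. q dvd b div d \<longrightarrow> 1 < q \<longrightarrow> \<not> d * q dvd n)"
proof safe
  fix q assume *: "q dvd b div gcd n b" "1 < q" "gcd n b * q dvd n"
  then have "gcd n b * q dvd b" by (metis gcd_dvd2 dvd_mult_div_cancel mult_dvd_mono dvd_refl)
  then have "gcd n b * q dvd gcd n b * 1" using * by simp
  then have "q dvd 1" using assms(2) by (subst (asm) dvd_times_left_cancel_iff) auto
  then show False using * by simp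
next
  assume *: "d dvd n" "\<forall>q. q dvd b div d \<longrightarrow> 1 < q \<longrightarrow> \<not> d * q dvd n"
  then obtain q where q: "gcd n b = d * q" using assms by (meson dvdE gcd_greatest)
  have "d > 0" using assms dvd_pos_nat by blast
  have "d * q dvd d * (b div d)" using q assms by (metis gcd_dvd2 dvd_mult_div_cancel)
  then have "q dvd b div d" using \<open>d > 0\<close> by simp
  moreover have "d * q dvd n" using q by (metis gcd_dvd1)
  moreover have "q \<noteq> 0" using q assms by (metis gcd_eq_0_iff mult_0_right neq0_conv)
  ultimately have "q = 1" using * by (metis less_one linorder_neqE_nat)
  then show "gcd n b = d" using q by simp
qed

text \<open>
  The classes modulo \<open>b\<close> with the same greatest common divisor \<open>d\<close> as \<open>r\<close> contain equally many free
  integers, and there are at most \<open>b\<close> of them. Together these free integers are the multiples of \<open>d\<close>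
  that are free of \<open>C\<close> and of all \<open>d * q\<close> with \<open>q > 1\<close> dividing \<open>b div d\<close>. After division by \<open>d\<close>
  Behrend's inequality applies.
\<close>

lemma mean_density_residue_class_lower_bound:
  fixes r :: int
  assumes "0 < L" "b \<in> C" "0 < b" "\<And>c. c \<in> C \<Longrightarrow> c dvd L" and d: "int d = gcd r (int b)"
  shows "free_density {q. q dvd b div d \<and> 1 < q} * free_density (gcd_quotients d C) / (d * b)
       \<le> mean_density L ({n. [n = r] (mod int b)} \<inter> free_set C)"
proof -
  have bL: "b dvd L" using assms by blast
  have db: "d dvd b" using d by (metis gcd_dvd2 int_dvd_int_iff)
  have d0: "0 < d" using db assms by (metis dvd_pos_nat)
  define A where "A = {n. gcd n (int b) = int d}"
  define Q where "Q = {q. q dvd b div d \<and> 1 < q}"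
  have per: "periodic_set L A"
    unfolding periodic_set_def
  proof (intro allI impI)
    fix m n assume "[m = n] (mod int L)" "m \<in> A"
    moreover from this have "[m = n] (mod int b)" using bL by (metis cong_dvd_modulus of_nat_dvd_iff)
    then have "gcd m (int b) = gcd n (int b)" by (rule cong_gcd_eq)
    ultimately show "n \<in> A" by (simp add: A_def)
  qed
  have vim: "int -` (A \<inter> free_set C) = {n. d dvd n} \<inter> nfree ((*) d ` Q \<union> C)"
  proof (rule Set.set_eqI)
    fix n
    have "gcd (int n) (int b) = int d \<longleftrightarrow> gcd n b = d" by simp
    then show "n \<in> int -` (A \<inter> free_set C) \<longleftrightarrow> n \<in> {n. d dvd n} \<inter> nfree ((*) d ` Q \<union> C)"
      unfolding vimage_eq Int_iff A_def mem_Collect_eq gcd_eq_iff_proper_multiples[OF db assms(3)]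
      by (simp add: Q_def nfree_def free_set_iff) blast
  qed
  have "gcd_quotients d ((*) d ` Q) = Q"
    using d0 by (auto simp: gcd_quotients_def image_image)
  then have quot: "gcd_quotients d ((*) d ` Q \<union> C) = Q \<union> gcd_quotients d C"
    by (simp add: gcd_quotients_Un)
  have "((\<lambda>s. zeta_prob s (int -` (A \<inter> free_set C))) \<longlongrightarrow> mean_density L (A \<inter> free_set C)) (at_right 1)"
    by (intro zeta_prob_periodic_tendsto periodic_set_Int per periodic_free_set assms)
  from tendsto_unique[OF at_right_1_nontrivial this[unfolded vim] zeta_prob_multiples_Int_nfree_tendsto[OF d0]]
  have dens: "free_density (Q \<union> gcd_quotients d C) / d = mean_density L (A \<inter> free_set C)"
    unfolding quot by simp
  let ?R = "{t\<in>{0..<int b}. gcd t (int b) = int d}"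
  let ?F = "free_set C \<inter> {0..<int L}"
  let ?K = "\<lambda>t. {n. [n = t] (mod int b)} \<inter> ?F"
  have "A \<inter> ?F \<subseteq> (\<Union>t\<in>?R. ?K t)"
  proof
    fix n assume n: "n \<in> A \<inter> ?F"
    have "gcd (n mod int b) (int b) = int d" "[n = n mod int b] (mod int b)"
      using n by (auto simp: A_def cong_def gcd.commute[of "n mod int b"] gcd.commute[of "int b"] simp flip: gcd_red_int)
    then show "n \<in> (\<Union>t\<in>?R. ?K t)"
      using n assms(3) by (intro UN_I[of "n mod int b"]) auto
  qed
  then have "card (A \<inter> ?F) \<le> card (\<Union>t\<in>?R. ?K t)"
    by (rule card_mono[rotated]) (rule finite_subset[of _ "{0..<int L}"], auto)
  also have "\<dots> \<le> (\<Sum>t\<in>?R. card (?K t))"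
    by (rule card_UN_le) (rule finite_subset[of _ "{0..<int b}"], auto)
  also have "\<dots> \<le> (\<Sum>t\<in>?R. card (?K r))"
    using card_free_residue_class_le[OF assms(1,3) bL, of C _ r] assms(4) d
    by (intro sum_mono) (simp add: Int_assoc)
  also have "\<dots> \<le> b * card (?K r)"
  proof -
    have "card ?R \<le> card {0..<int b}"
      by (rule card_mono) auto
    then show ?thesis by (auto intro!: mult_right_mono)
  qed
  finally have card: "card (A \<inter> ?F) \<le> b * card (?K r)" .
  have "free_density Q * free_density (gcd_quotients d C) / (d * b) \<le> free_density (Q \<union> gcd_quotients d C) / (d * b)"
    by (intro divide_right_mono free_density_Un) simp
  also have "\<dots> = mean_density L (A \<inter> free_set C) / b"
    unfolding dens[symmetric] by simp
  also have "\<dots> \<le> mean_density L ({n. [n = r] (mod int b)} \<inter> free_set C)"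
  proof -
    have "real (card (A \<inter> ?F)) \<le> real b * real (card (?K r))"
      using card by (metis of_nat_le_iff of_nat_mult)
    then show ?thesis
      using assms(1,3) unfolding mean_density_def Int_assoc by (simp add: field_simps)
  qed
  finally show ?thesis unfolding Q_def .
qed

text \<open>
  Tautness is positivity for \<open>gcd_quotients b (B - {b})\<close>. The quotients with respect to the divisor
  \<open>d\<close> are multiples of those with respect to \<open>b\<close>, and the one quotient \<open>b div d > 1\<close> coming from \<open>b\<close>
  costs only a positive factor.
\<close>

lemma taut_imp_free_density_gcd_quotients_pos:
  assumes "0 \<notin> B" "taut B" "b \<in> B" "d dvd b" "d < b"
  shows "0 < free_density (gcd_quotients d B)"
proof -
  have b0: "0 < b" using assms by (metis gr0I)
  have d0: "0 < d" using assms b0 dvd_pos_nat by blast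
  have "gcd_quotients d B = {b div d} \<union> gcd_quotients d (B - {b})"
  proof -
    have "B = {b} \<union> (B - {b})" using assms by auto
    then have "gcd_quotients d B = gcd_quotients d {b} \<union> gcd_quotients d (B - {b})"
      by (metis gcd_quotients_Un)
    then show ?thesis using assms(4) by (simp add: gcd_quotients_def gcd_nat.absorb2)
  qed
  moreover have "0 < free_density {b div d}"
    using assms(4,5) b0 d0 by (intro free_density_finite_pos) (auto elim!: dvdE)
  moreover have "free_density (gcd_quotients b (B - {b})) \<le> free_density (gcd_quotients d (B - {b}))"
  proof (rule free_density_antimono)
    fix c assume "c \<in> gcd_quotients d (B - {b})"
    then obtain a where a: "a \<in> B - {b}" "c = a div gcd a d" by (auto simp: gcd_quotients_def)
    have "gcd a d dvd gcd a b" using assms(4) by (auto intro: dvd_trans)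
    then obtain k where k: "gcd a b = gcd a d * k" by (elim dvdE)
    have "a div gcd a d = k * (a div gcd a b)"
    proof -
      obtain j where j: "a = gcd a b * j" using gcd_dvd1[of a b] by (elim dvdE)
      have "gcd a d \<noteq> 0" "gcd a b \<noteq> 0" using d0 b0 by auto
      have "a div gcd a b = j" using j \<open>gcd a b \<noteq> 0\<close> by (metis nonzero_mult_div_cancel_left)
      moreover have "a div gcd a d = k * j"
        using j k \<open>gcd a d \<noteq> 0\<close> by (metis mult.assoc nonzero_mult_div_cancel_left)
      ultimately show ?thesis by simp
    qed
    then have "a div gcd a b dvd c" using a by simp
    moreover have "a div gcd a b \<in> gcd_quotients b (B - {b})"
      using a unfolding gcd_quotients_def by blast
    ultimately show "\<exists>a\<in>gcd_quotients b (B - {b}). a dvd c" by blast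
  qed
  then have "0 < free_density (gcd_quotients d (B - {b}))"
    using assms taut_iff by (metis less_le_trans)
  ultimately show ?thesis
    using less_le_trans[OF mult_pos_pos free_density_Un[of "{b div d}" "gcd_quotients d (B - {b})"]] by simp
qed

text \<open>
  If \<open>b\<close> violates tautness, the quotients split into finitely many parts according to \<open>d = gcd c b\<close>, and
  by Behrend's inequality one part has density zero. Primitivity excludes \<open>d = b\<close>, which is what
  makes \<open>d\<close> a proper divisor.
\<close>

lemma not_taut_imp_free_density_eq_0:
  assumes "0 \<notin> B" "primitive_set B" "\<not> taut B"
  obtains b d where "b \<in> B" "d dvd b" "d < b" "free_density (gcd_quotients d (B - {b})) = 0"
proof -
  obtain b where b: "b \<in> B" "\<not> 0 < free_density (gcd_quotients b (B - {b}))"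
    using assms taut_iff by blast
  have b0: "0 < b" using assms b by (metis gr0I)
  let ?I = "{d. d dvd b \<and> d < b}"
  let ?A = "\<lambda>d. gcd_quotients d {a \<in> B - {b}. gcd a b = d}"
  have "gcd_quotients b (B - {b}) \<subseteq> (\<Union>d\<in>?I. ?A d)"
  proof
    fix c assume "c \<in> gcd_quotients b (B - {b})"
    then obtain a where a: "a \<in> B - {b}" "c = a div gcd a b" by (auto simp: gcd_quotients_def)
    have "\<not> b dvd a" using assms(2) a b by (auto simp: primitive_set_def)
    then have "gcd a b \<noteq> b" by (metis gcd_dvd1)
    then have "gcd a b < b" using b0 by (simp add: order.not_eq_order_implies_strict)
    then have "gcd a b \<in> ?I" by simp
    moreover have "gcd a (gcd a b) = gcd a b" by (simp add: gcd_nat.absorb2)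
    then have "c \<in> ?A (gcd a b)"
      using a by (auto simp: gcd_quotients_def intro!: image_eqI[of _ _ a])
    ultimately show "c \<in> (\<Union>d\<in>?I. ?A d)" by blast
  qed
  then have "free_density (\<Union>d\<in>?I. ?A d) \<le> free_density (gcd_quotients b (B - {b}))"
    by (rule free_density_anti_subset)
  then have "\<not> 0 < free_density (\<Union>d\<in>?I. ?A d)" using b(2) by (meson less_le_trans)
  moreover have "0 < free_density (\<Union>d\<in>?I. ?A d)" if "\<And>d. d \<in> ?I \<Longrightarrow> 0 < free_density (?A d)"
    by (rule free_density_UN_pos[OF _ that]) simp_all
  ultimately obtain d where d: "d \<in> ?I" "\<not> 0 < free_density (?A d)"
    by meson
  have "free_density (gcd_quotients d (B - {b})) \<le> free_density (?A d)"
    unfolding gcd_quotients_def by (intro free_density_anti_subset image_mono) blast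
  then have "free_density (gcd_quotients d (B - {b})) = 0"
    using d free_density_nonneg[of "gcd_quotients d (B - {b})"] by linarith
  then show ?thesis using that[of b d] b(1) d(1) by simp
qed

section \<open>Equivariant maps to the odometer\<close>

text \<open>
  The map \<open>\<theta>\<close> assigns to a point a residue modulo each \<open>b \<in> B\<close>, with \<open>T\<close> acting as addition of one.
  Finitely many of the residues always come from a single integer, so \<open>\<theta>\<close> takes values in the odometer.
  Only residue classes matter: no representative is prescribed. Both the odometer with its
  Haar measure and an arbitrary invariant measure on \<open>Y \<inter> X_eta_her\<close> are instances.
\<close>

locale odometer_factor = prob_space M for M :: "'a measure" +
  fixes T :: "'a \<Rightarrow> 'a" and \<theta> :: "'a \<Rightarrow> nat \<Rightarrow> int" and B :: "nat set"
  assumes zero_notin: "0 \<notin> B"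
    and measurable_T: "T \<in> measurable M M"
    and distr_T: "distr M M T = M"
    and \<theta>_T: "x \<in> space M \<Longrightarrow> b \<in> B \<Longrightarrow> [\<theta> (T x) b = \<theta> x b + 1] (mod int b)"
    and sets_\<theta>: "b \<in> B \<Longrightarrow> {x \<in> space M. [\<theta> x b = r] (mod int b)} \<in> sets M"
    and consistent: "x \<in> space M \<Longrightarrow> finite C \<Longrightarrow> C \<subseteq> B \<Longrightarrow> \<exists>n. \<forall>b\<in>C. [\<theta> x b = n] (mod int b)"
begin

abbreviation residue_event :: "nat set \<Rightarrow> int \<Rightarrow> 'a set" where
  "residue_event C r \<equiv> {x \<in> space M. \<forall>b\<in>C. [\<theta> x b = r] (mod int b)}"

lemma T_space: "x \<in> space M \<Longrightarrow> T x \<in> space M"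
  using measurable_T by (rule measurable_space)

lemma prob_vimage_T: "A \<in> sets M \<Longrightarrow> prob {x \<in> space M. T x \<in> A} = prob A"
  using measure_distr[OF measurable_T, of A] unfolding distr_T
  by (simp add: vimage_def Int_def conj_commute)

lemma sets_residues: "finite C \<Longrightarrow> C \<subseteq> B \<Longrightarrow> residue_event C r \<in> sets M"
  using sets_\<theta> by (intro sets.sets_Collect_finite_All) auto

lemma disjoint_residues:
  assumes "finite C"
  shows "disjoint_family_on (residue_event C) {0..<int (Lcm C)}"
  unfolding disjoint_family_on_def using residues_below_Lcm_unique[OF assms] by blast

text \<open>
  The \<open>Lcm C\<close> compatible systems of residues are permuted cyclically by \<open>T\<close>, hence equally likely.
\<close>

lemma prob_residues:
  assumes C: "finite C" "C \<subseteq> B"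
  shows "prob (residue_event C r) = 1 / Lcm C"
proof -
  define E where "E r = residue_event C r" for r
  have E: "E r \<in> sets M" for r unfolding E_def by (rule sets_residues[OF C])
  have L: "0 < Lcm C" using C zero_notin by (intro Lcm_nat_pos) auto
  have step: "prob (E r) = prob (E (r + 1))" for r
  proof -
    have "[\<theta> (T x) b = r + 1] (mod int b) \<longleftrightarrow> [\<theta> x b = r] (mod int b)" if "x \<in> space M" "b \<in> C" for x b
    proof -
      have "b \<in> B" using that C by blast
      then show ?thesis
        using cong_trans[OF cong_sym[OF \<theta>_T[OF that(1)]], of b "r + 1"]
          cong_trans[OF \<theta>_T[OF that(1)], of b "r + 1"] by (auto simp: cong_add_rcancel)
    qed
    then have "E r = {x \<in> space M. T x \<in> E (r + 1)}"
      using T_space by (auto simp: E_def)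
    then show ?thesis using prob_vimage_T[OF E] by simp
  qed
  have shift: "prob (E (int k)) = prob (E 0)" for k
  proof (induction k)
    case (Suc k)
    then show ?case using step[of "int k"] by (simp add: add.commute)
  qed simp
  have E_cong: "E r = E r'" if "[r = r'] (mod int (Lcm C))" for r r'
    using that unfolding cong_Lcm_iff[OF C(1)] E_def by (blast intro: cong_trans cong_sym)
  have "[r = int (nat (r mod int (Lcm C)))] (mod int (Lcm C))" for r
    using L by (simp add: cong_def)
  from E_cong[OF this] shift have all: "prob (E r) = prob (E 0)" for r by metis
  have disj: "disjoint_family_on E {0..<int (Lcm C)}"
    unfolding E_def by (rule disjoint_residues[OF C(1)])
  have "space M = (\<Union>r\<in>{0..<int (Lcm C)}. E r)"
  proof (intro equalityI subsetI)
    fix x assume x: "x \<in> space M"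
    then obtain n where "\<forall>b\<in>C. [\<theta> x b = n] (mod int b)" using consistent C by blast
    then have "x \<in> E n" using x by (simp add: E_def)
    also have "E n = E (n mod int (Lcm C))" by (rule E_cong) (simp add: cong_def)
    finally show "x \<in> (\<Union>r\<in>{0..<int (Lcm C)}. E r)" using L by (intro UN_I) auto
  qed (auto simp: E_def)
  then have "1 = prob (\<Union>r\<in>{0..<int (Lcm C)}. E r)" by (simp add: prob_space flip: \<open>space M = _\<close>)
  also have "\<dots> = (\<Sum>r\<in>{0..<int (Lcm C)}. prob (E r))"
    by (rule finite_measure_finite_Union) (use E disj in auto)
  also have "\<dots> = (\<Sum>_\<in>{0..<int (Lcm C)}. prob (E 0))"
    by (rule sum.cong[OF refl all])
  also have "\<dots> = Lcm C * prob (E r)"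
    using all[of r] by simp
  finally show ?thesis using L by (simp add: E_def field_simps)
qed

text \<open>
  Densities of periodic sets of integers become probabilities. The event may be given in any form
  that is determined by the residues modulo the elements of \<open>C\<close>.
\<close>

lemma
  assumes C: "finite C" "C \<subseteq> B" and A: "periodic_set (Lcm C) A"
    and Q: "\<And>x n. x \<in> space M \<Longrightarrow> (\<And>b. b \<in> C \<Longrightarrow> [\<theta> x b = n] (mod int b)) \<Longrightarrow> Q x \<longleftrightarrow> n \<in> A"
  shows sets_periodic: "{x \<in> space M. Q x} \<in> sets M"
    and prob_eq_mean_density: "prob {x \<in> space M. Q x} = mean_density (Lcm C) A"
proof -
  have L: "0 < Lcm C" using C zero_notin by (intro Lcm_nat_pos) auto
  let ?E = "residue_event C"
  let ?R = "A \<inter> {0..<int (Lcm C)}"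
  have eq: "{x \<in> space M. Q x} = (\<Union>r\<in>?R. ?E r)"
  proof (intro equalityI subsetI)
    fix x assume x: "x \<in> {x \<in> space M. Q x}"
    then obtain n where n: "\<forall>b\<in>C. [\<theta> x b = n] (mod int b)" using consistent C by blast
    let ?m = "n mod int (Lcm C)"
    have m: "[n = ?m] (mod int (Lcm C))" by (simp add: cong_def)
    have "n \<in> A" using Q x n by blast
    then have "?m \<in> A" using m A unfolding periodic_set_def by blast
    then have "?m \<in> ?R" using L by simp
    moreover have "x \<in> ?E ?m"
      using x n m unfolding cong_Lcm_iff[OF C(1)] by (auto intro: cong_trans)
    ultimately show "x \<in> (\<Union>r\<in>?R. ?E r)" by blast
  qed (use Q in auto)
  have E: "?E r \<in> sets M" for r by (rule sets_residues[OF C])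
  then show "{x \<in> space M. Q x} \<in> sets M" unfolding eq by (intro sets.finite_UN) auto
  have "disjoint_family_on ?E ?R"
    using disjoint_residues[OF C(1)] by (rule disjoint_family_on_mono[rotated]) simp
  then have "prob (\<Union>r\<in>?R. ?E r) = (\<Sum>r\<in>?R. prob (?E r))"
    by (intro finite_measure_finite_Union) (use E in auto)
  also have "\<dots> = mean_density (Lcm C) A"
    by (simp add: prob_residues[OF C] mean_density_def)
  finally show "prob {x \<in> space M. Q x} = mean_density (Lcm C) A" unfolding eq .
qed

lemma dvd_\<theta>_iff: "[\<theta> x b = n] (mod int b) \<Longrightarrow> int b dvd \<theta> x b \<longleftrightarrow> int b dvd n"
  by (rule cong_dvd_iff)

text \<open>
  Truncating \<open>D\<close> turns the event into one about finitely many residues, whose probability is the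
  density of the multiples of \<open>d\<close> free of the truncation of \<open>D\<close>.
\<close>

lemma prob_free_multiples_eq_0:
  assumes D: "D \<subseteq> B" and b: "b \<in> B" "d dvd b" and zero: "free_density (gcd_quotients d D) = 0"
  shows "prob {x \<in> space M. int d dvd \<theta> x b \<and> (\<forall>c\<in>D. \<not> int c dvd \<theta> x c)} = 0"
proof -
  have d0: "0 < d" using b zero_notin by (metis dvd_0_left gr0I)
  let ?Q = "\<lambda>D x. int d dvd \<theta> x b \<and> (\<forall>c\<in>D. \<not> int c dvd \<theta> x c)"
  have "prob {x \<in> space M. ?Q D x} \<le> free_density (gcd_quotients d D \<inter> {..K})" for K
  proof -
    \<comment> \<open>An element \<open>c\<close> of \<open>D\<close> with quotient at most \<open>K\<close> is itself at most \<open>d * K\<close>.\<close>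
    let ?D = "D \<inter> {..d * K}" and ?C = "insert b (D \<inter> {..d * K})"
    let ?A = "{n. int d dvd n} \<inter> free_set ?D"
    have C: "finite ?C" "?C \<subseteq> B" using D b by auto
    have L: "0 < Lcm ?C" using C zero_notin by (intro Lcm_nat_pos) auto
    have dL: "d dvd Lcm ?C" by (rule dvd_trans[OF b(2) dvd_Lcm]) simp
    have per: "periodic_set (Lcm ?C) ?A"
    proof (rule periodic_set_Int)
      show "periodic_set (Lcm ?C) {n. int d dvd n}"
        using periodic_dvd_add[OF dL, of 0] by simp
      show "periodic_set (Lcm ?C) (free_set ?D)"
        by (rule periodic_free_set) (rule dvd_Lcm, simp)
    qed
    have Q: "?Q ?D x \<longleftrightarrow> n \<in> ?A"
      if "x \<in> space M" "\<And>c. c \<in> ?C \<Longrightarrow> [\<theta> x c = n] (mod int c)" for x n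
    proof -
      have "[\<theta> x b = n] (mod int d)" using that(2)[of b] b(2) by (auto intro: cong_dvd_modulus)
      then have "int d dvd \<theta> x b \<longleftrightarrow> int d dvd n" by (rule cong_dvd_iff)
      moreover have "int c dvd \<theta> x c \<longleftrightarrow> int c dvd n" if "c \<in> ?D" for c
        using \<open>\<And>c. c \<in> ?C \<Longrightarrow> [\<theta> x c = n] (mod int c)\<close> that by (intro dvd_\<theta>_iff) simp
      ultimately show ?thesis unfolding Int_iff mem_Collect_eq free_set_iff by blast
    qed
    have "prob {x \<in> space M. ?Q D x} \<le> prob {x \<in> space M. ?Q ?D x}"
      by (intro finite_measure_mono sets_periodic[OF C per Q]) auto
    also have "\<dots> = mean_density (Lcm ?C) ?A" by (rule prob_eq_mean_density[OF C per Q])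
    also have "\<dots> = free_density (gcd_quotients d ?D) / d"
    proof (rule tendsto_unique[OF at_right_1_nontrivial zeta_prob_periodic_tendsto[OF L per]])
      have "int -` ?A = {n. d dvd n} \<inter> nfree ?D" by (auto simp: nfree_eq)
      then show "((\<lambda>s. zeta_prob s (int -` ?A)) \<longlongrightarrow> free_density (gcd_quotients d ?D) / d) (at_right 1)"
        using zeta_prob_multiples_Int_nfree_tendsto[OF d0] by simp
    qed
    also have "\<dots> \<le> free_density (gcd_quotients d ?D)"
      using free_density_nonneg[of "gcd_quotients d ?D"] d0 divide_left_mono[of 1 "real d" "free_density (gcd_quotients d ?D)"] by simp
    also have "\<dots> \<le> free_density (gcd_quotients d D \<inter> {..K})"
    proof (rule free_density_anti_subset, rule subsetI)
      fix q assume "q \<in> gcd_quotients d D \<inter> {..K}"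
      then obtain c where c: "c \<in> D" "q = c div gcd c d" "q \<le> K" by (auto simp: gcd_quotients_def)
      have "c = gcd c d * q" using c by simp
      also have "\<dots> \<le> d * K" using c d0 by (intro mult_le_mono) (auto intro: gcd_le2_nat)
      finally show "q \<in> gcd_quotients d ?D" using c by (auto simp: gcd_quotients_def)
    qed
    finally show ?thesis .
  qed
  then have "prob {x \<in> space M. ?Q D x} \<le> 0"
    using LIMSEQ_le_const[OF free_density_truncate[of "gcd_quotients d D"]] zero by auto
  then show ?thesis by (simp add: measure_le_0_iff)
qed

end

section \<open>Haar measure on the odometer\<close>

locale odometer =
  fixes B :: "nat set"
  assumes zero_notin: "0 \<notin> B"
begin

abbreviation "G \<equiv> odometer_set B"
abbreviation "\<tau> \<equiv> subtopology (residue_topology B) (odometer_set B)"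
abbreviation "residue_box \<equiv> (\<Pi>\<^sub>E b\<in>B. {0..<int b})"

text \<open>
  Prescribing the residues for all \<open>b \<le> k\<close> at once makes the cylinders nested or disjoint, so together
  with the empty set they are closed under intersection.
\<close>

definition cylinder :: "nat \<Rightarrow> int \<Rightarrow> (nat \<Rightarrow> int) set" where
  "cylinder k r = {g \<in> G. \<forall>b\<in>B \<inter> {..k}. [g b = r] (mod int b)}"

abbreviation "cylinders \<equiv> range (\<lambda>(k, r). cylinder k r)"

definition translate :: "(nat \<Rightarrow> int) \<Rightarrow> (nat \<Rightarrow> int) \<Rightarrow> (nat \<Rightarrow> int)" where
  "translate g x = (\<lambda>b\<in>B. (g b + x b) mod int b)"

lemma pos: "b \<in> B \<Longrightarrow> 0 < b"
  using zero_notin by (metis gr0I)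

lemma carrier_mod: "b \<in> B \<Longrightarrow> carrier (integer_mod_group b) = {0..<int b}"
  using pos by (simp add: carrier_integer_mod_group)

lemma topspace_residue: "topspace (residue_topology B) = residue_box"
  unfolding residue_topology_def by (auto simp: carrier_mod cong: PiE_cong)

lemma openin_residue_cylinder:
  "openin (residue_topology B) {g \<in> residue_box. \<forall>b\<in>C. [g b = r b] (mod int b)}" if "finite C" "C \<subseteq> B"
proof -
  have "{g \<in> residue_box. \<forall>b\<in>C. [g b = r b] (mod int b)}
      = (\<Pi>\<^sub>E b\<in>B. {m \<in> {0..<int b}. b \<in> C \<longrightarrow> [m = r b] (mod int b)})"
    by (rule Set.set_eqI) (use that(2) in \<open>simp add: PiE_iff, blast\<close>)
  also have "openin (residue_topology B) \<dots>"
    unfolding residue_topology_def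
    by (subst openin_PiE_gen)
       (use that carrier_mod in \<open>auto intro: finite_subset[OF _ that(1)]\<close>)
  finally show ?thesis .
qed

text \<open>
  The coordinate spaces are discrete, and a basic neighbourhood constrains only finitely many of them.
\<close>

lemma odometer_set_eq:
  "G = {g \<in> residue_box. \<forall>C. finite C \<longrightarrow> C \<subseteq> B \<longrightarrow> (\<exists>n. \<forall>b\<in>C. [g b = n] (mod int b))}"
    (is "_ = ?G")
proof (intro equalityI subsetI)
  fix g assume "g \<in> G"
  then have g: "g \<in> residue_box"
    and lim: "\<And>U. g \<in> U \<Longrightarrow> openin (residue_topology B) U \<Longrightarrow> \<exists>n. (\<lambda>b\<in>B. n mod int b) \<in> U"
    unfolding odometer_set_def in_closure_of topspace_residue by auto
  have "\<exists>n. \<forall>b\<in>C. [g b = n] (mod int b)" if C: "finite C" "C \<subseteq> B" for C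
  proof -
    have "openin (residue_topology B) {h \<in> residue_box. \<forall>b\<in>C. [h b = g b] (mod int b)}"
      by (rule openin_residue_cylinder[OF C])
    moreover have "g \<in> {h \<in> residue_box. \<forall>b\<in>C. [h b = g b] (mod int b)}"
      using g by simp
    ultimately obtain n where n: "(\<lambda>b\<in>B. n mod int b) \<in> {h \<in> residue_box. \<forall>b\<in>C. [h b = g b] (mod int b)}"
      using lim by meson
    have "[g b = n] (mod int b)" if "b \<in> C" for b
    proof -
      have "[(\<lambda>b\<in>B. n mod int b) b = g b] (mod int b)" using n that by blast
      then show ?thesis using that C by (auto simp: cong_def)
    qed
    then show ?thesis by blast
  qed
  then show "g \<in> ?G" using g by blast
next
  fix g assume g: "g \<in> ?G"
  show "g \<in> G"
    unfolding odometer_set_def in_closure_of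
  proof (intro conjI allI impI)
    show "g \<in> topspace (residue_topology B)" using g by (simp add: topspace_residue)
    fix U assume U: "g \<in> U \<and> openin (residue_topology B) U"
    then obtain X where X: "g \<in> (\<Pi>\<^sub>E b\<in>B. X b)"
      "finite {b. X b \<noteq> carrier (integer_mod_group b)}" "(\<Pi>\<^sub>E b\<in>B. X b) \<subseteq> U"
      using product_topology_open_contains_basis[of "\<lambda>b. discrete_topology (carrier (integer_mod_group b))" B U g]
      unfolding residue_topology_def by (auto simp: topspace_discrete_topology)
    let ?C = "B \<inter> {b. X b \<noteq> carrier (integer_mod_group b)}"
    obtain n where n: "\<forall>b\<in>?C. [g b = n] (mod int b)" using g X(2) by blast
    have "n mod int b \<in> X b" if b: "b \<in> B" for b
    proof (cases "b \<in> ?C")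
      case True
      then have "n mod int b = g b" using n g b by (auto simp: cong_def PiE_iff)
      then show ?thesis using X(1) b by auto
    qed (use b pos[OF b] in \<open>auto simp: carrier_mod\<close>)
    then have "(\<lambda>b\<in>B. n mod int b) \<in> U" using X(3) by auto
    then show "\<exists>y. y \<in> range (\<lambda>n. \<lambda>b\<in>B. n mod int b) \<and> y \<in> U" by blast
  qed
qed

lemma G_box: "g \<in> G \<Longrightarrow> g \<in> residue_box"
  by (simp add: odometer_set_eq)

lemma G_consistent: "g \<in> G \<Longrightarrow> finite C \<Longrightarrow> C \<subseteq> B \<Longrightarrow> \<exists>n. \<forall>b\<in>C. [g b = n] (mod int b)"
  by (simp add: odometer_set_eq)

lemma topspace_\<tau>: "topspace \<tau> = G"
  using G_box by (auto simp: topspace_residue)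

lemma openin_cylinder: "openin \<tau> (cylinder k r)"
proof -
  have "cylinder k r = {g \<in> residue_box. \<forall>b\<in>B \<inter> {..k}. [g b = r] (mod int b)} \<inter> G"
    using G_box by (auto simp: cylinder_def)
  then show ?thesis using openin_residue_cylinder[of "B \<inter> {..k}" "\<lambda>_. r"] by (auto simp: openin_subtopology)
qed

lemma openin_contains_cylinder:
  assumes "openin \<tau> U" "g \<in> U"
  shows "\<exists>k r. g \<in> cylinder k r \<and> cylinder k r \<subseteq> U"
proof -
  obtain V where V: "openin (residue_topology B) V" "U = V \<inter> G"
    using assms by (auto simp: openin_subtopology)
  then obtain X where X: "g \<in> (\<Pi>\<^sub>E b\<in>B. X b)"
    "finite {b. X b \<noteq> carrier (integer_mod_group b)}" "(\<Pi>\<^sub>E b\<in>B. X b) \<subseteq> V"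
    using product_topology_open_contains_basis[of "\<lambda>b. discrete_topology (carrier (integer_mod_group b))" B V g] assms(2)
    unfolding residue_topology_def by (auto simp: topspace_discrete_topology)
  define k where "k = Max (insert 0 {b. X b \<noteq> carrier (integer_mod_group b)})"
  have k: "b \<le> k" if "X b \<noteq> carrier (integer_mod_group b)" for b
    unfolding k_def using X(2) that by (intro Max_ge) auto
  have gG: "g \<in> G" using V assms by blast
  then obtain n where n: "\<forall>b\<in>B \<inter> {..k}. [g b = n] (mod int b)"
    using G_consistent[of g "B \<inter> {..k}"] by auto
  have "cylinder k n \<subseteq> U"
  proof
    fix h assume h: "h \<in> cylinder k n"
    then have hG: "h \<in> G" by (simp add: cylinder_def)
    have "h b \<in> X b" if b: "b \<in> B" for b
    proof (cases "b \<le> k")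
      case True
      then have "[h b = n] (mod int b)" "[g b = n] (mod int b)" using h n b by (auto simp: cylinder_def)
      then have "[h b = g b] (mod int b)" by (rule cong_trans[OF _ cong_sym])
      then have "h b = g b" using G_box[OF hG] G_box[OF gG] b by (auto simp: cong_def PiE_iff)
      then show ?thesis using X(1) b by auto
    next
      case False
      then have "X b = carrier (integer_mod_group b)" using k by blast
      then show ?thesis using G_box[OF hG] b carrier_mod by auto
    qed
    then have "h \<in> (\<Pi>\<^sub>E b\<in>B. X b)" using G_box[OF hG] by (auto simp: PiE_iff)
    then show "h \<in> U" using X(3) V(2) hG by blast
  qed
  moreover have "g \<in> cylinder k n" using gG n by (simp add: cylinder_def)
  ultimately show ?thesis by blast
qed

lemma sigma_sets_cylinders:
  "sigma_sets G {U. openin \<tau> U} = sigma_sets G cylinders"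
proof (rule sigma_sets_eqI)
  fix U assume "U \<in> {U. openin \<tau> U}"
  then have "U = \<Union>{cylinder k r |k r. cylinder k r \<subseteq> U}"
    using openin_contains_cylinder[of U] by blast
  moreover have "countable {cylinder k r |k r. cylinder k r \<subseteq> U}"
    by (rule countable_subset[of _ "cylinders"]) auto
  moreover have "\<Union>{cylinder k r |k r. cylinder k r \<subseteq> U} \<in> sigma_sets G cylinders"
    using calculation(2) by (rule sigma_sets_UNION) auto
  ultimately show "U \<in> sigma_sets G cylinders" by simp
qed (use openin_cylinder in auto)

lemma cylinder_subset: "cylinders \<subseteq> Pow G"
  by (auto simp: cylinder_def)

text \<open>
  There are only countably many cylinders, so this is the Borel sigma-algebra of the odometer
  (\<open>sets_odometer_space\<close>).
\<close>

definition odometer_space :: "(nat \<Rightarrow> int) measure" where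
  "odometer_space = sigma G cylinders"

lemma space_odometer_space: "space odometer_space = G"
  unfolding odometer_space_def by (rule space_measure_of[OF cylinder_subset])

lemma sets_odometer_space: "sets odometer_space = sigma_sets G {U. openin \<tau> U}"
  unfolding odometer_space_def sigma_sets_cylinders by (rule sets_measure_of[OF cylinder_subset])

lemma sets_cylinder: "cylinder k r \<in> sets odometer_space"
  unfolding odometer_space_def by (auto intro!: in_measure_of[OF cylinder_subset])

lemma measurable_odometerI:
  assumes "\<And>x. x \<in> space M \<Longrightarrow> f x \<in> G" "\<And>k r. f -` cylinder k r \<inter> space M \<in> sets M"
  shows "f \<in> measurable M odometer_space"
proof (rule measurable_sigma_sets[OF _ cylinder_subset])
  show "sets odometer_space = sigma_sets G cylinders"
    unfolding odometer_space_def by (rule sets_measure_of[OF cylinder_subset])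
qed (use assms in auto)

lemma cylinder_Int_cylinder:
  assumes "k \<le> k'"
  shows "cylinder k r \<inter> cylinder k' r' \<in> {{}, cylinder k' r'}"
proof (cases "\<forall>b\<in>B \<inter> {..k}. [r = r'] (mod int b)")
  case True
  then have "cylinder k' r' \<subseteq> cylinder k r"
    using assms unfolding cylinder_def by (auto simp: cong_def)
  then show ?thesis by blast
next
  case False
  then obtain b where "b \<in> B \<inter> {..k}" "\<not> [r = r'] (mod int b)" by blast
  then have "cylinder k r \<inter> cylinder k' r' = {}"
    using assms unfolding cylinder_def by (auto simp: cong_def)
  then show ?thesis by blast
qed

lemma Int_stable_cylinders: "Int_stable (insert {} cylinders)"
proof (rule Int_stableI)
  fix U V assume UV: "U \<in> insert {} cylinders" "V \<in> insert {} cylinders"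
  show "U \<inter> V \<in> insert {} cylinders"
  proof (cases "U = {} \<or> V = {}")
    case False
    then obtain k r k' r' where *: "U = cylinder k r" "V = cylinder k' r'" using UV by auto
    show ?thesis
      using cylinder_Int_cylinder[of k k' r r'] cylinder_Int_cylinder[of k' k r' r]
      unfolding * by (cases "k \<le> k'") (auto simp: Int_commute)
  qed auto
qed

lemma cylinder_0: "cylinder 0 r = G"
  using zero_notin by (auto simp: cylinder_def)

lemma measure_eqI_cylinders:
  assumes "sets M = sets odometer_space" "sets N = sets odometer_space" "prob_space M"
    and eq: "\<And>k r. emeasure M (cylinder k r) = emeasure N (cylinder k r)"
  shows "M = N"
proof (rule measure_eqI_generator_eq[OF Int_stable_cylinders, where \<Omega> = G and A = "\<lambda>_. G"])
  interpret prob_space M by fact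
  show "emeasure M G \<noteq> \<infinity>" by simp
  show "emeasure M X = emeasure N X" if "X \<in> insert {} cylinders" for X
    using that eq by auto
  have "sigma_sets G (insert {} cylinders) = sigma_sets G cylinders"
    by (rule sigma_sets_eqI) (auto intro: sigma_sets.Empty)
  then show "sets M = sigma_sets G (insert {} cylinders)"
    "sets N = sigma_sets G (insert {} cylinders)"
    using assms sets_odometer_space sigma_sets_cylinders by auto
  show "range (\<lambda>_. G) \<subseteq> insert {} cylinders"
    using cylinder_0[of 0] by (auto simp: image_iff intro!: exI[of _ 0])
qed (use cylinder_subset in auto)

lemma translate_apply: "b \<in> B \<Longrightarrow> [translate g x b = g b + x b] (mod int b)"
  by (simp add: translate_def cong_def)

lemma translate_box: "translate g x \<in> residue_box"
  using pos by (auto simp: translate_def)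

lemma translate_in_G: "g \<in> G \<Longrightarrow> x \<in> G \<Longrightarrow> translate g x \<in> G"
proof -
  assume *: "g \<in> G" "x \<in> G"
  have "\<exists>n. \<forall>b\<in>C. [translate g x b = n] (mod int b)" if C: "finite C" "C \<subseteq> B" for C
  proof -
    obtain m n where mn: "\<forall>b\<in>C. [g b = m] (mod int b)" "\<forall>b\<in>C. [x b = n] (mod int b)"
      using G_consistent[OF *(1) C] G_consistent[OF *(2) C] by blast
    have "[translate g x b = m + n] (mod int b)" if "b \<in> C" for b
      using translate_apply[of b g x] cong_add[of "g b" m "int b" "x b" n] mn that C by (blast intro: cong_trans)
    then show ?thesis by blast
  qed
  then show ?thesis using translate_box by (simp add: odometer_set_eq)
qed

lemma vimage_translate_cylinder:
  assumes "g \<in> G"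
  obtains m where "\<And>r. translate g -` cylinder k r \<inter> G = cylinder k (r - m)"
proof -
  obtain m where m: "\<forall>b\<in>B \<inter> {..k}. [g b = m] (mod int b)"
    using G_consistent[OF assms, of "B \<inter> {..k}"] by auto
  have "translate g -` cylinder k r \<inter> G = cylinder k (r - m)" for r
  proof -
    have "[translate g x b = r] (mod int b) \<longleftrightarrow> [x b = r - m] (mod int b)" if b: "b \<in> B \<inter> {..k}" for x b
    proof -
      have *: "[translate g x b = m + x b] (mod int b)"
        using translate_apply[of b g x] cong_add[of "g b" m "int b" "x b" "x b"] m b by (auto intro: cong_trans)
      have "[translate g x b = r] (mod int b) \<longleftrightarrow> [m + x b = m + (r - m)] (mod int b)"
        using * by (simp add: cong_def)
      then show ?thesis by (simp only: cong_add_lcancel)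
    qed
    then show ?thesis using translate_in_G[OF assms] by (auto simp: cylinder_def)
  qed
  then show ?thesis using that by blast
qed

lemma measurable_translate:
  assumes "g \<in> G"
  shows "translate g \<in> measurable odometer_space odometer_space"
proof (rule measurable_odometerI)
  fix k r
  obtain m where "translate g -` cylinder k r \<inter> G = cylinder k (r - m)"
    using vimage_translate_cylinder[OF assms] by metis
  then show "translate g -` cylinder k r \<inter> space odometer_space \<in> sets odometer_space"
    by (simp add: space_odometer_space sets_cylinder)
qed (simp add: space_odometer_space translate_in_G[OF assms])

definition invert :: "(nat \<Rightarrow> int) \<Rightarrow> (nat \<Rightarrow> int)" where
  "invert g = (\<lambda>b\<in>B. (- g b) mod int b)"

lemma invert_in_G:
  assumes "g \<in> G"
  shows "invert g \<in> G"
proof -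
  have "\<exists>n. \<forall>b\<in>C. [invert g b = n] (mod int b)" if C: "finite C" "C \<subseteq> B" for C
  proof -
    obtain m where m: "\<forall>b\<in>C. [g b = m] (mod int b)" using G_consistent assms C by blast
    have "[invert g b = - m] (mod int b)" if "b \<in> C" for b
    proof -
      have "[invert g b = - g b] (mod int b)" using that C by (auto simp: invert_def cong_def)
      also have "[- g b = - m] (mod int b)" using m that by (simp add: cong_minus_minus_iff)
      finally show ?thesis .
    qed
    then show ?thesis by blast
  qed
  then show ?thesis using pos by (auto simp: odometer_set_eq invert_def)
qed

lemma translate_invert:
  assumes "x \<in> G"
  shows "translate g (translate (invert g) x) = x" "translate (invert g) (translate g x) = x"
  using G_box[OF assms]
  by (auto simp: translate_def invert_def fun_eq_iff PiE_iff extensional_def mod_simps restrict_def)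

lemma image_translate:
  assumes "g \<in> G" "A \<subseteq> G"
  shows "translate g ` A = translate (invert g) -` A \<inter> G"
proof (intro equalityI subsetI)
  fix x assume "x \<in> translate (invert g) -` A \<inter> G"
  then show "x \<in> translate g ` A"
    by (intro image_eqI[of _ _ "translate (invert g) x"]) (auto simp: translate_invert)
qed (use assms translate_in_G translate_invert in auto)

text \<open>
  Consecutive moduli divide each other. They are the place values of a mixed radix system in which a
  point of the odometer is an infinite digit sequence; independent uniform digits give the Haar
  measure.
\<close>

definition modulus :: "nat \<Rightarrow> nat" where
  "modulus k = Lcm (B \<inter> {..k})"

lemma modulus_pos: "0 < modulus k"
  unfolding modulus_def using zero_notin by (intro Lcm_nat_pos) auto

lemma modulus_0: "modulus 0 = 1"
proof -
  have "B \<inter> {..0} = {}" using zero_notin by auto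
  then show ?thesis by (simp add: modulus_def)
qed

lemma dvd_modulus: "b \<in> B \<Longrightarrow> b \<le> k \<Longrightarrow> b dvd modulus k"
  unfolding modulus_def by (intro dvd_Lcm) auto

lemma modulus_dvd_Suc: "modulus k dvd modulus (Suc k)"
  unfolding modulus_def by (intro Lcm_subset) auto

definition ratio :: "nat \<Rightarrow> nat" where
  "ratio k = modulus (Suc k) div modulus k"

lemma modulus_Suc: "modulus (Suc k) = modulus k * ratio k"
  unfolding ratio_def using modulus_dvd_Suc[of k] by simp

lemma ratio_pos: "0 < ratio k"
  using modulus_Suc[of k] modulus_pos[of "Suc k"] by (metis gr0I mult_0_right)

definition digit_sum :: "nat \<Rightarrow> (nat \<Rightarrow> nat) \<Rightarrow> nat" where
  "digit_sum k w = (\<Sum>j<k. w j * modulus j)"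

definition from_digits :: "(nat \<Rightarrow> nat) \<Rightarrow> (nat \<Rightarrow> int)" where
  "from_digits w = (\<lambda>b\<in>B. int (digit_sum b w) mod int b)"

definition digit_measure :: "(nat \<Rightarrow> nat) measure" where
  "digit_measure = PiM UNIV (\<lambda>k. measure_pmf (pmf_of_set {..<ratio k}))"

lemma from_digits_cong:
  assumes b: "b \<in> B" "b \<le> k"
  shows "[from_digits w b = int (digit_sum k w)] (mod int b)"
proof -
  have "int b dvd int (digit_sum k w) - int (digit_sum b w)"
    using b(2)
  proof (induction k rule: dec_induct)
    case (step j)
    have "int b dvd int (w j * modulus j)"
      using dvd_modulus[OF b(1) step(1)] by simp
    then have "int b dvd (int (digit_sum j w) - int (digit_sum b w)) + int (w j * modulus j)"
      using step by simp
    then show ?case by (simp add: digit_sum_def algebra_simps)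
  qed simp
  then have "[int (digit_sum k w) = int (digit_sum b w)] (mod int b)"
    by (simp add: cong_iff_dvd_diff)
  then show ?thesis using b by (simp add: from_digits_def cong_def)
qed

lemma from_digits_in_G: "from_digits w \<in> G"
proof -
  have "\<exists>n. \<forall>b\<in>C. [from_digits w b = n] (mod int b)" if C: "finite C" "C \<subseteq> B" for C
    using C by (intro exI[of _ "int (digit_sum (Max (insert 0 C)) w)"] ballI from_digits_cong) auto
  then show ?thesis using pos by (auto simp: odometer_set_eq from_digits_def)
qed

lemma vimage_from_digits_cylinder:
  "from_digits w \<in> cylinder k r \<longleftrightarrow> [int (digit_sum k w) = r] (mod int (modulus k))"
proof -
  have "[from_digits w b = r] (mod int b) \<longleftrightarrow> [int (digit_sum k w) = r] (mod int b)" if "b \<in> B \<inter> {..k}" for b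
    using from_digits_cong[of b k w] that by (simp add: cong_def)
  then show ?thesis
    unfolding cylinder_def using from_digits_in_G[of w]
    by (simp add: modulus_def cong_Lcm_iff)
qed

lemma prob_space_digit_measure: "prob_space digit_measure"
  unfolding digit_measure_def by (intro prob_space_PiM measure_pmf.prob_space_axioms)

lemma measurable_digit_sum: "digit_sum k \<in> measurable digit_measure (count_space UNIV)"
proof (induction k)
  case (Suc k)
  have "(\<lambda>w. w k) \<in> measurable digit_measure (measure_pmf (pmf_of_set {..<ratio k}))"
    unfolding digit_measure_def by (rule measurable_component_singleton) simp
  then have k: "(\<lambda>w. w k) \<in> measurable digit_measure (count_space UNIV)"
    by (simp add: measurable_def)
  have "(\<lambda>w. i + w k * modulus k) \<in> measurable digit_measure (count_space UNIV)" for i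
    by (rule measurable_compose[OF k]) simp
  from measurable_compose_countable[OF this Suc]
  show ?case by (simp add: digit_sum_def)
qed (simp add: digit_sum_def)

lemma measurable_from_digits: "from_digits \<in> measurable digit_measure odometer_space"
proof (rule measurable_odometerI)
  fix k r
  have "from_digits -` cylinder k r \<inter> space digit_measure
      = digit_sum k -` {n. [int n = r] (mod int (modulus k))} \<inter> space digit_measure"
    by (auto simp: vimage_from_digits_cylinder)
  then show "from_digits -` cylinder k r \<inter> space digit_measure \<in> sets digit_measure"
    by (simp only:) (rule measurable_sets[OF measurable_digit_sum], simp)
qed (rule from_digits_in_G)

lemma digit_sum_digits: "digit_sum k (\<lambda>j. (r div modulus j) mod ratio j) = r mod modulus k"
proof (induction k)
  case (Suc k)
  have "r mod modulus (Suc k) = modulus k * (r div modulus k mod ratio k) + r mod modulus k"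
    unfolding modulus_Suc by (rule mod_mult2_eq)
  then show ?case using Suc by (simp add: digit_sum_def)
qed (simp add: digit_sum_def modulus_0)

definition uniform_odometer :: "(nat \<Rightarrow> int) measure" where
  "uniform_odometer = distr digit_measure odometer_space from_digits"

lemma prob_space_uniform_odometer: "prob_space uniform_odometer"
  unfolding uniform_odometer_def
  by (rule prob_space.prob_space_distr[OF prob_space_digit_measure measurable_from_digits])

text \<open>
  The event that the first \<open>k\<close> digits are those of a representative of \<open>r\<close> lies in the cylinder and has
  probability \<open>1 / modulus k\<close>.
\<close>

lemma measure_uniform_odometer_cylinder_ge: "1 / modulus k \<le> measure uniform_odometer (cylinder k r)"
proof -
  interpret D: product_prob_space "\<lambda>k. measure_pmf (pmf_of_set {..<ratio k})" UNIV ..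
  define n where "n = nat (r mod int (modulus k))"
  have n: "int n = r mod int (modulus k)" "n < modulus k"
    using modulus_pos[of k] by (auto simp: n_def nat_less_iff)
  let ?d = "\<lambda>j. (n div modulus j) mod ratio j"
  let ?E = "{w \<in> space digit_measure. \<forall>j\<in>{..<k}. w j \<in> {?d j}}"
  have "emeasure digit_measure ?E = (\<Prod>j<k. emeasure (measure_pmf (pmf_of_set {..<ratio j})) {?d j})"
    unfolding digit_measure_def by (rule D.emeasure_PiM_Collect) auto
  also have "\<dots> = (\<Prod>j<k. ennreal (1 / ratio j))"
  proof (rule prod.cong[OF refl])
    fix j
    have "?d j < ratio j" "{..<ratio j} \<noteq> {}" using ratio_pos[of j] by auto
    then show "emeasure (measure_pmf (pmf_of_set {..<ratio j})) {?d j} = ennreal (1 / ratio j)"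
      by (simp add: emeasure_pmf_single)
  qed
  also have "\<dots> = ennreal (\<Prod>j<k. 1 / ratio j)" by (rule prod_ennreal) simp
  also have "(\<Prod>j<k. 1 / ratio j) = 1 / modulus k"
    by (induction k) (simp_all add: modulus_0 modulus_Suc)
  finally have "measure digit_measure ?E = 1 / modulus k" by (simp add: measure_def)
  moreover have "?E \<subseteq> from_digits -` cylinder k r \<inter> space digit_measure"
  proof
    fix w assume w: "w \<in> ?E"
    then have "digit_sum k w = digit_sum k ?d" by (simp add: digit_sum_def)
    also have "\<dots> = n" unfolding digit_sum_digits using n by simp
    finally have "[int (digit_sum k w) = r] (mod int (modulus k))" using n by (simp add: cong_def)
    then show "w \<in> from_digits -` cylinder k r \<inter> space digit_measure"
      using w by (simp add: vimage_from_digits_cylinder)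
  qed
  moreover have "measure uniform_odometer (cylinder k r) = measure digit_measure (from_digits -` cylinder k r \<inter> space digit_measure)"
    unfolding uniform_odometer_def by (rule measure_distr[OF measurable_from_digits sets_cylinder])
  moreover have "from_digits -` cylinder k r \<inter> space digit_measure \<in> sets digit_measure"
    by (rule measurable_sets[OF measurable_from_digits sets_cylinder])
  ultimately show ?thesis
    using finite_measure.finite_measure_mono[OF prob_space.finite_measure[OF prob_space_digit_measure],
      of ?E "from_digits -` cylinder k r \<inter> space digit_measure"] by linarith
qed

text \<open>
  The lower bounds for the \<open>modulus k\<close> disjoint cylinders already add up to one.
\<close>

lemma measure_uniform_odometer_cylinder: "measure uniform_odometer (cylinder k r) = 1 / modulus k"
proof -
  interpret P: prob_space uniform_odometer by (rule prob_space_uniform_odometer)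
  define s where "s = r mod int (modulus k)"
  have s: "s \<in> {0..<int (modulus k)}" using modulus_pos[of k] by (simp add: s_def)
  have [simp]: "cylinder k r' \<in> sets uniform_odometer" for r'
    using sets_cylinder by (simp add: uniform_odometer_def)
  have "[r = s] (mod int (modulus k))" by (simp add: s_def cong_def)
  then have rs: "cylinder k r = cylinder k s"
    unfolding cylinder_def modulus_def by (subst (asm) cong_Lcm_iff) (auto simp: cong_def)
  have disj: "disjoint_family_on (cylinder k) {0..<int (modulus k)}"
    unfolding disjoint_family_on_def modulus_def cylinder_def
    using residues_below_Lcm_unique[of "B \<inter> {..k}"] by blast
  have "P.prob (cylinder k s) + (\<Sum>n\<in>{0..<int (modulus k)} - {s}. P.prob (cylinder k n))
      = (\<Sum>n\<in>{0..<int (modulus k)}. P.prob (cylinder k n))"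
    using s by (simp add: sum.remove)
  also have "\<dots> = P.prob (\<Union>n\<in>{0..<int (modulus k)}. cylinder k n)"
    by (rule P.finite_measure_finite_Union[symmetric]) (use disj in auto)
  also have "\<dots> \<le> 1" by (rule P.prob_le_1)
  finally have "P.prob (cylinder k s) + (\<Sum>n\<in>{0..<int (modulus k)} - {s}. P.prob (cylinder k n)) \<le> 1" .
  moreover have "(\<Sum>n\<in>{0..<int (modulus k)} - {s}. 1 / modulus k) \<le> (\<Sum>n\<in>{0..<int (modulus k)} - {s}. P.prob (cylinder k n))"
    by (intro sum_mono measure_uniform_odometer_cylinder_ge)
  moreover have "(\<Sum>n\<in>{0..<int (modulus k)} - {s}. 1 / modulus k) = 1 - 1 / modulus k"
  proof -
    have "card ({0..<int (modulus k)} - {s}) = modulus k - 1" using s by simp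
    then show ?thesis using modulus_pos[of k] by (simp add: of_nat_diff diff_divide_distrib)
  qed
  ultimately show ?thesis
    using measure_uniform_odometer_cylinder_ge[of k s] unfolding rs by linarith
qed

definition unit_rotation :: "(nat \<Rightarrow> int) \<Rightarrow> (nat \<Rightarrow> int)" where
  "unit_rotation = translate (\<lambda>b\<in>B. 1 mod int b)"

lemma unit_in_G: "(\<lambda>b\<in>B. 1 mod int b) \<in> G"
  unfolding odometer_set_eq using pos by (auto simp: cong_def intro!: exI[of _ 1])

lemma sets_cong_odometer:
  assumes "b \<in> B"
  shows "{g \<in> G. [g b = r] (mod int b)} \<in> sets odometer_space"
proof -
  have "openin \<tau> {g \<in> G. [g b = r] (mod int b)}"
  proof -
    have "{g \<in> G. [g b = r] (mod int b)} = {g \<in> residue_box. \<forall>b\<in>{b}. [g b = r] (mod int b)} \<inter> G"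
      using G_box by auto
    then show ?thesis using openin_residue_cylinder[of "{b}" "\<lambda>_. r"] assms by (auto simp: openin_subtopology)
  qed
  then show ?thesis unfolding sets_odometer_space by auto
qed

lemma odometer_factor_rotation:
  assumes "prob_space P" "sets P = sets odometer_space"
    and inv: "\<And>A. A \<in> sets P \<Longrightarrow> emeasure P (unit_rotation -` A \<inter> G) = emeasure P A"
  shows "odometer_factor P unit_rotation (\<lambda>g. g) B"
proof -
  have space: "space P = G" using sets_eq_imp_space_eq[OF assms(2)] space_odometer_space by simp
  interpret prob_space P by fact
  have meas: "unit_rotation \<in> measurable P P"
    using measurable_translate[OF unit_in_G] measurable_cong_sets[OF assms(2,2)] by (simp add: unit_rotation_def)
  show ?thesis
  proof
    show "0 \<notin> B" by (rule zero_notin)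
    show "unit_rotation \<in> measurable P P" by (rule meas)
    show "distr P P unit_rotation = P"
      by (rule measure_eqI) (use inv meas space in \<open>auto simp: emeasure_distr\<close>)
    show "[unit_rotation x b = x b + 1] (mod int b)" if "b \<in> B" for x b
      using translate_apply[OF that, of "\<lambda>b\<in>B. 1 mod int b" x] that
      by (simp add: unit_rotation_def cong_def mod_simps add.commute)
    show "{x \<in> space P. [x b = r] (mod int b)} \<in> sets P" if "b \<in> B" for b r
      using sets_cong_odometer[OF that] by (simp add: space assms(2))
    show "\<exists>n. \<forall>b\<in>C. [x b = n] (mod int b)" if "x \<in> space P" "finite C" "C \<subseteq> B" for x C
      using G_consistent that by (simp add: space)
  qed
qed

lemma measure_cylinder:
  assumes "odometer_factor P unit_rotation (\<lambda>g. g) B" "sets P = sets odometer_space"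
  shows "measure P (cylinder k r) = 1 / modulus k"
proof -
  interpret odometer_factor P unit_rotation "\<lambda>g. g" B by fact
  have "space P = G" using sets_eq_imp_space_eq[OF assms(2)] space_odometer_space by simp
  then show ?thesis using prob_residues[of "B \<inter> {..k}" r] by (simp add: cylinder_def modulus_def)
qed

text \<open>
  Invariance under the rotation by the unit alone determines the measure of every cylinder.
\<close>

lemma rotation_invariant_unique:
  assumes "odometer_factor P unit_rotation (\<lambda>g. g) B" "sets P = sets odometer_space"
    and "odometer_factor Q unit_rotation (\<lambda>g. g) B" "sets Q = sets odometer_space"
  shows "P = Q"
proof -
  interpret P: odometer_factor P unit_rotation "\<lambda>g. g" B by fact
  interpret Q: odometer_factor Q unit_rotation "\<lambda>g. g" B by fact
  show ?thesis
    by (rule measure_eqI_cylinders[OF assms(2,4) P.prob_space_axioms])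
       (simp add: P.emeasure_eq_measure Q.emeasure_eq_measure measure_cylinder[OF assms(1,2)] measure_cylinder[OF assms(3,4)])
qed

lemma uniform_odometer_translate:
  assumes g: "g \<in> G" and A: "A \<in> sets odometer_space"
  shows "emeasure uniform_odometer (translate g -` A \<inter> G) = emeasure uniform_odometer A"
proof -
  interpret P: prob_space uniform_odometer by (rule prob_space_uniform_odometer)
  have sets: "sets uniform_odometer = sets odometer_space" by (simp add: uniform_odometer_def)
  have space: "space uniform_odometer = G"
    using sets_eq_imp_space_eq[OF sets] space_odometer_space by simp
  have meas: "translate g \<in> measurable uniform_odometer odometer_space"
    using measurable_translate[OF g] measurable_cong_sets[OF sets refl] by blast
  interpret D: prob_space "distr uniform_odometer odometer_space (translate g)"
    by (rule P.prob_space_distr[OF meas])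
  have "distr uniform_odometer odometer_space (translate g) = uniform_odometer"
  proof (rule measure_eqI_cylinders)
    fix k r
    obtain m where m: "translate g -` cylinder k r \<inter> G = cylinder k (r - m)"
      using vimage_translate_cylinder[OF g] by metis
    have "emeasure (distr uniform_odometer odometer_space (translate g)) (cylinder k r)
        = emeasure uniform_odometer (cylinder k (r - m))"
      using emeasure_distr[OF meas sets_cylinder, of k r] by (simp add: space m)
    then show "emeasure (distr uniform_odometer odometer_space (translate g)) (cylinder k r) = emeasure uniform_odometer (cylinder k r)"
      by (simp add: P.emeasure_eq_measure measure_uniform_odometer_cylinder)
  qed (simp_all add: sets D.prob_space_axioms)
  then show ?thesis
    using emeasure_distr[OF meas A] by (simp add: space)
qed

text \<open>
  The defining property in \<open>normalized_haar\<close>, for the odometer.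
\<close>

definition haar_properties :: "(nat \<Rightarrow> int) measure \<Rightarrow> bool" where
  "haar_properties P \<longleftrightarrow> prob_space P \<and> space P = topspace \<tau> \<and> sets P = sigma_sets (topspace \<tau>) {U. openin \<tau> U} \<and>
     (\<forall>g\<in>carrier (odometer_group B). \<forall>A\<in>sets P. emeasure P ((\<lambda>x. g \<otimes>\<^bsub>odometer_group B\<^esub> x) ` A) = emeasure P A)"

lemma mult_odometer_group: "g \<otimes>\<^bsub>odometer_group B\<^esub> x = translate g x"
  by (simp add: odometer_group_def product_group_def translate_def)

lemma carrier_odometer_group: "carrier (odometer_group B) = G"
  by (simp add: odometer_group_def)

lemma haar_properties_uniform_odometer: "haar_properties uniform_odometer"
proof -
  have sets: "sets uniform_odometer = sets odometer_space" by (simp add: uniform_odometer_def)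
  have space: "space uniform_odometer = G"
    using sets_eq_imp_space_eq[OF sets] space_odometer_space by simp
  have "emeasure uniform_odometer (translate g ` A) = emeasure uniform_odometer A"
    if "g \<in> G" "A \<in> sets uniform_odometer" for g A
  proof -
    have "A \<subseteq> G" using sets.sets_into_space[OF that(2)] space by simp
    then show ?thesis
      using image_translate[OF that(1)] uniform_odometer_translate[OF invert_in_G[OF that(1)], of A] that(2) sets by simp
  qed
  then show ?thesis
    unfolding haar_properties_def mult_odometer_group carrier_odometer_group topspace_\<tau>
    using prob_space_uniform_odometer sets sets_odometer_space space by simp
qed

lemma haar_properties_imp_factor:
  assumes "haar_properties P"
  shows "odometer_factor P unit_rotation (\<lambda>g. g) B" "sets P = sets odometer_space"
proof -
  have P: "prob_space P" "space P = G" "sets P = sets odometer_space"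
    and inv: "\<And>g A. g \<in> G \<Longrightarrow> A \<in> sets P \<Longrightarrow> emeasure P (translate g ` A) = emeasure P A"
    using assms unfolding haar_properties_def mult_odometer_group carrier_odometer_group topspace_\<tau>
    by (auto simp: sets_odometer_space)
  show "sets P = sets odometer_space" by fact
  show "odometer_factor P unit_rotation (\<lambda>g. g) B"
  proof (rule odometer_factor_rotation[OF P(1,3)])
    fix A assume A: "A \<in> sets P"
    let ?u = "\<lambda>b\<in>B. 1 mod int b"
    have AG: "A \<subseteq> G" using sets.sets_into_space[OF A] P(2) by simp
    have "unit_rotation -` A \<inter> G \<in> sets P"
      using measurable_sets[OF measurable_translate[OF unit_in_G], of A] A P(3) space_odometer_space
      by (simp add: unit_rotation_def)
    from inv[OF unit_in_G this]
    have "emeasure P (translate ?u ` (unit_rotation -` A \<inter> G)) = emeasure P (unit_rotation -` A \<inter> G)" .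
    moreover have "translate ?u ` (unit_rotation -` A \<inter> G) = A"
    proof (intro equalityI subsetI)
      fix x assume x: "x \<in> A"
      then have "x \<in> G" using AG by blast
      then show "x \<in> translate ?u ` (unit_rotation -` A \<inter> G)"
        using x translate_in_G[OF invert_in_G[OF unit_in_G]]
        by (intro image_eqI[of _ _ "translate (invert ?u) x"]) (simp_all add: unit_rotation_def translate_invert)
    qed (auto simp: unit_rotation_def)
    ultimately show "emeasure P (unit_rotation -` A \<inter> G) = emeasure P A" by simp
  qed
qed

theorem odometer_haar:
  "odometer_factor (odometer_haar B) unit_rotation (\<lambda>g. g) B"
  "sets (odometer_haar B) = sets odometer_space"
proof -
  have "odometer_haar B = (THE P. haar_properties P)"
    unfolding odometer_haar_def normalized_haar_def haar_properties_def ..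
  moreover have "haar_properties (THE P. haar_properties P)"
    by (rule theI[of haar_properties, OF haar_properties_uniform_odometer])
       (rule rotation_invariant_unique[OF haar_properties_imp_factor haar_properties_imp_factor[OF haar_properties_uniform_odometer]])
  ultimately have "haar_properties (odometer_haar B)" by simp
  then show "odometer_factor (odometer_haar B) unit_rotation (\<lambda>g. g) B"
    "sets (odometer_haar B) = sets odometer_space"
    using haar_properties_imp_factor by blast+
qed

text \<open>
  Conditioning on an invariant set of positive measure gives another invariant probability measure,
  which by uniqueness is the original one.
\<close>

lemma rotation_ergodic:
  assumes P: "odometer_factor P unit_rotation (\<lambda>g. g) B" "sets P = sets odometer_space"
    and I: "I \<in> sets P" "unit_rotation -` I \<inter> G = I"
  shows "measure P I = 0 \<or> measure P I = 1"
proof (cases "measure P I = 0")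
  case False
  interpret odometer_factor P unit_rotation "\<lambda>g. g" B by fact
  have space: "space P = G" using sets_eq_imp_space_eq[OF P(2)] space_odometer_space by simp
  have nz: "emeasure P I \<noteq> 0" "emeasure P I \<noteq> \<infinity>" using False by (auto simp: emeasure_eq_measure)
  let ?U = "uniform_measure P I"
  have U: "prob_space ?U" using nz by (rule prob_space_uniform_measure)
  have eq: "emeasure P (unit_rotation -` A \<inter> G) = emeasure P A" if "A \<in> sets P" for A
    using emeasure_distr[OF measurable_T that] unfolding distr_T space by simp
  have "odometer_factor ?U unit_rotation (\<lambda>g. g) B"
  proof (rule odometer_factor_rotation[OF U])
    show "sets ?U = sets odometer_space" using P by simp
    fix A assume "A \<in> sets ?U"
    then have A: "A \<in> sets P" by simp
    have "I \<inter> (unit_rotation -` A \<inter> G) = unit_rotation -` (I \<inter> A) \<inter> G"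
      using I(2) by auto
    then show "emeasure ?U (unit_rotation -` A \<inter> G) = emeasure ?U A"
      using eq[of "I \<inter> A"] A I(1) measurable_sets[OF measurable_T A] by (simp add: space)
  qed
  then have "?U = P" using P by (intro rotation_invariant_unique) auto
  then have "emeasure P I = emeasure P (I \<inter> I) / emeasure P I"
    using emeasure_uniform_measure[OF I(1) I(1)] by simp
  also have "\<dots> = 1" unfolding Int_absorb by (rule ennreal_divide_self[OF nz(1)]) (simp flip: less_top)
  finally show ?thesis by (simp add: emeasure_eq_measure)
qed simp

end

section \<open>Patterns absent from the orbit of the free integers\<close>

text \<open>
  A shift by \<open>i\<close> changes a positive integer by a factor of at most \<open>1 + \<bar>i\<bar>\<close>; for \<open>s \<le> 2\<close> the weight changes by
  at most the square of this factor.
\<close>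

lemma zeta_weight_shift_le:
  fixes i :: int
  assumes s: "1 < s" "s \<le> 2" and n: "0 < n" and i: "int n = int m + i" and m: "0 < m"
  shows "zeta_weight s m \<le> (1 + \<bar>i\<bar>)\<^sup>2 * zeta_weight s n"
proof -
  let ?c = "1 + \<bar>real_of_int i\<bar>"
  have "real n \<le> real m + \<bar>real_of_int i\<bar>"
    using arg_cong[OF i, of real_of_int] by simp
  also have "\<dots> \<le> real m + real m * \<bar>real_of_int i\<bar>"
    using m mult_right_mono[of 1 "real m" "\<bar>real_of_int i\<bar>"] by simp
  finally have "real n \<le> ?c * real m" by (simp add: algebra_simps)
  then have "(?c * real m) powr (- s) \<le> real n powr (- s)"
    using n s by (intro powr_mono2') auto
  then have "?c powr s * (?c powr (- s) * real m powr (- s)) \<le> ?c powr s * real n powr (- s)"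
    by (intro mult_left_mono) (auto simp: powr_mult)
  moreover have "?c powr s * (?c powr (- s) * real m powr (- s)) = real m powr (- s)"
    by (simp add: powr_minus)
  moreover have "?c powr s * real n powr (- s) \<le> ?c powr 2 * real n powr (- s)"
    using s by (intro mult_right_mono powr_mono) auto
  moreover have "?c powr 2 = (1 + \<bar>i\<bar>)\<^sup>2"
    by (simp add: powr_realpow)
  ultimately show ?thesis by (simp add: zeta_weight_def)
qed

text \<open>
  The first summand accounts for the finitely many \<open>m\<close> with \<open>m = 0\<close> or \<open>m + i \<le> 0\<close>.
\<close>

lemma zeta_prob_shift_le:
  fixes i :: int
  assumes s: "1 < s" "s \<le> 2"
  shows "zeta_prob s {m. int m + i \<in> E} \<le> (1 + \<bar>i\<bar>) / zeta_sum s + (1 + \<bar>i\<bar>)\<^sup>2 * zeta_prob s (int -` E)"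
proof -
  let ?F = "{0..nat (- i)}" and ?M = "{m. 0 < m \<and> 0 < int m + i \<and> int m + i \<in> E}"
  have z: "0 < zeta_sum s" by (rule zeta_sum_pos[OF s(1)])
  have w: "zeta_weight s n \<le> 1" for n
    using powr_mono2'[of "- s" 1 "real n"] s by (cases "n = 0") (auto simp: zeta_weight_def)
  have "zeta_prob s ?F = (\<Sum>n\<in>?F. pmf (zeta_pmf s) n)"
    by (rule measure_measure_pmf_finite) simp
  also have "\<dots> \<le> (\<Sum>n\<in>?F. 1 / zeta_sum s)"
    by (rule sum_mono) (use z w in \<open>simp add: pmf_zeta[OF s(1)] divide_right_mono\<close>)
  also have "\<dots> \<le> (1 + \<bar>i\<bar>) / zeta_sum s"
    using z by (auto simp: intro!: divide_right_mono)
  finally have F: "zeta_prob s ?F \<le> (1 + \<bar>i\<bar>) / zeta_sum s" .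
  have inj: "inj_on (\<lambda>m. nat (int m + i)) ?M" by (auto simp: inj_on_def)
  have "zeta_prob s ?M = infsetsum (pmf (zeta_pmf s)) ?M" by (rule measure_pmf_conv_infsetsum)
  also have "\<dots> \<le> infsetsum (\<lambda>m. (1 + \<bar>i\<bar>)\<^sup>2 * pmf (zeta_pmf s) (nat (int m + i))) ?M"
  proof (rule infsetsum_mono)
    show "Infinite_Set_Sum.abs_summable_on (\<lambda>m. (1 + \<bar>i\<bar>)\<^sup>2 * pmf (zeta_pmf s) (nat (int m + i))) ?M"
      using abs_summable_on_reindex_iff[OF inj, of "pmf (zeta_pmf s)"] pmf_abs_summable
      by (intro abs_summable_on_cmult_right) auto
    fix m assume m: "m \<in> ?M"
    have "zeta_weight s m \<le> (1 + \<bar>i\<bar>)\<^sup>2 * zeta_weight s (nat (int m + i))"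
      using m by (intro zeta_weight_shift_le[OF s]) auto
    then show "pmf (zeta_pmf s) m \<le> (1 + \<bar>i\<bar>)\<^sup>2 * pmf (zeta_pmf s) (nat (int m + i))"
      using z by (simp add: pmf_zeta[OF s(1)] divide_right_mono)
  qed (rule pmf_abs_summable)
  also have "\<dots> = (1 + \<bar>i\<bar>)\<^sup>2 * infsetsum (\<lambda>m. pmf (zeta_pmf s) (nat (int m + i))) ?M"
    using abs_summable_on_reindex_iff[OF inj, of "pmf (zeta_pmf s)"] pmf_abs_summable
    by (intro infsetsum_cmult_right) auto
  also have "infsetsum (\<lambda>m. pmf (zeta_pmf s) (nat (int m + i))) ?M = zeta_prob s ((\<lambda>m. nat (int m + i)) ` ?M)"
    unfolding measure_pmf_conv_infsetsum by (rule infsetsum_reindex[OF inj, symmetric])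
  also have "(1 + \<bar>i\<bar>)\<^sup>2 * \<dots> \<le> (1 + \<bar>i\<bar>)\<^sup>2 * zeta_prob s (int -` E)"
    by (intro mult_left_mono measure_pmf.finite_measure_mono) auto
  finally have M: "zeta_prob s ?M \<le> (1 + \<bar>i\<bar>)\<^sup>2 * zeta_prob s (int -` E)" .
  have "{m. int m + i \<in> E} \<subseteq> ?F \<union> ?M"
  proof
    fix m assume "m \<in> {m. int m + i \<in> E}"
    then show "m \<in> ?F \<union> ?M" by (cases "m = 0 \<or> int m + i \<le> 0") auto
  qed
  then have "zeta_prob s {m. int m + i \<in> E} \<le> zeta_prob s (?F \<union> ?M)"
    by (rule measure_pmf.finite_measure_mono) simp
  also have "\<dots> \<le> zeta_prob s ?F + zeta_prob s ?M"
    by (rule measure_Un_le) auto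
  finally show ?thesis using F M by linarith
qed

text \<open>
  Wherever the truncated set shows a pattern on \<open>W\<close> that the full free set never shows, the two differ
  at one of the places \<open>m + i\<close>. Those integers are divisible only by elements of \<open>B\<close> beyond \<open>K\<close>, and
  they are rare.
\<close>

lemma mean_density_absent_pattern_le:
  fixes W S :: "int set" and B :: "nat set"
  defines "A K \<equiv> {m. \<forall>i\<in>W. (m + i \<in> free_set (B \<inter> {..K})) \<longleftrightarrow> i \<in> S}"
  assumes B: "0 \<notin> B" and W: "finite W" and absent: "\<And>m. \<not> (\<forall>i\<in>W. m + i \<in> free_set B \<longleftrightarrow> i \<in> S)"
  shows "periodic_set (Lcm (B \<inter> {..K})) (A K)"
    and "mean_density (Lcm (B \<inter> {..K})) (A K)
      \<le> (\<Sum>i\<in>W. (1 + \<bar>i\<bar>)\<^sup>2 * (free_density (B \<inter> {..K}) - free_density B))"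
proof -
  let ?C = "B \<inter> {..K}"
  have L: "0 < Lcm ?C" using B by (intro Lcm_nat_pos) auto
  have "m + i \<in> free_set ?C \<longleftrightarrow> n + i \<in> free_set ?C" if "[m = n] (mod int (Lcm ?C))" for m n i
    using that periodic_free_set[of ?C "Lcm ?C"] unfolding periodic_set_def
    by (meson cong_add cong_refl cong_sym dvd_Lcm)
  then show per: "periodic_set (Lcm ?C) (A K)"
    unfolding periodic_set_def A_def by blast
  show "mean_density (Lcm ?C) (A K) \<le> (\<Sum>i\<in>W. (1 + \<bar>i\<bar>)\<^sup>2 * (free_density ?C - free_density B))"
  proof (rule tendsto_le[OF at_right_1_nontrivial _ zeta_prob_periodic_tendsto[OF L per]])
    let ?b = "\<lambda>s. \<Sum>i\<in>W. (1 + \<bar>i\<bar>) * (1 / zeta_sum s) + (1 + \<bar>i\<bar>)\<^sup>2 * (zeta_prob s (nfree ?C) - free_density B)"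
    have "((\<lambda>s. 1 / zeta_sum s) \<longlongrightarrow> 0) (at_right 1)"
      by (rule real_tendsto_divide_at_top[OF tendsto_const filterlim_zeta_sum_at_right_1])
    then have "(?b
        \<longlongrightarrow> (\<Sum>i\<in>W. (1 + \<bar>i\<bar>) * (0 :: real) + (1 + \<bar>i\<bar>)\<^sup>2 * (free_density ?C - free_density B))) (at_right 1)"
      by (intro tendsto_intros zeta_prob_nfree_tendsto)
    then show "(?b
        \<longlongrightarrow> (\<Sum>i\<in>W. (1 + \<bar>i\<bar>)\<^sup>2 * (free_density ?C - free_density B))) (at_right 1)"
      by simp
    have "eventually (\<lambda>s. s < 2) (at_right (1::real))"
      by (rule eventually_at_rightI[of 1 2]) auto
    then show "eventually (\<lambda>s. zeta_prob s (int -` A K)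
        \<le> ?b s) (at_right 1)"
      using eventually_at_right_less[of 1]
    proof eventually_elim
      case (elim s)
      let ?E = "free_set ?C - free_set B"
      have "int -` A K \<subseteq> (\<Union>i\<in>W. {m. int m + i \<in> ?E})"
      proof
        fix m assume m: "m \<in> int -` A K"
        obtain i where i: "i \<in> W" "(int m + i \<in> free_set B) \<noteq> (i \<in> S)" using absent by blast
        have "free_set B \<subseteq> free_set ?C" by (auto simp: free_set_iff)
        then have "int m + i \<in> ?E" using i m by (auto simp: A_def)
        then show "m \<in> (\<Union>i\<in>W. {m. int m + i \<in> ?E})" using i by blast
      qed
      then have "zeta_prob s (int -` A K) \<le> zeta_prob s (\<Union>i\<in>W. {m. int m + i \<in> ?E})"
        by (rule measure_pmf.finite_measure_mono) simp
      also have "\<dots> \<le> (\<Sum>i\<in>W. zeta_prob s {m. int m + i \<in> ?E})"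
        by (rule measure_pmf.finite_measure_subadditive_finite[OF W]) auto
      also have "\<dots> \<le> ?b s"
      proof (rule sum_mono)
        fix i :: int
        have "zeta_prob s (int -` ?E) \<le> zeta_prob s (nfree ?C) - free_density B"
          using zeta_prob_tail_le[OF elim(2), of B K] by (simp add: nfree_eq vimage_Diff)
        then have "(1 + \<bar>i\<bar>)\<^sup>2 * zeta_prob s (int -` ?E) \<le> (1 + \<bar>i\<bar>)\<^sup>2 * (zeta_prob s (nfree ?C) - free_density B)"
          by (rule mult_left_mono) simp
        then show "zeta_prob s {m. int m + i \<in> ?E}
            \<le> (1 + \<bar>i\<bar>) * (1 / zeta_sum s) + (1 + \<bar>i\<bar>)\<^sup>2 * (zeta_prob s (nfree ?C) - free_density B)"
          using zeta_prob_shift_le[of s i ?E] elim by simp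
      qed
      finally show ?case .
    qed
  qed
qed

context odometer_factor
begin

text \<open>
  For the odometer and \<open>C = B\<close> this is the map \<open>phi\<close>; see \<open>phi_eq_free_at\<close>.
\<close>

definition free_at :: "nat set \<Rightarrow> 'a \<Rightarrow> int \<Rightarrow> bool" where
  "free_at C x i \<longleftrightarrow> (\<forall>b\<in>C. \<not> int b dvd i + \<theta> x b)"

lemma sets_free_at:
  assumes "C \<subseteq> B"
  shows "{x \<in> space M. free_at C x i} \<in> sets M"
proof -
  have "{x \<in> space M. \<not> int b dvd i + \<theta> x b} \<in> sets M" if "b \<in> C" for b
  proof -
    have "int b dvd i + \<theta> x b \<longleftrightarrow> [\<theta> x b = - i] (mod int b)" for x
      by (simp add: cong_iff_dvd_diff add.commute)
    then have "{x \<in> space M. \<not> int b dvd i + \<theta> x b} = space M - {x \<in> space M. [\<theta> x b = - i] (mod int b)}"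
      by auto
    then show ?thesis using sets_\<theta>[of b "- i"] that assms by auto
  qed
  then show ?thesis unfolding free_at_def by (intro sets.sets_Collect_countable_All') auto
qed

lemma free_at_T:
  assumes "x \<in> space M" "C \<subseteq> B"
  shows "free_at C (T x) i \<longleftrightarrow> free_at C x (i + 1)"
proof -
  have "int b dvd i + \<theta> (T x) b \<longleftrightarrow> int b dvd (i + 1) + \<theta> x b" if "b \<in> C" for b
  proof (rule cong_dvd_iff)
    have "[i + \<theta> (T x) b = i + (\<theta> x b + 1)] (mod int b)"
      using \<theta>_T assms that by (intro cong_add cong_refl) auto
    then show "[i + \<theta> (T x) b = (i + 1) + \<theta> x b] (mod int b)" by (simp add: algebra_simps)
  qed
  then show ?thesis by (auto simp: free_at_def)
qed

lemma free_at_iff_free_set: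
  assumes "\<And>b. b \<in> C \<Longrightarrow> [\<theta> x b = n] (mod int b)"
  shows "free_at C x i \<longleftrightarrow> n + i \<in> free_set C"
proof -
  have "int b dvd i + \<theta> x b \<longleftrightarrow> int b dvd n + i" if "b \<in> C" for b
    using cong_dvd_iff[OF cong_add[OF cong_refl[of i] assms[OF that]]] by (simp add: add.commute)
  then show ?thesis by (auto simp: free_at_def free_set_iff)
qed

text \<open>
  The pattern of a point on \<open>W\<close> is eventually that of its truncations, and for these the probability is
  the density just estimated, which tends to zero.
\<close>

lemma prob_absent_pattern:
  assumes W: "finite W" and absent: "\<And>m. \<not> (\<forall>i\<in>W. m + i \<in> free_set B \<longleftrightarrow> i \<in> S)"
  shows "prob {x \<in> space M. \<forall>i\<in>W. free_at B x i \<longleftrightarrow> i \<in> S} = 0"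
proof -
  let ?C = "\<lambda>K. B \<inter> {..K}"
  define A where "A K = {m. \<forall>i\<in>W. (m + i \<in> free_set (?C K)) \<longleftrightarrow> i \<in> S}" for K
  note A = mean_density_absent_pattern_le[OF zero_notin W absent, folded A_def]
  define E where "E K = {x \<in> space M. \<forall>K'. K \<le> K' \<longrightarrow> (\<forall>i\<in>W. free_at (?C K') x i \<longleftrightarrow> i \<in> S)}" for K
  have sets_eq: "{x \<in> space M. free_at C x i \<longleftrightarrow> i \<in> S} \<in> sets M" if "C \<subseteq> B" for C i
    using sets.sets_Collect_neg[OF sets_free_at[OF that, of i]] sets_free_at[OF that, of i] by (cases "i \<in> S") auto
  have pat: "{x \<in> space M. \<forall>i\<in>W. free_at C x i \<longleftrightarrow> i \<in> S} \<in> sets M" if "C \<subseteq> B" for C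
    using sets_eq[OF that] W by (intro sets.sets_Collect_finite_All) auto
  have E: "E K \<in> sets M" for K
    unfolding E_def by (intro sets.sets_Collect_countable_All sets.sets_Collect_imp pat) (auto intro: sets.sets_Collect_const)
  have le: "prob (E K) \<le> (\<Sum>i\<in>W. (1 + \<bar>i\<bar>)\<^sup>2 * (free_density (?C K) - free_density B))" for K
  proof -
    have "prob (E K) \<le> prob {x \<in> space M. \<forall>i\<in>W. free_at (?C K) x i \<longleftrightarrow> i \<in> S}"
      by (rule finite_measure_mono[OF _ pat]) (auto simp: E_def)
    also have "\<dots> = mean_density (Lcm (?C K)) (A K)"
    proof (rule prob_eq_mean_density[OF _ _ A(1)])
      fix x n assume "\<And>b. b \<in> ?C K \<Longrightarrow> [\<theta> x b = n] (mod int b)"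
      then have "free_at (?C K) x i \<longleftrightarrow> n + i \<in> free_set (?C K)" for i
        by (rule free_at_iff_free_set)
      then show "(\<forall>i\<in>W. free_at (?C K) x i \<longleftrightarrow> i \<in> S) \<longleftrightarrow> n \<in> A K" by (simp add: A_def)
    qed auto
    also note A(2)
    finally show ?thesis .
  qed
  have "incseq E" unfolding incseq_def E_def by auto
  then have "(\<lambda>K. prob (E K)) \<longlonglongrightarrow> prob (\<Union>K. E K)"
    using E by (intro finite_Lim_measure_incseq) auto
  moreover have "(\<lambda>K. \<Sum>i\<in>W. (1 + \<bar>i\<bar>)\<^sup>2 * (free_density (?C K) - free_density B)) \<longlonglongrightarrow> (\<Sum>i\<in>W. (1 + \<bar>i\<bar>)\<^sup>2 * (free_density B - free_density B))"
    by (intro tendsto_intros free_density_truncate)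
  ultimately have "prob (\<Union>K. E K) \<le> 0"
    using LIMSEQ_le[of "\<lambda>K. prob (E K)" "prob (\<Union>K. E K)"] le by simp
  moreover have "{x \<in> space M. \<forall>i\<in>W. free_at B x i \<longleftrightarrow> i \<in> S} \<subseteq> (\<Union>K. E K)"
  proof
    fix x assume x: "x \<in> {x \<in> space M. \<forall>i\<in>W. free_at B x i \<longleftrightarrow> i \<in> S}"
    have "\<exists>K. \<forall>K'\<ge>K. free_at (?C K') x i = free_at B x i" for i
    proof (cases "free_at B x i")
      case False
      then obtain b where "b \<in> B" "int b dvd i + \<theta> x b" by (auto simp: free_at_def)
      then show ?thesis using False by (intro exI[of _ b]) (auto simp: free_at_def)
    qed (auto simp: free_at_def)
    then obtain K where K: "\<And>i K'. K i \<le> K' \<Longrightarrow> free_at (?C K') x i = free_at B x i" by metis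
    have "K i \<le> Max (insert 0 (K ` W))" if "i \<in> W" for i
      using W that by (intro Max_ge) auto
    then have "x \<in> E (Max (insert 0 (K ` W)))"
      using x K by (fastforce simp: E_def)
    then show "x \<in> (\<Union>K. E K)" by blast
  qed
  then have "prob {x \<in> space M. \<forall>i\<in>W. free_at B x i \<longleftrightarrow> i \<in> S} \<le> prob (\<Union>K. E K)"
    using E by (intro finite_measure_mono) auto
  ultimately show ?thesis by (simp add: measure_le_0_iff)
qed

text \<open>
  All truncations of \<open>B\<close> share a positive lower bound, computed from the whole of \<open>B\<close>. The greatest common divisor of \<open>r\<close> and \<open>b\<close> is a proper divisor of \<open>b\<close> because \<open>b\<close> does
  not divide \<open>r\<close>, as the positivity statement for taut sets requires.
\<close>

lemma prob_free_residue_class_pos: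
  assumes "taut B" and b: "b \<in> B" and r: "\<not> int b dvd r"
  shows "0 < prob {x \<in> space M. [\<theta> x b = r] (mod int b) \<and> free_at B x 0}"
proof -
  have b0: "0 < b" using b zero_notin by (metis gr0I)
  define d where "d = nat (gcd r (int b))"
  have d: "int d = gcd r (int b)" by (simp add: d_def)
  have db: "d dvd b" using d by (metis gcd_dvd2 int_dvd_int_iff)
  have d0: "0 < d" using db b0 dvd_pos_nat by blast
  have "d \<noteq> b" using d r by (metis gcd_dvd1)
  then have dltb: "d < b" using db b0 dvd_imp_le by (simp add: order.not_eq_order_implies_strict)
  let ?Q = "{q. q dvd b div d \<and> 1 < q}"
  let ?c = "free_density ?Q * free_density (gcd_quotients d B) / (d * b)"
  have "0 < b div d" using db dltb d0 by (simp add: div_greater_zero_iff)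
  then have "finite ?Q" using finite_divisors_nat by simp
  then have "0 < free_density ?Q" by (intro free_density_finite_pos) auto
  then have c: "0 < ?c"
    using taut_imp_free_density_gcd_quotients_pos[OF zero_notin assms(1) b db dltb] b0 d0 by simp
  \<comment> \<open>Starting the truncations at \<open>b\<close> keeps \<open>b\<close> in all of them.\<close>
  let ?C = "\<lambda>K. B \<inter> {..b + K}"
  let ?E = "\<lambda>K. {x \<in> space M. [\<theta> x b = r] (mod int b) \<and> free_at (?C K) x 0}"
  have sets: "?E K \<in> sets M" for K
    by (intro sets.sets_Collect_conj sets_\<theta>[OF b] sets_free_at) auto
  have lower: "?c \<le> prob (?E K)" for K
  proof -
    let ?L = "Lcm (?C K)" and ?A = "{n. [n = r] (mod int b)} \<inter> free_set (?C K)"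
    have L: "0 < ?L" using zero_notin by (intro Lcm_nat_pos) auto
    have bC: "b \<in> ?C K" using b by simp
    have "b dvd ?L" by (rule dvd_Lcm[OF bC])
    then have "periodic_set ?L {n. [n = r] (mod int b)}"
      unfolding periodic_set_def by (metis cong_dvd_modulus cong_sym cong_trans mem_Collect_eq of_nat_dvd_iff)
    then have per: "periodic_set ?L ?A"
      by (intro periodic_set_Int periodic_free_set dvd_Lcm)
    have "prob (?E K) = mean_density ?L ?A"
    proof (rule prob_eq_mean_density[OF _ _ per])
      fix x n assume n: "\<And>c. c \<in> ?C K \<Longrightarrow> [\<theta> x c = n] (mod int c)"
      have "free_at (?C K) x 0 \<longleftrightarrow> n \<in> free_set (?C K)"
        using free_at_iff_free_set[of "?C K" x n 0] n by simp
      moreover have "[\<theta> x b = r] (mod int b) \<longleftrightarrow> [n = r] (mod int b)"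
        using n[OF bC] by (auto simp: cong_def)
      ultimately show "([\<theta> x b = r] (mod int b) \<and> free_at (?C K) x 0) \<longleftrightarrow> n \<in> ?A" by simp
    qed auto
    moreover have "free_density ?Q * free_density (gcd_quotients d (?C K)) / (d * b) \<le> mean_density ?L ?A"
      by (rule mean_density_residue_class_lower_bound[OF L bC b0 dvd_Lcm d])
    moreover have "?c \<le> free_density ?Q * free_density (gcd_quotients d (?C K)) / (d * b)"
      unfolding gcd_quotients_def
      by (intro divide_right_mono mult_left_mono free_density_anti_subset image_mono free_density_nonneg) auto
    ultimately show ?thesis by linarith
  qed
  have "decseq ?E" unfolding decseq_def free_at_def by auto
  then have "(\<lambda>K. prob (?E K)) \<longlonglongrightarrow> prob (\<Inter>K. ?E K)"
    using sets by (intro finite_Lim_measure_decseq) auto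
  then have "?c \<le> prob (\<Inter>K. ?E K)"
    by (rule LIMSEQ_le_const) (use lower in blast)
  moreover have "(\<Inter>K. ?E K) = {x \<in> space M. [\<theta> x b = r] (mod int b) \<and> free_at B x 0}"
  proof (intro equalityI subsetI)
    fix x assume x: "x \<in> (\<Inter>K. ?E K)"
    have "\<not> int c dvd 0 + \<theta> x c" if "c \<in> B" for c
    proof -
      have "free_at (?C c) x 0" using x by blast
      then show ?thesis using that by (simp add: free_at_def)
    qed
    then show "x \<in> {x \<in> space M. [\<theta> x b = r] (mod int b) \<and> free_at B x 0}"
      using x by (auto simp: free_at_def)
  qed (auto simp: free_at_def)
  ultimately show ?thesis using c by simp
qed

end

section \<open>Topology and measurability in the full shift\<close>

lemma open_bi_seq_window:
  fixes U :: "bi_seq set"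
  assumes "open U" "x \<in> U"
  shows "\<exists>n::nat. \<forall>y. (\<forall>i\<in>{- int n..int n}. y i = x i) \<longrightarrow> y \<in> U"
proof -
  have "openin (product_topology (\<lambda>_::int. euclidean :: bool topology) UNIV) U"
    using assms(1) by (simp add: open_fun_def)
  from product_topology_open_contains_basis[OF this assms(2)]
  obtain X where X: "x \<in> (\<Pi>\<^sub>E i\<in>UNIV. X i)" "finite {i. X i \<noteq> (UNIV :: bool set)}" "(\<Pi>\<^sub>E i\<in>UNIV. X i) \<subseteq> U"
    by auto
  define n where "n = Max (insert 0 ((\<lambda>i. nat \<bar>i\<bar>) ` {i. X i \<noteq> UNIV}))"
  have n: "i \<in> {- int n..int n}" if "X i \<noteq> UNIV" for i
  proof -
    have "nat \<bar>i\<bar> \<le> n" unfolding n_def using X(2) that by (intro Max_ge) auto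
    then show ?thesis by auto
  qed
  have "y \<in> U" if y: "\<forall>i\<in>{- int n..int n}. y i = x i" for y
  proof -
    have "y i \<in> X i" for i using X(1) y n[of i] by (cases "X i = UNIV") auto
    then show ?thesis using X(3) by auto
  qed
  then show ?thesis by blast
qed

lemma open_coordinate: "open {x :: bi_seq. x i}"
proof -
  have "open ((\<lambda>x :: bi_seq. x i) -` {True})"
    by (intro open_vimage Topological_Spaces.open_discrete continuous_on_product_coordinates)
  then show ?thesis by (simp add: vimage_def)
qed

lemma sets_coordinate [measurable]: "{x :: bi_seq. x i} \<in> sets borel"
  by (rule borel_open[OF open_coordinate])

text \<open>
  Every open set is a union of countably many sets given by the pattern on a finite window.
\<close>

lemma measurable_bi_seqI:
  assumes f: "\<And>i. {w \<in> space M. f w i} \<in> sets M"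
  shows "f \<in> measurable M (borel :: bi_seq measure)"
proof (rule borel_measurableI)
  fix U :: "bi_seq set" assume U: "open U"
  define I where "I = {(n :: nat, S :: int set). finite S \<and> (\<forall>y. (\<forall>i\<in>{- int n..int n}. y i \<longleftrightarrow> i \<in> S) \<longrightarrow> y \<in> U)}"
  have "I \<subseteq> UNIV \<times> {S. finite S}" by (auto simp: I_def)
  then have I: "countable I"
    by (rule countable_subset) (intro countable_SIGMA countable_Collect_finite, simp)
  let ?V = "\<lambda>(n :: nat, S). {w \<in> space M. \<forall>i\<in>{- int n..int n}. f w i \<longleftrightarrow> i \<in> S}"
  have eq: "f -` U \<inter> space M = (\<Union>p\<in>I. ?V p)"
  proof (intro equalityI subsetI)
    fix w assume w: "w \<in> f -` U \<inter> space M"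
    then obtain n where n: "\<forall>y. (\<forall>i\<in>{- int n..int n}. y i = f w i) \<longrightarrow> y \<in> U"
      using open_bi_seq_window[OF U] by blast
    let ?S = "{i \<in> {- int n..int n}. f w i}"
    have "y \<in> U" if "\<forall>i\<in>{- int n..int n}. y i \<longleftrightarrow> i \<in> ?S" for y
    proof -
      have "\<forall>i\<in>{- int n..int n}. y i = f w i" using that by simp
      then show ?thesis using n by blast
    qed
    moreover have "finite ?S" by (rule finite_subset[of _ "{- int n..int n}"]) auto
    ultimately have "(n, ?S) \<in> I" unfolding I_def by blast
    moreover have "w \<in> ?V (n, ?S)" using w by auto
    ultimately show "w \<in> (\<Union>p\<in>I. ?V p)" by blast
  qed (auto simp: I_def)
  have "{w \<in> space M. f w i \<longleftrightarrow> i \<in> S} \<in> sets M" for i S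
    using f[of i] sets.sets_Collect_neg[OF f[of i]] by (cases "i \<in> S") auto
  then have "?V p \<in> sets M" for p
    by (cases p) (auto intro!: sets.sets_Collect_finite_All)
  then show "f -` U \<inter> space M \<in> sets M"
    unfolding eq using I by (intro sets.countable_UN'') auto
qed

lemma in_X_etaI:
  assumes "\<And>n::nat. \<exists>m. \<forall>i\<in>{- int n..int n}. x i = eta B (i + m)"
  shows "x \<in> X_eta B"
proof (rule ccontr)
  let ?O = "range (\<lambda>m. shift_pow m (eta B))"
  assume "x \<notin> X_eta B"
  then have "x \<in> - closure ?O" by (simp add: X_eta_def)
  moreover have "open (- closure ?O)" by (rule open_Compl[OF closed_closure])
  ultimately obtain n :: nat where n: "\<forall>y. (\<forall>i\<in>{- int n..int n}. y i = x i) \<longrightarrow> y \<in> - closure ?O"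
    using open_bi_seq_window by blast
  obtain m where "\<forall>i\<in>{- int n..int n}. x i = eta B (i + m)" using assms by blast
  then have "\<forall>i\<in>{- int n..int n}. shift_pow m (eta B) i = x i" by (simp add: shift_pow_def)
  then have "shift_pow m (eta B) \<in> - closure ?O" by (rule n[THEN spec, THEN mp])
  moreover have "shift_pow m (eta B) \<in> closure ?O" by (rule subsetD[OF closure_subset]) (rule rangeI)
  ultimately show False by simp
qed

text \<open>
  The points all of whose finite windows lie below a window of \<open>eta\<close> form a hereditary subshift that
  contains \<open>X_eta\<close>.
\<close>

lemma X_eta_her_window:
  assumes "x \<in> X_eta_her B" "finite F"
  obtains m where "\<And>i. i \<in> F \<Longrightarrow> x i \<Longrightarrow> eta B (i + m)"
proof -
  define W where "W = {x. \<forall>F. finite F \<longrightarrow> (\<exists>m. \<forall>i\<in>F. x i \<longrightarrow> eta B (i + m))}"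
  have "closed W"
    unfolding closed_def
  proof (subst open_subopen, intro ballI)
    fix x assume "x \<in> - W"
    then obtain F where "finite F" "\<not> (\<exists>m. \<forall>i\<in>F. x i \<longrightarrow> eta B (i + m))" unfolding W_def by auto
    then have F: "finite F" "\<And>m. \<exists>i\<in>F. x i \<and> \<not> eta B (i + m)" by auto
    let ?N = "\<Inter>i\<in>{i \<in> F. x i}. {y :: bi_seq. y i}"
    have "open ?N" using F(1) by (intro open_INT ballI open_coordinate) simp
    moreover have "?N \<subseteq> - W"
    proof
      fix y assume y: "y \<in> ?N"
      have "\<exists>i\<in>F. y i \<and> \<not> eta B (i + m)" for m using F(2)[of m] y by blast
      then show "y \<in> - W" using F(1) unfolding W_def by blast
    qed
    ultimately show "\<exists>T. open T \<and> x \<in> T \<and> T \<subseteq> - W" by (intro exI[of _ ?N]) auto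
  qed
  have shift: "shift_pow k x \<in> W" if "x \<in> W" for k x
    unfolding W_def
  proof (intro CollectI allI impI)
    fix F :: "int set" assume "finite F"
    then have "finite ((\<lambda>i. i + k) ` F)" by simp
    then obtain m where "\<forall>i\<in>(\<lambda>i. i + k) ` F. x i \<longrightarrow> eta B (i + m)" using \<open>x \<in> W\<close> unfolding W_def by blast
    then have "\<forall>i\<in>F. shift_pow k x i \<longrightarrow> eta B (i + (k + m))" by (simp add: shift_pow_def add.assoc)
    then show "\<exists>m. \<forall>i\<in>F. shift_pow k x i \<longrightarrow> eta B (i + m)" by blast
  qed
  have l: "lshift = shift_pow 1" by (simp add: fun_eq_iff lshift_def shift_pow_def)
  have "lshift ` W = W"
  proof (intro equalityI subsetI)
    fix x assume "x \<in> W"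
    then show "x \<in> lshift ` W"
      by (intro image_eqI[of _ _ "shift_pow (- 1) x"] shift) (auto simp: lshift_def shift_pow_def)
  next
    fix x assume "x \<in> lshift ` W"
    then show "x \<in> W" unfolding l using shift by blast
  qed
  then have "subshift W" using \<open>closed W\<close> by (simp add: subshift_def)
  moreover have "hereditary W"
    unfolding hereditary_def
  proof (intro ballI allI impI)
    fix x y assume x: "x \<in> W" and "y \<le> x"
    then have yx: "x i" if "y i" for i using that by (auto simp: le_fun_def)
    have "\<exists>m. \<forall>i\<in>F. y i \<longrightarrow> eta B (i + m)" if F: "finite F" for F
    proof -
      obtain m where "\<forall>i\<in>F. x i \<longrightarrow> eta B (i + m)" using x F unfolding W_def by auto
      then show ?thesis using yx by (intro exI[of _ m]) simp
    qed
    then show "y \<in> W" unfolding W_def by simp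
  qed
  moreover have "X_eta B \<subseteq> W"
    unfolding X_eta_def
  proof (rule closure_minimal[OF _ \<open>closed W\<close>])
    have "eta B \<in> W" unfolding W_def by (intro CollectI allI impI exI[of _ 0]) simp
    then show "range (\<lambda>m. shift_pow m (eta B)) \<subseteq> W" using shift by auto
  qed
  ultimately have "X_eta_her B \<subseteq> W" by (rule X_eta_her_smallest(4))
  then have "x \<in> W" using assms(1) by blast
  then have "\<exists>m. \<forall>i\<in>F. x i \<longrightarrow> eta B (i + m)"
    using assms(2) by (simp add: W_def)
  then obtain m where "\<forall>i\<in>F. x i \<longrightarrow> eta B (i + m)" by (rule exE)
  then show ?thesis using that[of m] by simp
qed

text \<open>
  The omitted class is that of \<open>- n\<close>; with this sign the shift adds one to \<open>n\<close>.
\<close>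

definition omits_class :: "nat \<Rightarrow> bi_seq \<Rightarrow> int \<Rightarrow> bool" where
  "omits_class b x n \<longleftrightarrow> (\<forall>i. x i \<longrightarrow> \<not> int b dvd i + n)"

lemma dvd_add_iff_mod_eq:
  assumes "0 < b"
  shows "int b dvd i + n \<longleftrightarrow> i mod int b = (- n) mod int b"
  by (simp add: mod_eq_dvd_iff)

lemma omits_class_iff:
  assumes "0 < b"
  shows "omits_class b x n \<longleftrightarrow> (- n) mod int b \<notin> (\<lambda>i. i mod int b) ` supp x"
proof -
  have "omits_class b x n \<longleftrightarrow> (\<forall>i\<in>supp x. (- n) mod int b \<noteq> i mod int b)"
    unfolding omits_class_def supp_def dvd_add_iff_mod_eq[OF assms] by (metis mem_Collect_eq)
  then show ?thesis by blast
qed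

lemma omits_class_cong:
  assumes "[n = n'] (mod int b)" "omits_class b x n"
  shows "omits_class b x n'"
  using assms(2) cong_dvd_iff[OF cong_add[OF cong_refl assms(1)]] unfolding omits_class_def by blast

lemma Y_set_omits_class:
  assumes x: "x \<in> Y_set B" and b: "b \<in> B" "0 < b"
  shows "\<exists>n. omits_class b x n"
    and "omits_class b x n \<Longrightarrow> omits_class b x n' \<Longrightarrow> [n = n'] (mod int b)"
proof -
  let ?I = "(\<lambda>i. i mod int b) ` supp x"
  have sub: "?I \<subseteq> {0..<int b}" using b by auto
  have "card ?I = b - 1" using x b by (simp add: Y_set_def)
  then have "card ({0..<int b} - ?I) = 1"
    using card_Diff_subset[OF finite_subset[OF sub] sub] b by simp
  then obtain c where c: "{0..<int b} - ?I = {c}" by (auto simp: card_1_singleton_iff)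
  have "c \<in> {0..<int b}" using c by blast
  then have "(- (- c)) mod int b = c" by simp
  then have "omits_class b x (- c)" unfolding omits_class_iff[OF b(2)] using c by auto
  then show "\<exists>n. omits_class b x n" by blast
  assume "omits_class b x n" "omits_class b x n'"
  then have "(- n) mod int b = c" "(- n') mod int b = c"
    using c b(2) unfolding omits_class_iff[OF b(2)] by auto
  then have "[- n = - n'] (mod int b)" by (simp add: cong_def)
  then show "[n = n'] (mod int b)" by (simp add: cong_minus_minus_iff)
qed

lemma Y_setI:
  assumes "\<And>b. b \<in> B \<Longrightarrow> 0 < b"
    and "\<And>b. b \<in> B \<Longrightarrow> omits_class b x (n b)"
    and "\<And>b r. b \<in> B \<Longrightarrow> \<not> int b dvd r \<Longrightarrow> \<exists>i. x i \<and> [i + n b = r] (mod int b)"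
  shows "x \<in> Y_set B"
  unfolding Y_set_def
proof (intro CollectI ballI)
  fix b assume b: "b \<in> B"
  let ?I = "(\<lambda>i. i mod int b) ` supp x"
  have "?I = {0..<int b} - {(- n b) mod int b}"
  proof (intro equalityI subsetI)
    fix c assume c: "c \<in> ?I"
    then have "c \<in> {0..<int b}" using assms(1)[OF b] by auto
    moreover have "(- n b) mod int b \<notin> ?I" using assms(2)[OF b] unfolding omits_class_iff[OF assms(1)[OF b]] .
    ultimately show "c \<in> {0..<int b} - {(- n b) mod int b}" using c by blast
  next
    fix c assume c: "c \<in> {0..<int b} - {(- n b) mod int b}"
    then have "c mod int b \<noteq> (- n b) mod int b" by auto
    then have "\<not> int b dvd c + n b" using dvd_add_iff_mod_eq[OF assms(1)[OF b]] by blast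
    then obtain i where i: "x i" "[i + n b = c + n b] (mod int b)" using assms(3)[OF b] by blast
    then have "i mod int b = c" using c by (simp add: cong_add_rcancel) (simp add: cong_def)
    then show "c \<in> ?I" using i by (auto simp: supp_def)
  qed
  then show "card ?I = b - 1" using assms(1)[OF b] by simp
qed

lemma sets_Y_set:
  assumes "0 \<notin> B"
  shows "Y_set B \<in> sets (borel :: bi_seq measure)"
proof -
  have sets: "{x :: bi_seq. card ((\<lambda>n. n mod int b) ` supp x) = b - 1} \<in> sets borel" if "b \<in> B" for b
  proof -
    have b: "0 < b" using assms that by (metis gr0I)
    let ?I = "\<lambda>x :: bi_seq. (\<lambda>n. n mod int b) ` supp x"
    let ?U = "\<lambda>S. \<Inter>c\<in>{0..<int b}. {x. c \<in> ?I x \<longleftrightarrow> c \<in> S}" and ?S = "{S. S \<subseteq> {0..<int b} \<and> card S = b - 1}"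
    have sub: "?I x \<subseteq> {0..<int b}" for x using b by auto
    have "{x. c \<in> ?I x} = (\<Union>n\<in>{n. n mod int b = c}. {x. x n})" for c
      by (auto simp: supp_def)
    then have c: "{x. c \<in> ?I x} \<in> sets borel" for c
      by (simp only:) (intro sets.countable_UN', auto)
    have "{x. c \<in> ?I x \<longleftrightarrow> c \<in> S} \<in> sets borel" for c S
      using c[of c] sets.compl_sets[OF c[of c]] by (cases "c \<in> S") (auto simp: Collect_neg_eq Compl_eq_Diff_UNIV)
    then have "?U S \<in> sets borel" for S
      using b by (intro sets.finite_INT) auto
    then have "(\<Union>S\<in>?S. ?U S) \<in> sets borel"
      by (intro sets.finite_UN) auto
    also have "(\<Union>S\<in>?S. ?U S) = {x. card (?I x) = b - 1}"
    proof (intro equalityI subsetI)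
      fix x assume "x \<in> {x. card (?I x) = b - 1}"
      then show "x \<in> (\<Union>S\<in>?S. ?U S)"
        using sub[of x] by (intro UN_I[of "?I x"]) auto
    next
      fix x assume "x \<in> (\<Union>S\<in>?S. ?U S)"
      then obtain S where "S \<in> ?S"
        and x: "x \<in> ?U S" by (rule UN_E)
      then have S: "S \<subseteq> {0..<int b}" "card S = b - 1" by simp_all
      have mem: "c \<in> ?I x \<longleftrightarrow> c \<in> S" if "c \<in> {0..<int b}" for c
        using INT_D[OF x that] by (rule CollectD)
      have "?I x = S"
        using mem subsetD[OF S(1)] subsetD[OF sub[of x]] by (intro equalityI subsetI) metis+
      then show "x \<in> {x. card (?I x) = b - 1}" using S by simp
    qed
    finally show ?thesis .
  qed
  have "Y_set B = (\<Inter>b\<in>B. {x. card ((\<lambda>n. n mod int b) ` supp x) = b - 1})"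
    by (auto simp: Y_set_def)
  then show ?thesis using sets by (cases "B = {}") (auto intro!: sets.countable_INT')
qed

section \<open>Invariant measures, the Mirsky measure and tautness\<close>

lemma lshift_apply: "lshift x i = x (i + 1)"
  by (simp add: lshift_def)

lemma lshift_Y_X_eta_her:
  assumes "0 \<notin> B"
  shows "lshift x \<in> Y_set B \<inter> X_eta_her B \<longleftrightarrow> x \<in> Y_set B \<inter> X_eta_her B"
proof -
  have supp: "supp (lshift x) = (\<lambda>n. n - 1) ` supp x"
    by (force simp: supp_def lshift_apply)
  have "card ((\<lambda>n. n mod int b) ` supp (lshift x)) = card ((\<lambda>n. n mod int b) ` supp x)" if "b \<in> B" for b
  proof -
    have "(\<lambda>n. n mod int b) ` supp (lshift x) = (\<lambda>c. (c - 1) mod int b) ` (\<lambda>n. n mod int b) ` supp x"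
      unfolding supp by (simp add: image_image mod_simps)
    moreover have "inj_on (\<lambda>c. (c - 1) mod int b) ((\<lambda>n. n mod int b) ` supp x)"
    proof (rule inj_onI)
      fix c d assume cd: "c \<in> (\<lambda>n. n mod int b) ` supp x" "d \<in> (\<lambda>n. n mod int b) ` supp x"
        "(c - 1) mod int b = (d - 1) mod int b"
      then have "[c - 1 = d - 1] (mod int b)" by (simp add: cong_def)
      then have "[c - 1 + 1 = d - 1 + 1] (mod int b)" by (rule cong_add[OF _ cong_refl])
      then show "c = d" using cd by (auto simp: cong_def)
    qed
    ultimately show ?thesis by (simp add: card_image)
  qed
  then have "lshift x \<in> Y_set B \<longleftrightarrow> x \<in> Y_set B" by (simp add: Y_set_def)
  moreover have "lshift ` X_eta_her B = X_eta_her B"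
    using X_eta_her_smallest(1)[of B] by (simp add: subshift_def)
  then have "lshift x \<in> X_eta_her B \<longleftrightarrow> x \<in> X_eta_her B"
    using bij_lshift by (metis bij_def inj_image_mem_iff)
  ultimately show ?thesis by simp
qed

text \<open>
  The negatives of the omitted classes form an equivariant map to the odometer. If \<open>B\<close> is not taut, then for some
  proper divisor \<open>d\<close> of \<open>b\<close> almost every point with \<open>\<theta> x b\<close> divisible by \<open>d\<close> also has \<open>\<theta> x c\<close>
  divisible by some other \<open>c\<close>, and therefore vanishes at \<open>0\<close>. By invariance almost every point vanishes
  at all \<open>i\<close> for which \<open>d\<close> divides \<open>i + \<theta> x b\<close>, so it omits the two classes modulo \<open>b\<close> given by \<open>\<theta> x b\<close> and
  \<open>\<theta> x b - d\<close>.
\<close>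

theorem invariant_prob_imp_taut:
  assumes B: "0 \<notin> B" "primitive_set B" and ne: "invariant_probs (Y_set B \<inter> X_eta_her B) \<noteq> {}"
  shows "taut B"
proof (rule ccontr)
  assume "\<not> taut B"
  then obtain b d where b: "b \<in> B" "d dvd b" "d < b" and zero: "free_density (gcd_quotients d (B - {b})) = 0"
    using not_taut_imp_free_density_eq_0 B by blast
  have cong_dvd: "[m = n] (mod int d)" if "[m = n] (mod int b)" for m n
    by (rule cong_dvd_modulus[OF that]) (use b(2) in simp)
  have pos: "0 < c" if "c \<in> B" for c using B that by (metis gr0I)
  let ?Z = "Y_set B \<inter> X_eta_her B"
  obtain M where M: "prob_space M" "sets M = sets (restrict_space borel ?Z)"
    "lshift \<in> measurable M M" "distr M M lshift = M"
    using ne by (auto simp: invariant_probs_def)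
  have space: "space M = ?Z"
    using sets_eq_imp_space_eq[OF M(2)] by (simp add: space_restrict_space)
  have sets_M: "{x \<in> space M. P x} \<in> sets M" if "{x. P x} \<in> sets borel" for P
  proof -
    have "{x \<in> space M. P x} = ?Z \<inter> {x. P x}" using space by auto
    then show ?thesis unfolding M(2) sets_restrict_space using that by auto
  qed
  define \<theta> where "\<theta> x c = (SOME n. omits_class c x n)" for x c
  have \<theta>: "omits_class c x (\<theta> x c)" if "x \<in> space M" "c \<in> B" for x c
    unfolding \<theta>_def by (rule someI_ex, rule Y_set_omits_class(1)[of x B c]) (use that space pos in auto)
  have \<theta>_iff: "[\<theta> x c = n] (mod int c) \<longleftrightarrow> omits_class c x n" if "x \<in> space M" "c \<in> B" for x c n
    using omits_class_cong[OF _ \<theta>[OF that]] Y_set_omits_class(2)[OF _ that(2) pos[OF that(2)] \<theta>[OF that]] that(1) space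
    by blast
  interpret odometer_factor M lshift \<theta> B
  proof (intro odometer_factor.intro odometer_factor_axioms.intro)
    show "prob_space M" "0 \<notin> B" "lshift \<in> measurable M M" "distr M M lshift = M" by fact+
  next
    fix x c assume x: "x \<in> space M" "c \<in> B"
    have lx: "lshift x \<in> space M" using measurable_space[OF M(3) x(1)] .
    have "omits_class c (lshift x) (\<theta> x c + 1)"
      unfolding omits_class_def lshift_apply
    proof (intro allI impI)
      fix i assume "x (i + 1)"
      then have "\<not> int c dvd (i + 1) + \<theta> x c" using \<theta>[OF x] unfolding omits_class_def by blast
      then show "\<not> int c dvd i + (\<theta> x c + 1)" by (simp add: algebra_simps)
    qed
    then show "[\<theta> (lshift x) c = \<theta> x c + 1] (mod int c)" using \<theta>_iff[OF lx x(2)] by blast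
  next
    fix c r assume c: "c \<in> B"
    have "{x. omits_class c x r} = (\<Inter>i\<in>{i. int c dvd i + r}. UNIV - {x. x i})"
      by (auto simp: omits_class_def)
    also have "\<dots> \<in> sets borel"
    proof (rule sets.countable_INT')
      have "int c dvd - r + r" by simp
      then show "{i. int c dvd i + r} \<noteq> {}" by blast
    qed (auto intro: sets.Diff)
    finally have "{x \<in> space M. omits_class c x r} \<in> sets M" by (rule sets_M)
    then show "{x \<in> space M. [\<theta> x c = r] (mod int c)} \<in> sets M"
      using \<theta>_iff[OF _ c] by (simp cong: conj_cong)
  next
    fix x C assume x: "x \<in> space M" and C: "finite C" "C \<subseteq> B"
    let ?I = "\<lambda>c. (\<lambda>n. n mod int c) ` supp x"
    \<comment> \<open>Finitely many places of \<open>x\<close> witness all nonomitted classes; a translate of \<open>eta\<close> dominating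
      \<open>x\<close> there omits the same classes.\<close>
    have "\<forall>c\<in>C. \<exists>F. F \<subseteq> supp x \<and> finite F \<and> (\<lambda>n. n mod int c) ` F = ?I c"
    proof
      fix c assume "c \<in> C"
      then have c: "0 < c" using pos C by blast
      have "finite (?I c)"
        by (rule finite_subset[of _ "{0..<int c}"]) (use c in auto)
      from finite_subset_image[OF this order_refl]
      obtain F where F: "F \<subseteq> supp x" "finite F" "?I c = (\<lambda>n. n mod int c) ` F"
        by blast
      then show "\<exists>F. F \<subseteq> supp x \<and> finite F \<and> (\<lambda>n. n mod int c) ` F = ?I c"
        by (intro exI[of _ F]) simp
    qed
    then obtain F where F: "\<And>c. c \<in> C \<Longrightarrow> F c \<subseteq> supp x \<and> finite (F c) \<and> (\<lambda>n. n mod int c) ` F c = ?I c"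
      by metis
    have "x \<in> X_eta_her B" using x space by blast
    moreover have "finite (\<Union>c\<in>C. F c)" using C F by blast
    ultimately obtain m where m: "\<And>i. i \<in> (\<Union>c\<in>C. F c) \<Longrightarrow> x i \<Longrightarrow> eta B (i + m)"
      using X_eta_her_window by blast
    have "[\<theta> x c = m] (mod int c)" if c: "c \<in> C" for c
    proof -
      have cB: "c \<in> B" using c C by blast
      have "omits_class c x m"
        unfolding omits_class_def
      proof (intro allI impI)
        fix i assume "x i"
        then have "i mod int c \<in> (\<lambda>n. n mod int c) ` F c" using F[OF c] by (simp add: supp_def)
        then obtain j where j: "j \<in> F c" "i mod int c = j mod int c" by blast
        then have "x j" using F[OF c] by (auto simp: supp_def)
        then have "eta B (j + m)" using m j c by blast
        then have "\<not> int c dvd j + m" using cB by (simp add: eta_def free_set_iff)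
        moreover have "[i + m = j + m] (mod int c)" using j by (intro cong_add cong_refl) (simp add: cong_def)
        ultimately show "\<not> int c dvd i + m" using cong_dvd_iff by blast
      qed
      then show ?thesis using \<theta>_iff[OF x cB] by blast
    qed
    then show "\<exists>n. \<forall>c\<in>C. [\<theta> x c = n] (mod int c)" by blast
  qed
  \<comment> \<open>The preimage of \<open>N i\<close> under the shift is \<open>N (i + 1)\<close>, so all these sets have the same probability, also for
    negative \<open>i\<close>.\<close>
  define N where "N i = {x \<in> space M. int d dvd i + \<theta> x b \<and> x i}" for i
  have dvd_sets: "{x \<in> space M. int d dvd i + \<theta> x b} \<in> sets M" for i
  proof (rule sets_periodic[of "{b}" "{n. int d dvd i + n}"])
    show "periodic_set (Lcm {b}) {n. int d dvd i + n}"
      by (rule periodic_dvd_add) (use b(2) in simp)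
    fix x n assume "\<And>c. c \<in> {b} \<Longrightarrow> [\<theta> x c = n] (mod int c)"
    then have "[\<theta> x b = n] (mod int b)" by simp
    then have "[\<theta> x b = n] (mod int d)" by (rule cong_dvd)
    then have "[i + \<theta> x b = i + n] (mod int d)" by (rule cong_add[OF cong_refl])
    then show "int d dvd i + \<theta> x b \<longleftrightarrow> n \<in> {n. int d dvd i + n}" using cong_dvd_iff by blast
  qed (use b in auto)
  have N: "N i \<in> sets M" for i
    using sets.sets_Collect_conj[OF sets_M[OF sets_coordinate] dvd_sets] unfolding N_def .
  have step: "prob (N (i + 1)) = prob (N i)" for i
  proof -
    have "N (i + 1) = {x \<in> space M. lshift x \<in> N i}"
    proof -
      have "int d dvd i + \<theta> (lshift x) b \<longleftrightarrow> int d dvd (i + 1) + \<theta> x b" if x: "x \<in> space M" for x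
      proof (rule cong_dvd_iff)
        have "[\<theta> (lshift x) b = \<theta> x b + 1] (mod int d)"
          using \<theta>_T[OF x b(1)] by (rule cong_dvd)
        then have "[i + \<theta> (lshift x) b = i + (\<theta> x b + 1)] (mod int d)" by (rule cong_add[OF cong_refl])
        then show "[i + \<theta> (lshift x) b = i + 1 + \<theta> x b] (mod int d)" by (simp add: algebra_simps)
      qed
      then show ?thesis using T_space by (auto simp: N_def lshift_apply)
    qed
    then show ?thesis using prob_vimage_T[OF N] by simp
  qed
  let ?E = "{x \<in> space M. int d dvd \<theta> x b \<and> (\<forall>c\<in>B - {b}. \<not> int c dvd \<theta> x c)}"
  have "prob (N 0) \<le> prob ?E"
  proof (rule finite_measure_mono)
    show "N 0 \<subseteq> ?E"
    proof
      fix x assume x: "x \<in> N 0"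
      then have "\<not> int c dvd 0 + \<theta> x c" if "c \<in> B" for c
        using \<theta>[of x c] that unfolding N_def omits_class_def by blast
      then show "x \<in> ?E"
        using x by (simp add: N_def)
    qed
    have "{x \<in> space M. \<forall>c\<in>B - {b}. \<not> int c dvd \<theta> x c} \<in> sets M"
      using sets_free_at[of "B - {b}" 0] by (auto simp: free_at_def)
    moreover have "{x \<in> space M. int d dvd \<theta> x b} \<in> sets M"
      using dvd_sets[of 0] by simp
    ultimately show "?E \<in> sets M"
      by (intro sets.sets_Collect_conj)
  qed
  also have "\<dots> = 0" by (rule prob_free_multiples_eq_0[OF _ b(1,2) zero]) auto
  finally have N0: "prob (N 0) = 0" by (simp add: measure_le_0_iff)
  have "prob (N i) = 0" for i
  proof (induction i rule: int_induct[where k = 0])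
    case (step2 i)
    then show ?case using step[of "i - 1"] by simp
  qed (use N0 step in simp_all)
  then have "N i \<in> null_sets M" for i
    using N by (intro null_setsI) (simp_all add: emeasure_eq_measure)
  then have "(\<Union>i. N i) \<in> null_sets M" by (rule null_sets_UN)
  then have "(\<Union>i. N i) \<noteq> space M" using emeasure_space_1 by auto
  then obtain x where x: "x \<in> space M" "\<And>i. x \<notin> N i"
    using sets.sets_into_space[OF N] by blast
  have "omits_class b x (\<theta> x b - int d)"
    unfolding omits_class_def
  proof (intro allI impI notI)
    fix i assume i: "x i" "int b dvd i + (\<theta> x b - int d)"
    have "int d dvd i + (\<theta> x b - int d)" using dvd_trans[OF _ i(2)] b(2) by simp
    then have "int d dvd i + (\<theta> x b - int d) + int d" by (rule dvd_add) simp
    then have "int d dvd i + \<theta> x b" by simp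
    then show False using x i by (auto simp: N_def)
  qed
  then have "[\<theta> x b = \<theta> x b - int d] (mod int b)" using \<theta>_iff[OF x(1) b(1)] by blast
  then have "int b dvd int d" by (simp add: cong_iff_dvd_diff)
  then have "b \<le> d" using b(2) pos[OF b(1)] by (intro dvd_imp_le) (auto intro!: Nat.gr0I)
  then show False using b(3) by simp
qed

context odometer
begin

sublocale haar: odometer_factor "odometer_haar B" unit_rotation "\<lambda>g. g" B
  by (rule odometer_haar(1))

lemma space_haar: "space (odometer_haar B) = G"
  using sets_eq_imp_space_eq[OF odometer_haar(2)] space_odometer_space by simp

lemma phi_eq_free_at: "phi B g = haar.free_at B g"
  by (simp add: fun_eq_iff phi_def haar.free_at_def cong_iff_dvd_diff)

lemma measurable_phi: "phi B \<in> measurable (odometer_haar B) borel"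
  unfolding phi_eq_free_at[abs_def] by (intro measurable_bi_seqI haar.sets_free_at) auto

text \<open>
  Only countably many patterns on windows exist, and each one absent from \<open>eta\<close> has probability zero.
\<close>

lemma AE_phi_in_X_eta: "AE g in odometer_haar B. phi B g \<in> X_eta B"
proof -
  let ?W = "\<lambda>n :: nat. {- int n..int n}"
  define bad where "bad = {(n :: nat, S :: int set). finite S \<and> \<not> (\<exists>m. \<forall>i\<in>?W n. m + i \<in> free_set B \<longleftrightarrow> i \<in> S)}"
  have "bad \<subseteq> UNIV \<times> {S. finite S}" by (auto simp: bad_def)
  then have "countable bad"
    by (rule countable_subset) (intro countable_SIGMA countable_Collect_finite, simp)
  have "AE g in odometer_haar B. \<not> (\<forall>i\<in>?W (fst p). phi B g i \<longleftrightarrow> i \<in> snd p)" if "p \<in> bad" for p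
  proof -
    let ?E = "{g \<in> space (odometer_haar B). \<forall>i\<in>?W (fst p). haar.free_at B g i \<longleftrightarrow> i \<in> snd p}"
    have "{g \<in> space (odometer_haar B). haar.free_at B g i \<longleftrightarrow> i \<in> snd p} \<in> sets (odometer_haar B)" for i
      using haar.sets_free_at[of B i] sets.sets_Collect_neg[OF haar.sets_free_at[of B i]] by (cases "i \<in> snd p") auto
    then have "?E \<in> sets (odometer_haar B)" by (intro sets.sets_Collect_finite_All) auto
    moreover have "haar.prob ?E = 0"
      using that by (intro haar.prob_absent_pattern) (auto simp: bad_def)
    ultimately have "?E \<in> null_sets (odometer_haar B)"
      by (simp add: null_setsI haar.emeasure_eq_measure)
    then show ?thesis
      unfolding phi_eq_free_at by (rule AE_I') auto
  qed
  then have "AE g in odometer_haar B. \<forall>p\<in>bad. \<not> (\<forall>i\<in>?W (fst p). phi B g i \<longleftrightarrow> i \<in> snd p)"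
    using \<open>countable bad\<close> by (simp add: AE_ball_countable)
  then show ?thesis
  proof eventually_elim
    case (elim g)
    show ?case
    proof (rule in_X_etaI)
      fix n :: nat
      let ?S = "{i \<in> ?W n. phi B g i}"
      have "finite ?S" by (rule finite_subset[of _ "?W n"]) auto
      moreover have "\<forall>i\<in>?W (fst (n, ?S)). phi B g i \<longleftrightarrow> i \<in> snd (n, ?S)" by simp
      ultimately obtain m where "\<forall>i\<in>?W n. m + i \<in> free_set B \<longleftrightarrow> i \<in> ?S"
        using elim unfolding bad_def by blast
      then show "\<exists>m. \<forall>i\<in>?W n. phi B g i = eta B (i + m)"
        by (intro exI[of _ m]) (simp add: eta_def add.commute)
    qed
  qed
qed

text \<open>
  The event that some position is free and lies in a prescribed class other than the omitted one is invariant.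
  It has positive probability by tautness, hence probability one by ergodicity.
\<close>

lemma AE_phi_in_Y_set:
  assumes "taut B"
  shows "AE g in odometer_haar B. phi B g \<in> Y_set B"
proof -
  have "AE g in odometer_haar B. \<exists>i. haar.free_at B g i \<and> [i + g b = r] (mod int b)"
    if b: "b \<in> B" and r: "\<not> int b dvd r" for b r
  proof -
    define J where "J = {g \<in> space (odometer_haar B). \<exists>i. haar.free_at B g i \<and> [i + g b = r] (mod int b)}"
    have cong: "[i + k = r] (mod int b) \<longleftrightarrow> [k = r - i] (mod int b)" for i k
      by (simp add: cong_iff_dvd_diff algebra_simps)
    have J: "J \<in> sets (odometer_haar B)"
      unfolding J_def cong using b
      by (intro sets.sets_Collect_countable_Ex sets.sets_Collect_conj haar.sets_free_at haar.sets_\<theta>) auto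
    have "haar.free_at B (unit_rotation g) i \<and> [i + unit_rotation g b = r] (mod int b)
       \<longleftrightarrow> haar.free_at B g (i + 1) \<and> [(i + 1) + g b = r] (mod int b)" if g: "g \<in> space (odometer_haar B)" for g i
    proof -
      have "[i + unit_rotation g b = i + (g b + 1)] (mod int b)"
        by (rule cong_add[OF cong_refl haar.\<theta>_T[OF g b]])
      then have "[i + unit_rotation g b = r] (mod int b) \<longleftrightarrow> [(i + 1) + g b = r] (mod int b)"
        by (simp add: cong_def algebra_simps)
      then show ?thesis using haar.free_at_T[OF g order_refl] by simp
    qed
    then have "unit_rotation g \<in> J \<longleftrightarrow> g \<in> J" if "g \<in> space (odometer_haar B)" for g
      using that haar.T_space[OF that] unfolding J_def by simp (metis diff_add_cancel)
    then have inv: "unit_rotation -` J \<inter> G = J"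
      using space_haar by (auto simp: J_def)
    have "{g \<in> space (odometer_haar B). [g b = r] (mod int b) \<and> haar.free_at B g 0} \<subseteq> J"
      unfolding J_def by (auto intro!: exI[of _ 0])
    then have "0 < haar.prob J"
      using haar.prob_free_residue_class_pos[OF assms b r] haar.finite_measure_mono[OF _ J] by (meson less_le_trans)
    then have "haar.prob J = 1" using rotation_ergodic[OF odometer_haar J inv] by auto
    then have "AE g in odometer_haar B. g \<in> J" using haar.prob_eq_1[OF J] by simp
    then show ?thesis by (auto simp: J_def)
  qed
  then have "AE g in odometer_haar B. \<forall>b\<in>B. \<forall>r\<in>{r. \<not> int b dvd r}. \<exists>i. haar.free_at B g i \<and> [i + g b = r] (mod int b)"
    by (intro AE_ball_countable') auto
  then show ?thesis
  proof eventually_elim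
    case (elim g)
    show ?case
      unfolding phi_eq_free_at
    proof (rule Y_setI[where n = g])
      show "omits_class b (haar.free_at B g) (g b)" if "b \<in> B" for b
        using that by (auto simp: omits_class_def haar.free_at_def)
    qed (use elim pos in auto)
  qed
qed

lemma prob_space_mirsky: "prob_space (mirsky B)"
  unfolding mirsky_def by (rule haar.prob_space_distr[OF measurable_phi])

lemma sets_mirsky: "sets (mirsky B) = sets borel"
  by (simp add: mirsky_def)

theorem taut_imp_mirsky_Y_set:
  assumes "taut B"
  shows "measure (mirsky B) (Y_set B \<inter> X_eta B) = 1"
proof -
  interpret prob_space "mirsky B" by (rule prob_space_mirsky)
  define A where "A = Y_set B \<inter> X_eta B"
  have sets: "A \<in> sets borel"
    unfolding A_def by (rule sets.Int[OF sets_Y_set[OF zero_notin] borel_closed]) (simp add: X_eta_def)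
  have "AE g in odometer_haar B. phi B g \<in> A"
    using AE_phi_in_Y_set[OF assms] AE_phi_in_X_eta unfolding A_def by eventually_elim simp
  then have "AE x in mirsky B. x \<in> A"
    unfolding mirsky_def using sets by (subst AE_distr_iff[OF measurable_phi]) auto
  then show ?thesis using prob_eq_1[of A] sets by (simp add: sets_mirsky A_def)
qed

lemma measurable_lshift: "lshift \<in> measurable borel (borel :: bi_seq measure)"
  by (rule measurable_bi_seqI) (simp add: lshift_apply sets_coordinate)

lemma distr_mirsky_lshift: "distr (mirsky B) borel lshift = mirsky B"
proof -
  have "lshift (phi B g) = phi B (unit_rotation g)" if "g \<in> space (odometer_haar B)" for g
    using haar.free_at_T[OF that order_refl] by (simp add: phi_eq_free_at fun_eq_iff lshift_apply)
  then have "distr (mirsky B) borel lshift = distr (odometer_haar B) borel (phi B \<circ> unit_rotation)"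
    unfolding mirsky_def distr_distr[OF measurable_lshift measurable_phi]
    by (intro distr_cong) auto
  also have "\<dots> = distr (distr (odometer_haar B) (odometer_haar B) unit_rotation) borel (phi B)"
    by (rule distr_distr[OF measurable_phi haar.measurable_T, symmetric])
  also have "\<dots> = mirsky B" by (simp add: haar.distr_T mirsky_def)
  finally show ?thesis .
qed

theorem mirsky_Y_set_imp_invariant_prob:
  assumes "measure (mirsky B) (Y_set B \<inter> X_eta B) = 1"
  shows "invariant_probs (Y_set B \<inter> X_eta_her B) \<noteq> {}"
proof -
  interpret prob_space "mirsky B" by (rule prob_space_mirsky)
  let ?Z = "Y_set B \<inter> X_eta_her B"
  have Z: "?Z \<in> sets (mirsky B)"
    unfolding sets_mirsky using X_eta_her_smallest(1)[of B]
    by (intro sets.Int[OF sets_Y_set[OF zero_notin] borel_closed]) (simp add: subshift_def)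
  have "prob (Y_set B \<inter> X_eta B) \<le> prob ?Z"
    using X_eta_her_smallest(3)[of B] by (intro finite_measure_mono Z) auto
  then have Z1: "prob ?Z = 1" using assms prob_le_1[of ?Z] by linarith
  let ?M = "restrict_space (mirsky B) ?Z"
  have sets: "sets ?M = sets (restrict_space borel ?Z)"
    by (simp add: sets_restrict_space sets_mirsky)
  have space: "space ?M = ?Z" using sets.sets_into_space[OF Z] by (auto simp: space_restrict_space)
  have emeasure: "emeasure ?M A = emeasure (mirsky B) A" if "A \<subseteq> ?Z" for A
    using Z that by (intro emeasure_restrict_space) (auto simp: Int_absorb2 dest: sets.sets_into_space)
  have inv: "lshift x \<in> ?Z \<longleftrightarrow> x \<in> ?Z" for x by (rule lshift_Y_X_eta_her[OF zero_notin])
  have lshift_M: "lshift \<in> measurable (mirsky B) (mirsky B)"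
    using measurable_lshift measurable_cong_sets[OF sets_mirsky sets_mirsky] by blast
  have meas: "lshift \<in> measurable ?M ?M"
  proof (rule measurable_restrict_space2)
    show "lshift \<in> space ?M \<rightarrow> ?Z" using inv space by auto
    show "lshift \<in> measurable ?M (mirsky B)" by (rule measurable_restrict_space1[OF lshift_M])
  qed
  have "prob_space ?M"
    by (rule prob_spaceI) (simp add: space emeasure emeasure_eq_measure Z1)
  moreover have "distr ?M ?M lshift = ?M"
  proof (rule measure_eqI)
    fix A assume "A \<in> sets (distr ?M ?M lshift)"
    then have A: "A \<in> sets ?M" by simp
    then have AZ: "A \<subseteq> ?Z" using sets.sets_into_space[OF A] space by simp
    have AM: "A \<in> sets borel" using A Z by (auto simp: sets_restrict_space sets_mirsky)
    have "emeasure (distr ?M ?M lshift) A = emeasure ?M (lshift -` A \<inter> space ?M)"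
      by (rule emeasure_distr[OF meas A])
    also have "lshift -` A \<inter> space ?M = lshift -` A" using AZ inv space by auto
    also have "emeasure ?M (lshift -` A) = emeasure (mirsky B) (lshift -` A)"
      using AZ inv by (intro emeasure) auto
    also have "\<dots> = emeasure (distr (mirsky B) borel lshift) A"
      using emeasure_distr[of lshift "mirsky B" borel A] lshift_M AM
      by (simp add: sets_eq_imp_space_eq[OF sets_mirsky] measurable_cong_sets[OF refl sets_mirsky])
    also have "\<dots> = emeasure ?M A" using emeasure[OF AZ] by (simp add: distr_mirsky_lshift)
    finally show "emeasure (distr ?M ?M lshift) A = emeasure ?M A" .
  qed simp
  ultimately have "?M \<in> invariant_probs ?Z"
    using sets meas by (simp add: invariant_probs_def)
  then show ?thesis by blast
qed

end

theorem theorem8: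
  fixes B :: "nat set"
  assumes "0 \<notin> B" and "infinite B" and "primitive_set B"
  shows "(taut B \<longleftrightarrow> invariant_probs (Y_set B \<inter> X_eta_her B) \<noteq> {}) \<and>
         (taut B \<longleftrightarrow> measure (mirsky B) (Y_set B \<inter> X_eta B) = 1)"
proof -
  interpret odometer B by standard (rule assms(1))
  show ?thesis
    using taut_imp_mirsky_Y_set mirsky_Y_set_imp_invariant_prob invariant_prob_imp_taut[OF assms(1,3)] by blast
qed

end
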